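(* Let $D$ be a domain in $\mathbb R^n$, $n\ge2$, let $Q:D\to[0,\infty]$ be measurable with $Q\in L^1_{\rm loc}(D)$, let $a,b\in D$ and $\delta>0$. Then the class $\mathfrak K^{\delta}_{a,b,Q}$ is closed under locally uniform convergence: if $f_m\in\mathfrak K^{\delta}_{a,b,Q}$ and $f_m\to f:D\to\overline{\mathbb R^n}$ locally uniformly in $D$ with respect to the chordal metric $h$, then $f$ is a homeomorphism of $D$ into $\overline{\mathbb R^n}$ satisfying the ring $Q$-inequality at every $x_0\in D$ for radii in $(0,\mathrm{dist}(x_0,\partial D))$, and $h(f(a),f(b))\ge\delta$; that is, $f\in\mathfrak K^{\delta}_{a,b,Q}$.
   Context: $\overline{\mathbb R^n}$ carries the chordal metric $h(x,y)=\frac{|x-y|}{\sqrt{1+|x|^2}\sqrt{1+|y|^2}}$, $h(x,\infty)=\frac{1}{\sqrt{1+|x|^2}}$. $S(x_0,r)=\{|x-x_0|=r\}$, $A(x_0,r_1,r_2)=\{r_1<|x-x_0|<r_2\}$. $\Gamma(E,F,G)$: paths $\gamma:[a,b]\to\overline{\mathbb R^n}$ with $\gamma(a)\in E$, $\gamma(b)\in F$, $\gamma(t)\in G$ for $a<t<b$; $f(\Gamma)=\{f\circ\gamma\}$; $M$ = conformal $n$-modulus. Ring $Q$-inequality at $x_0$ for radii in $(0,R)$ (with $Q:=0$ outside $D$): $M(f(\Gamma(S(x_0,r_1),S(x_0,r_2),D)))\le\int_{A(x_0,r_1,r_2)\cap D}Q(x)\eta^n(|x-x_0|)\,dm(x)$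 for all $0<r_1<r_2<R$ and all measurable $\eta:(r_1,r_2)\to[0,\infty]$ with $\int_{r_1}^{r_2}\eta\,dr\ge1$. $\mathfrak K^{\delta}_{a,b,Q}$: the class of all homeomorphisms $f:D\to\overline{\mathbb R^n}$ satisfying the ring $Q$-inequality at every $x_0\in D$ for radii in $(0,\mathrm{dist}(x_0,\partial D))$ and such that $h(f(a),f(b))\ge\delta$. *)

theory Defs
  imports "HOL-Analysis.Analysis"
begin

text \<open>Extended space: None represents the point at infinity.\<close>
type_synonym 'n ext = "(real^'n) option"

definition chordal :: "'n::finite ext \<Rightarrow> 'n ext \<Rightarrow> real" where
  "chordal p q = (case (p, q) of
      (Some x, Some y) \<Rightarrow> norm (x - y) / (sqrt (1 + (norm x)\<^sup>2) * sqrt (1 + (norm y)\<^sup>2))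
    | (Some x, None) \<Rightarrow> 1 / sqrt (1 + (norm x)\<^sup>2)
    | (None, Some y) \<Rightarrow> 1 / sqrt (1 + (norm y)\<^sup>2)
    | (None, None) \<Rightarrow> 0)"

definition path_len :: "(real \<Rightarrow> 'a::real_normed_vector) \<Rightarrow> real \<Rightarrow> real \<Rightarrow> ereal" where
  "path_len g a b = (SUP ts \<in> {ts. sorted ts \<and> set ts \<subseteq> {a..b}}.
      ereal (\<Sum>i<length ts - 1. norm (g (ts ! Suc i) - g (ts ! i))))"

definition rectifiable_ext :: "(real \<Rightarrow> 'n::finite ext) \<Rightarrow> bool" where
  "rectifiable_ext \<gamma> \<longleftrightarrow> (\<forall>t\<in>{0..1}. \<gamma> t \<noteq> None) \<and> path_len (the \<circ> \<gamma>) 0 1 < \<infinity>"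

definition arclen :: "(real \<Rightarrow> 'a::real_normed_vector) \<Rightarrow> real \<Rightarrow> real" where
  "arclen g t = real_of_ereal (path_len g 0 t)"

definition normal_rep :: "(real \<Rightarrow> 'a::real_normed_vector) \<Rightarrow> real \<Rightarrow> 'a" where
  "normal_rep g s = g (SOME t. t \<in> {0..1} \<and> arclen g t = s)"

text \<open>Line integral of rho along a rectifiable path (Vaisala's definition).\<close>
definition line_int :: "('a::real_normed_vector \<Rightarrow> ennreal) \<Rightarrow> (real \<Rightarrow> 'a) \<Rightarrow> ennreal" where
  "line_int \<rho> g = (\<integral>\<^sup>+ s. indicator {0..arclen g 1} s * \<rho> (normal_rep g s) \<partial>lborel)"

definition admissible :: "(real^'n::finite \<Rightarrow> ennreal) \<Rightarrow> (real \<Rightarrow> 'n ext) set \<Rightarrow> bool" where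
  "admissible \<rho> \<Gamma> \<longleftrightarrow> \<rho> \<in> borel_measurable borel \<and>
     (\<forall>\<gamma>\<in>\<Gamma>. rectifiable_ext \<gamma> \<longrightarrow> line_int \<rho> (the \<circ> \<gamma>) \<ge> 1)"

definition modulus :: "(real \<Rightarrow> 'n::finite ext) set \<Rightarrow> ennreal" where
  "modulus \<Gamma> = (INF \<rho> \<in> {\<rho>. admissible \<rho> \<Gamma>}. \<integral>\<^sup>+ x. \<rho> x ^ CARD('n) \<partial>lebesgue)"

definition path_fam :: "(real^'n::finite) set \<Rightarrow> (real^'n) set \<Rightarrow> (real^'n) set \<Rightarrow> (real \<Rightarrow> real^'n) set" where
  "path_fam E F G = {\<gamma>. continuous_on {0..1} \<gamma> \<and> \<gamma> 0 \<in> E \<and> \<gamma> 1 \<in> F \<and> (\<forall>t\<in>{0<..<1}. \<gamma> t \<in> G)}"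

text \<open>Ring Q-inequality at x0 for all radii below dist(x0, boundary D) (Q := 0 outside D).\<close>
definition ring_Q_ineq :: "(real^'n::finite) set \<Rightarrow> (real^'n \<Rightarrow> ennreal) \<Rightarrow> (real^'n \<Rightarrow> 'n ext) \<Rightarrow> real^'n \<Rightarrow> bool" where
  "ring_Q_ineq D Q f x0 \<longleftrightarrow>
     (\<forall>r1 r2 (\<eta>::real \<Rightarrow> ennreal). 0 < r1 \<longrightarrow> r1 < r2 \<longrightarrow> (\<forall>y\<in>frontier D. r2 < dist x0 y) \<longrightarrow>
        \<eta> \<in> borel_measurable lebesgue \<longrightarrow>
        (\<integral>\<^sup>+ r. indicator {r1<..<r2} r * \<eta> r \<partial>lebesgue) \<ge> 1 \<longrightarrow>
        modulus ((\<lambda>\<gamma>. f \<circ> \<gamma>) ` path_fam (sphere x0 r1) (sphere x0 r2) D)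
          \<le> (\<integral>\<^sup>+ x. indicator ({x. r1 < dist x x0 \<and> dist x x0 < r2} \<inter> D) x
                 * Q x * \<eta> (dist x x0) ^ CARD('n) \<partial>lebesgue))"

definition homeo_into :: "(real^'n::finite) set \<Rightarrow> (real^'n \<Rightarrow> 'n ext) \<Rightarrow> bool" where
  "homeo_into D f \<longleftrightarrow> inj_on f D \<and>
     (\<forall>x\<in>D. \<forall>e>0. \<exists>d>0. \<forall>y\<in>D. dist y x < d \<longrightarrow> chordal (f y) (f x) < e) \<and>
     (\<forall>x\<in>D. \<forall>e>0. \<exists>d>0. \<forall>y\<in>D. chordal (f y) (f x) < d \<longrightarrow> dist y x < e)"

definition K_class :: "(real^'n::finite) set \<Rightarrow> real^'n \<Rightarrow> real^'n \<Rightarrow> (real^'n \<Rightarrow> ennreal) \<Rightarrow> real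
     \<Rightarrow> (real^'n \<Rightarrow> 'n ext) set" where
  "K_class D a b Q \<delta> = {f. homeo_into D f \<and> (\<forall>x0\<in>D. ring_Q_ineq D Q f x0)
       \<and> chordal (f a) (f b) \<ge> \<delta>}"

definition loc_unif_conv :: "(real^'n::finite) set \<Rightarrow> (nat \<Rightarrow> real^'n \<Rightarrow> 'n ext) \<Rightarrow> (real^'n \<Rightarrow> 'n ext) \<Rightarrow> bool" where
  "loc_unif_conv D fs f \<longleftrightarrow> (\<forall>x\<in>D. \<exists>r>0. ball x r \<subseteq> D \<and>
     (\<forall>e>0. \<forall>\<^sub>F m in sequentially. \<forall>y\<in>ball x r. chordal (fs m y) (f y) < e))"

end

theory Submission
  imports Defs
begin

text \<open>
  The argument rests on a lower bound for moduli in the image: if two sets meet all spheres of radius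
  between \<open>s\<close> and \<open>4\<^sup>N s\<close> about a common centre, then the paths joining them have modulus at least
  \<open>c N\<close>. Polar coordinates are avoided: on one shell, averaging the admissibility inequality over
  two-segment paths with a random middle vertex shows that one of the two sets consists of points \<open>z\<close>
  with \<open>\<integral>\<rho>\<^sup>n \<ge> c r/s\<close> over some ball of radius \<open>r\<close> about \<open>z\<close>; a Vitali covering by such balls and
  radial projection bound \<open>\<integral>\<rho>\<^sup>n\<close> over the shell from below, and the shells add up.

  Suppose \<open>f x = f z\<close> with \<open>x \<noteq> z\<close> and \<open>f\<close> not constant near \<open>z\<close>. The images under \<open>f\<^sub>m\<close> of a small
  ball about \<open>z\<close> and of the outside of a larger one come arbitrarily close near \<open>f z\<close> while keeping
  points away from it, so the modulus between them is unbounded, whereas the ring inequality with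
  constant \<open>\<eta>\<close> bounds it. Connectedness then excludes points of local constancy, so \<open>f\<close> is
  injective, and it is a homeomorphism by invariance of domain.

  For the ring inequality of \<open>f\<close>, the map \<open>f\<^sub>m\<^sup>-\<^sup>1 \<circ> f\<close> is close to the identity, so every image path
  under \<open>f\<close> of the ring \<open>(r\<^sub>1, r\<^sub>2)\<close> contains an image path under \<open>f\<^sub>m\<close> of the slightly smaller ring
  \<open>(r\<^sub>1 + \<epsilon>, r\<^sub>2 - \<epsilon>)\<close>; rescaling \<open>\<eta>\<close> and letting \<open>\<epsilon> \<rightarrow> 0\<close> finishes the proof.
\<close>
subsection \<open>Length of paths and line integrals along subpaths\<close>

text \<open>Admissibility tests only rectifiable paths that avoid infinity. Lower bounds for moduli
  therefore come from explicit finite paths, and families are compared through subpaths alone, which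
  avoids any semicontinuity of the modulus under convergence of maps. Since \<open>line_int\<close>
  uses the arc length representation, that representation has to be identified for subpaths and for
  two-segment paths.

  The energy \<open>c * r / s\<close> is linear in \<open>r\<close> for two reasons. Taking the
  distance from the centre turns a ball of radius \<open>r\<close> into an interval of length
  proportional to \<open>r\<close>, so linear energies add up to the length of a whole interval of
  radii. In the averaging over middle vertices, a linear bound leaves the factor
  \<open>t powr (- (n - 1) / n)\<close>, which is integrable at 0.

  That an image covers a chordal ball is shown without degree theory: chordal balls are connected,
  open images come from invariance of domain, and closed images from compactness. The same covering
  statement yields the continuous inverse and makes \<open>inv_into D (fs m) \<circ> f\<close> well
  defined.\<close>

definition poly_len :: "(real \<Rightarrow> 'a::real_normed_vector) \<Rightarrow> real list \<Rightarrow> real" where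
  "poly_len g ts = (\<Sum>i<length ts - 1. norm (g (ts ! Suc i) - g (ts ! i)))"

lemma poly_len_simps [simp]:
  "poly_len g [] = 0" "poly_len g [x] = 0"
  "poly_len g (x # y # zs) = norm (g y - g x) + poly_len g (y # zs)"
proof -
  show "poly_len g (x # y # zs) = norm (g y - g x) + poly_len g (y # zs)"
    unfolding poly_len_def by (simp add: sum.lessThan_Suc_shift del: sum.lessThan_Suc)
qed (simp_all add: poly_len_def)

lemma poly_len_le_path_len:
  "sorted ts \<Longrightarrow> set ts \<subseteq> {a..b} \<Longrightarrow> ereal (poly_len g ts) \<le> path_len g a b"
  unfolding path_len_def poly_len_def by (rule SUP_upper) simp

lemma path_len_least:
  assumes "\<And>ts. sorted ts \<Longrightarrow> set ts \<subseteq> {a..b} \<Longrightarrow> ereal (poly_len g ts) \<le> M"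
  shows "path_len g a b \<le> M"
  unfolding path_len_def using assms unfolding poly_len_def by (intro SUP_least) auto

lemma less_path_lenE:
  assumes "ereal c < path_len g a b"
  obtains ts where "sorted ts" "set ts \<subseteq> {a..b}" "c < poly_len g ts"
  using path_len_least[of a b g "ereal c"] assms
  by (metis ereal_less_eq(3) linorder_not_le)

lemma path_len_nonneg: "0 \<le> path_len g a b"
  using poly_len_le_path_len[of "[]" a b g] by (simp add: zero_ereal_def)

lemma norm_le_path_len:
  assumes "a \<le> s" "s \<le> t" "t \<le> b" shows "ereal (norm (g t - g s)) \<le> path_len g a b"
  using poly_len_le_path_len[of "[s,t]" a b g] assms by simp

lemma poly_len_append: "poly_len g xs + poly_len g ys \<le> poly_len g (xs @ ys)"
proof (induction xs rule: induct_list012)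
  case (2 x)
  then show ?case by (cases ys) auto
qed auto

text \<open>Clamping a partition from above and from below at \<open>b\<close> inserts
  \<open>b\<close> into it without any list surgery. Only the step that passes over \<open>b\<close>
  is split, and there the triangle inequality applies.\<close>

lemma poly_len_le_min_max:
  assumes "sorted ts"
  shows "poly_len g ts \<le> poly_len g (map (min b) ts) + poly_len g (map (max b) ts)"
  using assms
proof (induction ts rule: induct_list012)
  case (3 x y zs)
  have "norm (g y - g x) \<le> norm (g (min b y) - g (min b x)) + norm (g (max b y) - g (max b x))"
  proof (cases "x \<le> b \<and> b \<le> y")
    case True
    then show ?thesis using norm_triangle_ineq[of "g b - g x" "g y - g b"] by (simp add: min_def max_def)
  next
    case False
    then show ?thesis using 3(3) by (auto simp: min_def max_def)
  qed
  with 3 show ?case by simp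
qed auto

lemma sorted_map_min_max:
  fixes b :: real
  assumes "sorted ts" shows "sorted (map (min b) ts)" "sorted (map (max b) ts)"
  using assms by (induction ts) (auto simp: min_def max_def)

lemma path_len_add:
  assumes "a \<le> b" "b \<le> c"
  shows "path_len g a c = path_len g a b + path_len g b c"
proof (rule antisym)
  show "path_len g a c \<le> path_len g a b + path_len g b c"
  proof (rule path_len_least)
    fix ts assume ts: "sorted ts" "set ts \<subseteq> {a..c}"
    have "ereal (poly_len g ts) \<le> ereal (poly_len g (map (min b) ts)) + ereal (poly_len g (map (max b) ts))"
      using poly_len_le_min_max[OF ts(1)] by simp
    also have "\<dots> \<le> path_len g a b + path_len g b c"
      using ts assms
      by (intro add_mono poly_len_le_path_len sorted_map_min_max) (auto simp: subset_iff)
    finally show "ereal (poly_len g ts) \<le> path_len g a b + path_len g b c" .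
  qed
  let ?S = "\<lambda>a b. {ts::real list. sorted ts \<and> set ts \<subseteq> {a..b}}"
  have ne: "?S a b \<noteq> {}" for a b by (auto intro: exI[of _ "[]"])
  have *: "path_len g a b = (SUP ts\<in>?S a b. ereal (poly_len g ts))" for a b
    by (simp add: path_len_def poly_len_def)
  have 1: "ereal (poly_len g xs) + path_len g b c \<le> path_len g a c" if xs: "xs \<in> ?S a b" for xs
  proof -
    have "path_len g b c + ereal (poly_len g xs) = (SUP ts\<in>?S b c. ereal (poly_len g ts) + ereal (poly_len g xs))"
      unfolding * by (rule SUP_ereal_add_left[symmetric, OF ne]) auto
    also have "\<dots> \<le> path_len g a c"
    proof (rule SUP_least)
      fix ts assume ts: "ts \<in> ?S b c"
      have "ereal (poly_len g ts) + ereal (poly_len g xs) \<le> ereal (poly_len g (xs @ ts))"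
        using poly_len_append[of g xs ts] by simp
      also have "\<dots> \<le> path_len g a c"
        using xs ts assms by (intro poly_len_le_path_len) (auto simp: sorted_append subset_iff dest: order_trans)
      finally show "ereal (poly_len g ts) + ereal (poly_len g xs) \<le> path_len g a c" .
    qed
    finally show ?thesis by (simp add: add.commute)
  qed
  have "path_len g a b + path_len g b c = (SUP ts\<in>?S a b. ereal (poly_len g ts) + path_len g b c)"
    unfolding *[of a b] using path_len_nonneg[of g b c]
    by (intro SUP_ereal_add_left[symmetric, OF ne]) auto
  also have "\<dots> \<le> path_len g a c" by (rule SUP_least) (use 1 in blast)
  finally show "path_len g a b + path_len g b c \<le> path_len g a c" .
qed

text \<open>One inequality, proved for all increasing affine substitutions, suffices: the converse
  is the same inequality for the inverse substitution.\<close>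

lemma path_len_affine:
  assumes "0 < k"
  shows "path_len (\<lambda>t. g (c + k * t)) a b = path_len g (c + k * a) (c + k * b)"
proof -
  have gen: "path_len (\<lambda>t. g (c + k * t)) a b \<le> path_len g (c + k * a) (c + k * b)"
    if "0 < k" for k c a b and g :: "real \<Rightarrow> 'b::real_normed_vector"
  proof (rule path_len_least)
    fix ts assume ts: "sorted ts" "set ts \<subseteq> {a..b}"
    have "poly_len (\<lambda>t. g (c + k * t)) ts = poly_len g (map (\<lambda>t. c + k * t) ts)"
      by (induction ts rule: induct_list012) auto
    moreover have "sorted (map (\<lambda>t. c + k * t) ts)"
      using ts(1) that by (induction ts) auto
    moreover have "set (map (\<lambda>t. c + k * t) ts) \<subseteq> {c + k * a..c + k * b}"
      using ts(2) that by auto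
    ultimately show "ereal (poly_len (\<lambda>t. g (c + k * t)) ts) \<le> path_len g (c + k * a) (c + k * b)"
      using poly_len_le_path_len by metis
  qed
  have "path_len (\<lambda>t. (\<lambda>t. g (c + k * t)) (- (c / k) + (1 / k) * t)) (c + k * a) (c + k * b) \<le>
     path_len (\<lambda>t. g (c + k * t)) (- (c / k) + (1 / k) * (c + k * a)) (- (c / k) + (1 / k) * (c + k * b))"
    using assms by (intro gen) auto
  moreover have "c + k * (- (c / k) + (1 / k) * t) = t" for t using assms by (simp add: field_simps)
  moreover have "- (c / k) + (1 / k) * (c + k * t) = t" for t using assms by (simp add: field_simps)
  ultimately have "path_len g (c + k * a) (c + k * b) \<le> path_len (\<lambda>t. g (c + k * t)) a b" by simp
  with gen[OF assms, of g c a b] show ?thesis by (rule antisym)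
qed

lemma path_len_cong:
  assumes "\<And>t. t \<in> {a..b} \<Longrightarrow> g t = h t" shows "path_len g a b = path_len h a b"
proof -
  have "poly_len g ts = poly_len h ts" if "set ts \<subseteq> {a..b}" for ts
    using that assms by (induction ts rule: induct_list012) auto
  then show ?thesis
    unfolding path_len_def poly_len_def[symmetric] by (intro SUP_cong) auto
qed

lemma affine_mem_Icc:
  fixes a b t :: real
  assumes "a \<le> b" "t \<in> {0..1}" shows "a + (b - a) * t \<in> {a..b}"
  using mult_left_mono[of t 1 "b - a"] assms by auto

section \<open>Arc length and the normal representation of a rectifiable path\<close>

locale rectifiable_path =
  fixes g :: "real \<Rightarrow> 'a::real_normed_vector"
  assumes cont: "continuous_on {0..1} g" and fin: "path_len g 0 1 < \<infinity>"
begin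

lemma path_len_finite:
  assumes "0 \<le> s" "s \<le> t" "t \<le> 1" shows "\<bar>path_len g s t\<bar> \<noteq> \<infinity>"
proof -
  have "path_len g 0 1 = path_len g 0 s + (path_len g s t + path_len g t 1)"
    using assms path_len_add[of s t 1 g] path_len_add[of 0 s 1 g] by simp
  with fin path_len_nonneg[of g] show ?thesis
    by (cases "path_len g s t") (auto simp: ereal_plus_eq_PInfty)
qed

lemma path_len_eq_arclen:
  assumes "0 \<le> s" "s \<le> t" "t \<le> 1" shows "path_len g s t = ereal (arclen g t - arclen g s)"
proof -
  have "path_len g 0 t = path_len g 0 s + path_len g s t" by (rule path_len_add) (use assms in auto)
  moreover have "\<bar>path_len g 0 t\<bar> \<noteq> \<infinity>" "\<bar>path_len g 0 s\<bar> \<noteq> \<infinity>" "\<bar>path_len g s t\<bar> \<noteq> \<infinity>"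
    by (intro path_len_finite; use assms in simp)+
  ultimately show ?thesis unfolding arclen_def
    by (cases "path_len g 0 t"; cases "path_len g 0 s"; cases "path_len g s t") auto
qed

lemma arclen_0: "arclen g 0 = 0"
proof -
  have "path_len g 0 0 = path_len g 0 0 + path_len g 0 0" by (rule path_len_add) auto
  with path_len_finite[of 0 0] show ?thesis unfolding arclen_def by (cases "path_len g 0 0") auto
qed

lemma norm_le_arclen:
  assumes "0 \<le> s" "s \<le> t" "t \<le> 1" shows "norm (g t - g s) \<le> arclen g t - arclen g s"
  using norm_le_path_len[of s s t t g] path_len_eq_arclen[OF assms] assms by simp

lemma arclen_mono: "0 \<le> s \<Longrightarrow> s \<le> t \<Longrightarrow> t \<le> 1 \<Longrightarrow> arclen g s \<le> arclen g t"
  using norm_le_arclen[of s t] norm_ge_zero[of "g t - g s"] by linarith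

text \<open>For a fixed partition, the clamped lists are partitions of \<open>{0..t}\<close> and
  \<open>{t..1}\<close> whose polygonal lengths vary continuously with \<open>t\<close>. They serve
  as continuous minorants of the two length functions.\<close>

lemma continuous_on_poly_len_min_max:
  assumes "set ts \<subseteq> {0..1}"
  shows "continuous_on {0..1} (\<lambda>t. poly_len g (map (min t) ts))"
    and "continuous_on {0..1} (\<lambda>t. poly_len g (map (max t) ts))"
proof -
  have c: "continuous_on {0..1} (\<lambda>t. g (min t x))" "continuous_on {0..1} (\<lambda>t. g (max t x))"
    if "x \<in> {0..1}" for x
    using that by (auto intro!: continuous_on_compose2[OF cont] continuous_intros)
  show "continuous_on {0..1} (\<lambda>t. poly_len g (map (min t) ts))"
    using assms by (induction ts rule: induct_list012) (auto intro!: continuous_intros c)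
  show "continuous_on {0..1} (\<lambda>t. poly_len g (map (max t) ts))"
    using assms by (induction ts rule: induct_list012) (auto intro!: continuous_intros c)
qed

text \<open>Both \<open>t \<mapsto> path_len g 0 t\<close> and \<open>t \<mapsto> path_len g t 1\<close> are suprema of continuous functions, hence
  lower semicontinuous, and their sum is constant.\<close>
lemma continuous_on_arclen: "continuous_on {0..1} (arclen g)"
proof -
  have key: "\<forall>\<^sub>F t in at s within {0..1}. arclen g s - e < arclen g t"
       "\<forall>\<^sub>F t in at s within {0..1}. arclen g t < arclen g s + e"
    if s: "s \<in> {0..1}" and e: "0 < e" for s e :: real
  proof -
    have in01: "\<forall>\<^sub>F t in at s within {0..1}. t \<in> {0..1}" by (simp add: eventually_at_filter)
    have "ereal (arclen g s - e) < path_len g 0 s"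
      using s e arclen_0 by (simp add: path_len_eq_arclen)
    then obtain ts where ts: "sorted ts" "set ts \<subseteq> {0..s}" "arclen g s - e < poly_len g ts"
      by (rule less_path_lenE)
    \<comment> \<open>The partition lies to the left of \<open>s\<close>, so clamping at
      \<open>s\<close> itself changes nothing and the continuous minorant is within \<open>e\<close>
      of the length at \<open>t = s\<close>.\<close>
    have "map (min s) ts = ts" using ts(2) by (intro map_idI) auto
    moreover have "set ts \<subseteq> {0..1}" using ts(2) s by auto
    ultimately have ev: "\<forall>\<^sub>F t in at s within {0..1}. arclen g s - e < poly_len g (map (min t) ts)"
      using continuous_on_poly_len_min_max(1)[of ts, unfolded continuous_on_def, rule_format, of s] s ts(3)
      by (intro order_tendstoD(1)[where y="poly_len g (map (min s) ts)"]) simp_all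
    have le: "poly_len g (map (min t) ts) \<le> arclen g t" if "t \<in> {0..1}" for t
    proof -
      have "set (map (min t) ts) \<subseteq> {0..t}" using that ts(2) by auto
      then have "ereal (poly_len g (map (min t) ts)) \<le> path_len g 0 t"
        by (intro poly_len_le_path_len sorted_map_min_max ts(1))
      then show ?thesis using path_len_eq_arclen[of 0 t] arclen_0 that by simp
    qed
    show "\<forall>\<^sub>F t in at s within {0..1}. arclen g s - e < arclen g t"
      using ev in01 by eventually_elim (use le in force)
    \<comment> \<open>An upper bound for \<open>arclen g t\<close> is a lower bound for the
      remaining length on \<open>{t..1}\<close>.\<close>
    have "ereal (arclen g 1 - arclen g s - e) < path_len g s 1"
      using s e by (simp add: path_len_eq_arclen)
    then obtain ts where ts: "sorted ts" "set ts \<subseteq> {s..1}" "arclen g 1 - arclen g s - e < poly_len g ts"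
      by (rule less_path_lenE)
    have "map (max s) ts = ts" using ts(2) by (intro map_idI) auto
    moreover have "set ts \<subseteq> {0..1}" using ts(2) s by auto
    ultimately have ev: "\<forall>\<^sub>F t in at s within {0..1}. arclen g 1 - arclen g s - e < poly_len g (map (max t) ts)"
      using continuous_on_poly_len_min_max(2)[of ts, unfolded continuous_on_def, rule_format, of s] s ts(3)
      by (intro order_tendstoD(1)[where y="poly_len g (map (max s) ts)"]) simp_all
    have le: "poly_len g (map (max t) ts) \<le> arclen g 1 - arclen g t" if "t \<in> {0..1}" for t
    proof -
      have "set (map (max t) ts) \<subseteq> {t..1}" using that ts(2) s by auto
      then have "ereal (poly_len g (map (max t) ts)) \<le> path_len g t 1"
        by (intro poly_len_le_path_len sorted_map_min_max ts(1))
      then show ?thesis using path_len_eq_arclen[of t 1] that by simp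
    qed
    show "\<forall>\<^sub>F t in at s within {0..1}. arclen g t < arclen g s + e"
      using ev in01 by eventually_elim (use le in force)
  qed
  show ?thesis unfolding continuous_on_def
  proof (intro ballI order_tendstoI)
    fix s a assume "s \<in> {0..1::real}" "a < arclen g s"
    with key(1)[of s "arclen g s - a"] show "\<forall>\<^sub>F t in at s within {0..1}. a < arclen g t" by simp
  next
    fix s a assume "s \<in> {0..1::real}" "arclen g s < a"
    with key(2)[of s "a - arclen g s"] show "\<forall>\<^sub>F t in at s within {0..1}. arclen g t < a" by simp
  qed
qed

lemma arclen_surj:
  assumes "0 \<le> a" "a \<le> b" "b \<le> 1" "s \<in> {arclen g a..arclen g b}" shows "\<exists>t\<in>{a..b}. arclen g t = s"
proof -
  have "continuous_on {a..b} (arclen g)"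
    by (rule continuous_on_subset[OF continuous_on_arclen]) (use assms in auto)
  from IVT'[OF _ _ assms(2) this, of s] assms(4) show ?thesis by (meson atLeastAtMost_iff)
qed

text \<open>The parameter picked by \<open>SOME\<close> may differ from \<open>t\<close>, but no
  length lies between two parameters with equal arc length, so \<open>g\<close> takes the same value
  at both.\<close>

lemma normal_rep_arclen:
  assumes "t \<in> {0..1}" shows "normal_rep g (arclen g t) = g t"
proof -
  define t' where "t' = (SOME u. u \<in> {0..1} \<and> arclen g u = arclen g t)"
  have t': "t' \<in> {0..1} \<and> arclen g t' = arclen g t"
    unfolding t'_def by (rule someI[of _ t]) (use assms in auto)
  then have "g t' = g t"
    using norm_le_arclen[of t t'] norm_le_arclen[of t' t] assms by (cases "t \<le> t'") simp_all
  then show ?thesis unfolding normal_rep_def t'_def[symmetric] .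
qed

lemma continuous_on_normal_rep: "continuous_on {0..arclen g 1} (normal_rep g)"
proof -
  have *: "dist (normal_rep g x) (normal_rep g y) \<le> dist x y"
    if "x \<le> y" "x \<in> {0..arclen g 1}" "y \<in> {0..arclen g 1}" for x y
  proof -
    have "\<exists>t\<in>{0..1}. arclen g t = x" "\<exists>t\<in>{0..1}. arclen g t = y"
      by (rule arclen_surj; use that arclen_0 in simp)+
    then obtain t u where t: "t \<in> {0..1}" "arclen g t = x" and u: "u \<in> {0..1}" "arclen g u = y"
      by blast
    \<comment> \<open>The parameters \<open>t\<close> and \<open>u\<close> need not be ordered like
      \<open>x\<close> and \<open>y\<close>; if they are reversed, monotonicity of arc length forces
      \<open>x = y\<close>.\<close>
    show ?thesis
    proof (cases "t \<le> u")
      case True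
      then show ?thesis using norm_le_arclen[of t u] t u normal_rep_arclen[of t] normal_rep_arclen[of u] that
        by (auto simp: dist_norm norm_minus_commute)
    next
      case False
      then have "x = y" using arclen_mono[of u t] t u that by auto
      then show ?thesis by simp
    qed
  qed
  have "dist (normal_rep g x) (normal_rep g y) \<le> dist x y"
    if "x \<in> {0..arclen g 1}" "y \<in> {0..arclen g 1}" for x y
    using *[of x y] *[of y x] that by (cases "x \<le> y") (auto simp: dist_commute)
  then show ?thesis by (intro lipschitz_on_continuous_on[of 1] lipschitz_onI) auto
qed

lemma borel_measurable_line_integrand:
  fixes \<rho> :: "'a \<Rightarrow> ennreal"
  assumes [measurable]: "\<rho> \<in> borel_measurable borel"
  shows "(\<lambda>s. indicator {0..arclen g 1} s * \<rho> (normal_rep g s)) \<in> borel_measurable borel"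
proof -
  let ?L = "arclen g 1"
  have L: "0 \<le> ?L" using arclen_mono[of 0 1] arclen_0 by simp
  \<comment> \<open>Outside \<open>{0..?L}\<close> the value of \<open>normal_rep g\<close> is an
    arbitrary choice. Clamping the argument gives a function continuous on the whole line that
    agrees with it where the indicator is nonzero.\<close>
  define h where "h s = normal_rep g (max 0 (min ?L s))" for s
  have "continuous_on UNIV h" unfolding h_def
    using L by (intro continuous_on_compose2[OF continuous_on_normal_rep] continuous_intros) auto
  then have [measurable]: "h \<in> borel_measurable borel" by (rule borel_measurable_continuous_onI)
  have "(\<lambda>s. indicator {0..?L} s * \<rho> (normal_rep g s)) = (\<lambda>s. indicator {0..?L} s * \<rho> (h s))"
    by (auto simp: h_def fun_eq_iff indicator_def)
  also have "\<dots> \<in> borel_measurable borel" by measurable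
  finally show ?thesis .
qed

text \<open>The normal representation of the subpath is that of \<open>g\<close> shifted by
  \<open>arclen g a\<close>. Its line integral is thus an integral of the same nonnegative function
  over a subinterval.\<close>

lemma subpath:
  assumes ab: "0 \<le> a" "a < b" "b \<le> 1" and h: "\<And>t. t \<in> {0..1} \<Longrightarrow> h t = g (a + (b - a) * t)"
    and \<rho>: "\<rho> \<in> borel_measurable borel"
  shows "path_len h 0 1 < \<infinity>" and "line_int \<rho> h \<le> line_int \<rho> g"
proof -
  have pl: "path_len h 0 t = path_len g a (a + (b - a) * t)" if "t \<in> {0..1}" for t
  proof -
    have "path_len h 0 t = path_len (\<lambda>t. g (a + (b - a) * t)) 0 t"
      using that h by (intro path_len_cong) auto
    then show ?thesis using path_len_affine[of "b - a" g a 0 t] ab by simp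
  qed
  have in01: "a + (b - a) * t \<in> {a..b}" if "t \<in> {0..1}" for t
    by (rule affine_mem_Icc) (use that ab in auto)
  have al: "arclen h t = arclen g (a + (b - a) * t) - arclen g a" if "t \<in> {0..1}" for t
    using pl[OF that] path_len_eq_arclen[of a "a + (b - a) * t"] in01[OF that] ab unfolding arclen_def[of h] by simp
  show "path_len h 0 1 < \<infinity>" using pl[of 1] path_len_finite[of a b] ab by (cases "path_len g a b") auto
  interpret h: rectifiable_path h
  proof
    show "path_len h 0 1 < \<infinity>" by fact
    have "continuous_on {0..1} (\<lambda>t. g (a + (b - a) * t))"
      using in01 ab by (intro continuous_on_compose2[OF cont] continuous_intros) force
    then show "continuous_on {0..1} h" by (rule continuous_on_eq) (use h in auto)
  qed
  have nr: "normal_rep h s = normal_rep g (arclen g a + s)" if "s \<in> {0..arclen h 1}" for s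
  proof -
    have "\<exists>t\<in>{0..1}. arclen h t = s" by (rule h.arclen_surj) (use h.arclen_0 that in simp_all)
    then obtain t where t: "t \<in> {0..1}" "arclen h t = s" by blast
    then have "normal_rep h s = h t" using h.normal_rep_arclen by blast
    also have "\<dots> = normal_rep g (arclen g (a + (b - a) * t))"
      using h t in01[OF t(1)] ab by (simp add: normal_rep_arclen)
    finally show ?thesis using al t by auto
  qed
  have a0: "0 \<le> arclen g a" "arclen g b \<le> arclen g 1"
    using arclen_mono[of 0 a] arclen_mono[of b 1] ab arclen_0 by auto
  have "line_int \<rho> h \<le> (\<integral>\<^sup>+ s. indicator {0..arclen g 1} (arclen g a + s) * \<rho> (normal_rep g (arclen g a + s)) \<partial>lborel)"
    unfolding line_int_def
  proof (rule nn_integral_mono)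
    fix s
    show "indicator {0..arclen h 1} s * \<rho> (normal_rep h s)
         \<le> indicator {0..arclen g 1} (arclen g a + s) * \<rho> (normal_rep g (arclen g a + s))"
    proof (cases "s \<in> {0..arclen h 1}")
      case True
      then have "arclen g a + s \<in> {0..arclen g 1}" using al[of 1] a0 by auto
      then show ?thesis using True nr by simp
    qed simp
  qed
  also have "\<dots> = line_int \<rho> g"
    unfolding line_int_def
    using nn_integral_real_affine[OF borel_measurable_line_integrand[OF \<rho>], of 1 "arclen g a"] by simp
  finally show "line_int \<rho> h \<le> line_int \<rho> g" .
qed

end

text \<open>Minorisation: a function admissible for \<Gamma>2 is admissible for \<Gamma>1, because
  line integrals can only grow from a subpath to the full path. Subpaths are demanded of rectifiable
  paths alone, so image paths through infinity are dismissed here once and for all.\<close>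

lemma modulus_mono_subpath:
  fixes \<Gamma>1 \<Gamma>2 :: "(real \<Rightarrow> 'n::finite ext) set"
  assumes sub: "\<And>\<gamma>. \<gamma> \<in> \<Gamma>1 \<Longrightarrow> rectifiable_ext \<gamma> \<Longrightarrow> continuous_on {0..1} (the \<circ> \<gamma>) \<and>
     (\<exists>a b. 0 \<le> a \<and> a < b \<and> b \<le> 1 \<and> (\<exists>\<gamma>'\<in>\<Gamma>2. \<forall>t\<in>{0..1}. \<gamma>' t = \<gamma> (a + (b - a) * t)))"
  shows "modulus \<Gamma>1 \<le> modulus \<Gamma>2"
  unfolding modulus_def
proof (rule INF_superset_mono)
  show "{\<rho>. admissible \<rho> \<Gamma>2} \<subseteq> {\<rho>. admissible \<rho> \<Gamma>1}"
  proof safe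
    fix \<rho> assume adm: "admissible \<rho> \<Gamma>2"
    then have \<rho>: "\<rho> \<in> borel_measurable borel" by (simp add: admissible_def)
    have "1 \<le> line_int \<rho> (the \<circ> \<gamma>)" if \<gamma>: "\<gamma> \<in> \<Gamma>1" "rectifiable_ext \<gamma>" for \<gamma>
    proof -
      from sub[OF \<gamma>] obtain a b \<gamma>' where ab: "0 \<le> a" "a < b" "b \<le> 1" and \<gamma>': "\<gamma>' \<in> \<Gamma>2"
        "\<And>t. t\<in>{0..1} \<Longrightarrow> \<gamma>' t = \<gamma> (a + (b - a) * t)" by blast
      interpret rectifiable_path "the \<circ> \<gamma>"
        using sub[OF \<gamma>] \<gamma>(2) by unfold_locales (auto simp: rectifiable_ext_def)
      have h: "(the \<circ> \<gamma>') t = (the \<circ> \<gamma>) (a + (b - a) * t)" if "t \<in> {0..1}" for t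
        using \<gamma>'(2)[OF that] by simp
      have "\<gamma>' t \<noteq> None" if "t \<in> {0..1}" for t
        using \<gamma>(2) \<gamma>'(2)[OF that] affine_mem_Icc[OF _ that, of a b] ab by (force simp: rectifiable_ext_def)
      then have "rectifiable_ext \<gamma>'" using subpath(1)[OF ab h \<rho>] unfolding rectifiable_ext_def by blast
      then have "1 \<le> line_int \<rho> (the \<circ> \<gamma>')" using adm \<gamma>'(1) by (auto simp: admissible_def)
      also have "\<dots> \<le> line_int \<rho> (the \<circ> \<gamma>)" by (rule subpath(2)[OF ab h \<rho>])
      finally show ?thesis .
    qed
    with \<rho> show "admissible \<rho> \<Gamma>1" by (simp add: admissible_def)
  qed
qed simp

subsection \<open>Two-segment paths\<close>

text \<open>The line integral along the segment from \<open>p\<close> to \<open>q\<close> at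
  constant speed. The explicit integral, instead of \<open>line_int\<close>, is visibly measurable
  in the endpoint, as the averaging over middle vertices requires.\<close>

definition seg_int :: "('a::euclidean_space \<Rightarrow> ennreal) \<Rightarrow> 'a \<Rightarrow> 'a \<Rightarrow> ennreal" where
  "seg_int \<rho> p q = ennreal (norm (q - p)) * (\<integral>\<^sup>+ t. indicator {0..1} t * \<rho> (p + t *\<^sub>R (q - p)) \<partial>lborel)"

lemma seg_int_commute:
  assumes [measurable]: "\<rho> \<in> borel_measurable borel"
  shows "seg_int \<rho> p q = seg_int \<rho> q p"
proof -
  have "(\<integral>\<^sup>+ t. indicator {0..1} t * \<rho> (p + t *\<^sub>R (q - p)) \<partial>lborel) =
     (\<integral>\<^sup>+ t. indicator {0..1} (1 + (-1) * t) * \<rho> (p + (1 + (-1) * t) *\<^sub>R (q - p)) \<partial>lborel)"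
    by (subst nn_integral_real_affine[where c="-1" and t=1]) auto
  also have "\<dots> = (\<integral>\<^sup>+ t. indicator {0..1} t * \<rho> (q + t *\<^sub>R (p - q)) \<partial>lborel)"
    by (intro nn_integral_cong arg_cong2[where f="(*)"] arg_cong[where f=\<rho>])
       (auto simp: indicator_def algebra_simps)
  finally show ?thesis by (simp add: seg_int_def norm_minus_commute)
qed

lemma nn_integral_segment:
  assumes [measurable]: "\<rho> \<in> borel_measurable borel" and d: "d = norm (q - p)"
  shows "(\<integral>\<^sup>+ s. indicator {a..a + d} s * \<rho> (p + ((s - a) / d) *\<^sub>R (q - p)) \<partial>lborel) = seg_int \<rho> p q"
\<comment> \<open>For \<open>d = 0\<close> the domain of integration is a single point and the
  factor \<open>norm (q - p)\<close> vanishes, so both sides are 0.\<close>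
proof (cases "d = 0")
  case True
  have "(\<integral>\<^sup>+ s. indicator {a..a + d} s * \<rho> (p + ((s - a) / d) *\<^sub>R (q - p)) \<partial>lborel)
      = (\<integral>\<^sup>+ s. \<rho> (p + ((s - a) / d) *\<^sub>R (q - p)) * indicator {a} s \<partial>lborel)"
    using True by (simp add: mult.commute)
  also have "\<dots> = 0" by (subst nn_integral_indicator_singleton) auto
  finally show ?thesis using True d by (simp add: seg_int_def)
next
  case False
  then have pos: "d > 0" using d by simp
  have "(\<integral>\<^sup>+ s. indicator {a..a + d} s * \<rho> (p + ((s - a) / d) *\<^sub>R (q - p)) \<partial>lborel) =
     ennreal d * (\<integral>\<^sup>+ t. indicator {a..a + d} (a + d * t) * \<rho> (p + ((a + d * t - a) / d) *\<^sub>R (q - p)) \<partial>lborel)"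
    using pos by (subst nn_integral_real_affine[where c=d and t=a]) auto
  also have "(\<integral>\<^sup>+ t. indicator {a..a + d} (a + d * t) * \<rho> (p + ((a + d * t - a) / d) *\<^sub>R (q - p)) \<partial>lborel)
     = (\<integral>\<^sup>+ t. indicator {0..1} t * \<rho> (p + t *\<^sub>R (q - p)) \<partial>lborel)"
    using pos by (intro nn_integral_cong arg_cong2[where f="(*)"] arg_cong[where f=\<rho>])
       (auto simp: indicator_def mult_le_cancel_left1 zero_le_mult_iff)
  finally show ?thesis by (simp add: seg_int_def d)
qed

lemma norm_diff_segment:
  fixes p q :: "'a::real_normed_vector"
  assumes "d = norm (q - p)" "0 \<le> s" "s \<le> t" "t \<le> d"
  shows "norm ((p + (t / d) *\<^sub>R (q - p)) - (p + (s / d) *\<^sub>R (q - p))) = t - s"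
proof (cases "d = 0")
  case False
  have "(p + (t / d) *\<^sub>R (q - p)) - (p + (s / d) *\<^sub>R (q - p)) = ((t - s) / d) *\<^sub>R (q - p)"
    by (simp add: diff_divide_distrib scaleR_left_diff_distrib)
  then show ?thesis using assms False by simp
qed (use assms in auto)

lemma poly_len_le_lipschitz:
  assumes "\<And>s t. a \<le> s \<Longrightarrow> s \<le> t \<Longrightarrow> t \<le> b \<Longrightarrow> norm (g t - g s) \<le> L * (t - s)"
    and "sorted ts" "set ts \<subseteq> {a..b}" "0 \<le> L" "a \<le> b"
  shows "poly_len g ts \<le> L * (b - a)"
proof (cases ts)
  case (Cons x xs)
  have "poly_len g (x # xs) \<le> L * (last (x # xs) - x)" if "sorted (x # xs)" "set (x # xs) \<subseteq> {a..b}" for x xs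
    using that
  proof (induction xs arbitrary: x)
    case (Cons y ys)
    then have "poly_len g (y # ys) \<le> L * (last (y # ys) - y)" "norm (g y - g x) \<le> L * (y - x)"
      using assms(1)[of x y] by auto
    then show ?case by (simp add: algebra_simps)
  qed simp
  from this[of x xs] have "poly_len g ts \<le> L * (last ts - x)" using assms Cons by simp
  also have "\<dots> \<le> L * (b - a)"
    using assms Cons last_in_set[of ts] by (intro mult_left_mono) (auto intro!: diff_mono)
  finally show ?thesis .
qed (use assms in simp)

text \<open>\<open>G\<close> parametrises the broken line through \<open>e\<close>,
  \<open>y\<close>, \<open>f\<close> by arc length, and \<open>g\<close> runs through it with
  constant speed \<open>L\<close>. Hence \<open>arclen g t = L * t\<close>, and the normal
  representation is \<open>G\<close>. Degenerate segments are allowed: there the quotients have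
  denominator 0 and take the value 0.\<close>

lemma exists_two_segment_path:
  fixes e y f :: "'a::euclidean_space"
  obtains \<beta> where "continuous_on {0..1} \<beta>" "\<beta> 0 = e" "\<beta> 1 = f" "path_len \<beta> 0 1 < \<infinity>"
    "\<And>\<rho>. \<rho> \<in> borel_measurable borel \<Longrightarrow> line_int \<rho> \<beta> \<le> seg_int \<rho> e y + seg_int \<rho> f y"
proof -
  define A where "A = norm (y - e)"
  define B where "B = norm (f - y)"
  define L where "L = A + B"
  define G where "G s = (if s \<le> A then e + (s / A) *\<^sub>R (y - e) else y + ((s - A) / B) *\<^sub>R (f - y))" for s
  define g where "g t = G (L * t)" for t
  have nn: "0 \<le> A" "0 \<le> B" "0 \<le> L" by (auto simp: A_def B_def L_def)
  have GA: "G A = y" by (cases "A = 0") (auto simp: G_def, auto simp: A_def)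
  have G1: "G s = e + (s / A) *\<^sub>R (y - e)" if "s \<le> A" for s using that by (simp add: G_def)
  have G2: "G s = y + ((s - A) / B) *\<^sub>R (f - y)" if "A \<le> s" for s
    using that GA by (cases "s = A") (auto simp: G_def)
  have n1: "norm (G t - G s) = t - s" if "0 \<le> s" "s \<le> t" "t \<le> A" for s t
    using norm_diff_segment[OF A_def, of s t] that by (simp add: G1)
  have n2: "norm (G t - G s) = t - s" if "A \<le> s" "s \<le> t" "t \<le> L" for s t
    using norm_diff_segment[OF B_def, of "s - A" "t - A"] that by (simp add: G2 L_def)
  have lip: "norm (G t - G s) \<le> t - s" if "0 \<le> s" "s \<le> t" "t \<le> L" for s t
  proof (cases "s \<le> A \<and> A \<le> t")
    case True
    then show ?thesis using norm_triangle_ineq[of "G t - G A" "G A - G s"] n1[of s A] n2[of A t] that by simp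
  next
    case False
    then show ?thesis using n1[of s t] n2[of s t] that by auto
  qed
  have Lt: "0 \<le> L * t" "L * t \<le> L" if "t \<in> {0..1}" for t
    using that nn mult_left_le[of t L] by auto
  have lipg: "norm (g t - g s) \<le> L * (t - s)" if "0 \<le> s" "s \<le> t" "t \<le> 1" for s t
    using lip[of "L * s" "L * t"] Lt[of s] Lt[of t] that nn mult_left_mono[of s t L]
    by (simp add: g_def algebra_simps)
  have up: "path_len g 0 t \<le> ereal (L * t)" if "t \<in> {0..1}" for t
  proof (rule path_len_least)
    fix ts assume "sorted ts" "set ts \<subseteq> {0..t}"
    then show "ereal (poly_len g ts) \<le> ereal (L * t)"
      using poly_len_le_lipschitz[of 0 t g L ts] lipg that nn by simp
  qed
  have lo: "ereal (L * t) \<le> path_len g 0 t" if t: "t \<in> {0..1}" for t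
  proof (cases "L * t \<le> A")
    case True
    then show ?thesis
      using norm_le_path_len[of 0 0 t t g] n1[of 0 "L * t"] t Lt[OF t] nn by (simp add: g_def)
  next
    case False
    then have L: "L > 0" using nn by (cases "L = 0") auto
    then have u: "0 \<le> A / L" "A / L \<le> t" using nn False by (auto simp: field_simps)
    \<comment> \<open>With the corner time \<open>A / L\<close> in the partition, the polygonal
      length is exact.\<close>
    have "ereal (poly_len g [0, A / L, t]) \<le> path_len g 0 t"
      using u by (intro poly_len_le_path_len) auto
    moreover have "poly_len g [0, A / L, t] = L * t"
      using n1[of 0 A] n2[of A "L * t"] nn L Lt[OF t] False by (simp add: g_def)
    ultimately show ?thesis by simp
  qed
  have al: "arclen g t = L * t" if "t \<in> {0..1}" for t
    using up[OF that] lo[OF that] by (simp add: arclen_def antisym)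
  have nr: "normal_rep g s = G s" if s: "s \<in> {0..L}" for s
  proof -
    define t where "t = (SOME t. t \<in> {0..1} \<and> arclen g t = s)"
    have "s / L \<in> {0..1}" using s nn by (auto simp: divide_le_eq_1)
    moreover have "L * (s / L) = s" using s by (cases "L = 0") auto
    ultimately have "s / L \<in> {0..1} \<and> arclen g (s / L) = s" using al by simp
    then have "t \<in> {0..1} \<and> arclen g t = s" unfolding t_def by (rule someI)
    then have "L * t = s" using al by auto
    then show ?thesis unfolding normal_rep_def t_def[symmetric] by (simp add: g_def)
  qed
  show thesis
  proof
    have "norm (g t - g s) \<le> L * \<bar>t - s\<bar>" if "s \<in> {0..1}" "t \<in> {0..1}" for s t
      using lipg[of s t] lipg[of t s] that by (cases "s \<le> t") (auto simp: norm_minus_commute)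
    then show "continuous_on {0..1} g"
      using nn by (intro lipschitz_on_continuous_on[of L] lipschitz_onI) (auto simp: dist_norm)
    show "g 0 = e" using nn by (simp add: g_def G_def)
    show "g 1 = f" using G2[of L] nn by (cases "B = 0") (auto simp: g_def L_def B_def)
    show "path_len g 0 1 < \<infinity>" using up[of 1] by (auto simp: less_top[symmetric])
  next
    fix \<rho> :: "'a \<Rightarrow> ennreal" assume [measurable]: "\<rho> \<in> borel_measurable borel"
    have "line_int \<rho> g = (\<integral>\<^sup>+ s. indicator {0..L} s * \<rho> (G s) \<partial>lborel)"
      unfolding line_int_def using al[of 1] nr by (intro nn_integral_cong) (auto simp: indicator_def)
    \<comment> \<open>At the corner \<open>s = A\<close> both indicators equal 1, which is why this
      is an inequality.\<close>
    also have "\<dots> \<le> (\<integral>\<^sup>+ s. indicator {0..0 + A} s * \<rho> (e + ((s - 0) / A) *\<^sub>R (y - e)) +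
        indicator {A..A + B} s * \<rho> (y + ((s - A) / B) *\<^sub>R (f - y)) \<partial>lborel)"
      using G1 G2 by (intro nn_integral_mono) (auto simp: indicator_def L_def)
    also have "\<dots> = (\<integral>\<^sup>+ s. indicator {0..0 + A} s * \<rho> (e + ((s - 0) / A) *\<^sub>R (y - e)) \<partial>lborel) +
        (\<integral>\<^sup>+ s. indicator {A..A + B} s * \<rho> (y + ((s - A) / B) *\<^sub>R (f - y)) \<partial>lborel)"
      by (rule nn_integral_add) measurable
    also have "\<dots> = seg_int \<rho> e y + seg_int \<rho> y f"
      using nn_integral_segment[OF _ A_def, of \<rho> 0] nn_integral_segment[OF _ B_def, of \<rho> A] by simp
    also have "seg_int \<rho> y f = seg_int \<rho> f y" by (rule seg_int_commute) simp
    finally show "line_int \<rho> g \<le> seg_int \<rho> e y + seg_int \<rho> f y" .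
  qed
qed

text \<open>The middle vertex \<open>y\<close> is arbitrary. This freedom is what the averaging
  argument exploits.\<close>

lemma admissible_two_segments:
  fixes \<rho> :: "real^'n::finite \<Rightarrow> ennreal"
  assumes adm: "admissible \<rho> ((\<lambda>\<beta>. Some \<circ> \<beta>) ` path_fam E F UNIV)" and "e \<in> E" "f \<in> F"
  shows "1 \<le> seg_int \<rho> e y + seg_int \<rho> f y"
proof -
  obtain \<beta> where \<beta>: "continuous_on {0..1} \<beta>" "\<beta> 0 = e" "\<beta> 1 = f" "path_len \<beta> 0 1 < \<infinity>"
    "\<And>\<rho>. \<rho> \<in> borel_measurable borel \<Longrightarrow> line_int \<rho> \<beta> \<le> seg_int \<rho> e y + seg_int \<rho> f y"
    using exists_two_segment_path by metis
  have eq: "the \<circ> (Some \<circ> \<beta>) = \<beta>" by auto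
  have "\<beta> \<in> path_fam E F UNIV" using \<beta> assms by (auto simp: path_fam_def)
  moreover have "rectifiable_ext (Some \<circ> \<beta>)" using \<beta>(4) eq by (simp add: rectifiable_ext_def)
  ultimately have "1 \<le> line_int \<rho> \<beta>" using adm eq by (auto simp: admissible_def)
  then show ?thesis using \<beta>(5)[of \<rho>] adm by (auto simp: admissible_def)
qed

subsection \<open>A lower bound for the modulus of paths joining two sets\<close>

lemma sets_borel_cball [measurable]: "cball (x::'a::metric_space) r \<in> sets borel"
  by simp

text \<open>Either \<open>x \<le> k\<close>, or \<open>k ^ (n - 1) \<le> x ^ (n - 1)\<close>. This
  linear form of the Hoelder inequality leaves the threshold \<open>k\<close> free, so that it can
  be chosen separately at every scale.\<close>

lemma ennreal_le_add_power:
  fixes x :: ennreal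
  assumes "0 < k" "1 \<le> n"
  shows "x \<le> ennreal k + ennreal (1 / k ^ (n - 1)) * x ^ n"
proof (cases "x \<le> ennreal k")
  case True
  then show ?thesis by (rule add_increasing2[rotated]) simp
next
  case False
  have "x = ennreal (1 / k ^ (n - 1)) * (x * ennreal k ^ (n - 1))"
    using assms by (simp add: ennreal_power mult.left_commute[of _ x] flip: ennreal_mult)
  also have "\<dots> \<le> ennreal (1 / k ^ (n - 1)) * (x * x ^ (n - 1))"
    using False by (intro mult_left_mono power_mono) auto
  also have "x * x ^ (n - 1) = x ^ n" using assms by (cases n) auto
  finally show ?thesis by (rule add_increasing[rotated]) simp
qed

lemma nn_integral_powr_unit_interval:
  assumes "0 \<le> a" "a < 1"
  shows "(\<integral>\<^sup>+ t. ennreal (t powr (- a)) * indicator {0..1} t \<partial>lborel) = ennreal (1 / (1 - a))"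
  using has_integral_powr_from_0[of "-a" 1] assms
  by (intro nn_integral_has_integral_lebesgue') auto

lemma nn_integral_lborel_affine:
  fixes f :: "'a::euclidean_space \<Rightarrow> ennreal"
  assumes [measurable]: "f \<in> borel_measurable borel" and "0 < c"
  shows "(\<integral>\<^sup>+ x. f x \<partial>lborel) = ennreal (c ^ DIM('a)) * (\<integral>\<^sup>+ x. f (t + c *\<^sub>R x) \<partial>lborel)"
  using assms(2)
  by (subst lborel_affine[of c t]) (simp_all add: nn_integral_density nn_integral_distr nn_integral_cmult)

text \<open>After Fubini, for fixed \<open>t\<close> the map
  \<open>y \<mapsto> e + t *\<^sub>R (y - e)\<close> carries \<open>cball e R\<close> onto
  \<open>cball e (t * R)\<close>, where the energy is at most \<open>c * t\<close>. The Jacobian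
  turns this into \<open>c * t / t ^ n\<close>, and the threshold inequality bounds the mean of
  \<rho> by a multiple of an integrable power of \<open>t\<close>.\<close>

lemma nn_integral_seg_int_le:
  fixes \<rho> :: "'a::euclidean_space \<Rightarrow> ennreal"
  assumes [measurable]: "\<rho> \<in> borel_measurable borel"
    and n_def: "n = DIM('a)" and R: "0 < R" and c: "0 \<le> c" and \<kappa>: "0 < \<kappa>"
    and bound: "\<And>r. 0 < r \<Longrightarrow> r \<le> R \<Longrightarrow>
      (\<integral>\<^sup>+ x. indicator (cball e r) x * \<rho> x ^ n \<partial>lborel) \<le> ennreal (c * r / R)"
  shows "(\<integral>\<^sup>+ y. indicator (cball e R) y * seg_int \<rho> e y \<partial>lborel)
      \<le> ennreal (R ^ n * real n * (\<kappa> * unit_ball_vol n + c / \<kappa> ^ (n - 1)))"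
proof -
  define \<omega> where "\<omega> = unit_ball_vol n"
  define a where "a = (real n - 1) / real n"
  have n: "1 \<le> n" by (simp add: n_def Suc_leI)
  have a: "0 \<le> a" "a < 1" "1 / (1 - a) = real n" using n by (auto simp: a_def field_simps)
  have inner: "(\<integral>\<^sup>+ y. ennreal R * (indicator (cball e R) y * \<rho> (e + t *\<^sub>R (y - e))) \<partial>lborel)
      \<le> ennreal (R ^ n * (\<kappa> * \<omega> + c / \<kappa> ^ (n - 1))) * ennreal (t powr (- a))"
    if t: "0 < t" "t \<le> 1" for t
  proof -
    \<comment> \<open>This threshold balances the two terms: the energy term scales as
      \<open>t powr (1 - n)\<close> divided by \<open>k ^ (n - 1)\<close>, and with
      \<open>a = (n - 1) / n\<close> this is again \<open>t powr (- a)\<close>. As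
      \<open>a < 1\<close>, the integral over \<open>t\<close> is
      \<open>1 / (1 - a) = n\<close>.\<close>
    define k where "k = \<kappa> * t powr (- a) / R"
    have k: "0 < k" using \<kappa> t R by (simp add: k_def)
    define J where "J = (\<integral>\<^sup>+ y. indicator (cball e R) y * \<rho> (e + t *\<^sub>R (y - e)) ^ n \<partial>lborel)"
    have m: "(\<lambda>x. indicator (cball e (t * R)) x * \<rho> x ^ n) \<in> borel_measurable borel" by measurable
    have "ennreal (c * (t * R) / R) \<ge> (\<integral>\<^sup>+ x. indicator (cball e (t * R)) x * \<rho> x ^ n \<partial>lborel)"
      using t R by (intro bound) (auto intro: mult_left_le_one_le)
    also have "(\<integral>\<^sup>+ x. indicator (cball e (t * R)) x * \<rho> x ^ n \<partial>lborel) = ennreal (t ^ n) *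
        (\<integral>\<^sup>+ y. indicator (cball e (t * R)) ((e - t *\<^sub>R e) + t *\<^sub>R y) * \<rho> ((e - t *\<^sub>R e) + t *\<^sub>R y) ^ n \<partial>lborel)"
      unfolding n_def by (rule nn_integral_lborel_affine[OF m[unfolded n_def] t(1)])
    also have "(\<integral>\<^sup>+ y. indicator (cball e (t * R)) ((e - t *\<^sub>R e) + t *\<^sub>R y) * \<rho> ((e - t *\<^sub>R e) + t *\<^sub>R y) ^ n \<partial>lborel) = J"
      unfolding J_def
    proof (rule nn_integral_cong)
      fix y
      have 1: "(e - t *\<^sub>R e) + t *\<^sub>R y = e + t *\<^sub>R (y - e)" by (simp add: algebra_simps)
      have "dist e (e + t *\<^sub>R (y - e)) = t * dist e y" using t by (simp add: dist_norm norm_minus_commute)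
      then have "indicator (cball e (t * R)) (e + t *\<^sub>R (y - e)) = (indicator (cball e R) y :: ennreal)"
        using t by (simp add: indicator_def)
      then show "indicator (cball e (t * R)) ((e - t *\<^sub>R e) + t *\<^sub>R y) * \<rho> ((e - t *\<^sub>R e) + t *\<^sub>R y) ^ n =
         indicator (cball e R) y * \<rho> (e + t *\<^sub>R (y - e)) ^ n" unfolding 1 by simp
    qed
    finally have J: "ennreal (t ^ n) * J \<le> ennreal (c * t)" using R by simp
    have "J = ennreal (1 / t ^ n) * (ennreal (t ^ n) * J)"
      using t by (simp add: mult.assoc[symmetric] flip: ennreal_mult)
    also have "\<dots> \<le> ennreal (1 / t ^ n) * ennreal (c * t)" by (intro mult_left_mono J) simp
    finally have J': "J \<le> ennreal (c * t / t ^ n)" using t c by (simp flip: ennreal_mult)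
    have "(\<integral>\<^sup>+ y. indicator (cball e R) y * \<rho> (e + t *\<^sub>R (y - e)) \<partial>lborel)
      \<le> (\<integral>\<^sup>+ y. ennreal k * indicator (cball e R) y +
            ennreal (1 / k ^ (n - 1)) * (indicator (cball e R) y * \<rho> (e + t *\<^sub>R (y - e)) ^ n) \<partial>lborel)"
      using ennreal_le_add_power[OF k n] by (intro nn_integral_mono) (simp add: indicator_def)
    also have "\<dots> = ennreal k * ennreal (\<omega> * R ^ n) + ennreal (1 / k ^ (n - 1)) * J"
      unfolding J_def using R
      by (subst nn_integral_add) (auto simp: nn_integral_cmult emeasure_cball \<omega>_def n_def)
    also have "\<dots> \<le> ennreal k * ennreal (\<omega> * R ^ n) + ennreal (1 / k ^ (n - 1)) * ennreal (c * t / t ^ n)"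
      by (intro add_left_mono mult_left_mono J') simp
    also have "\<dots> = ennreal (k * \<omega> * R ^ n + c * t / t ^ n / k ^ (n - 1))"
      using k c t R by (simp add: \<omega>_def mult.assoc flip: ennreal_mult ennreal_plus)
    finally have "ennreal R * (\<integral>\<^sup>+ y. indicator (cball e R) y * \<rho> (e + t *\<^sub>R (y - e)) \<partial>lborel)
        \<le> ennreal R * ennreal (k * \<omega> * R ^ n + c * t / t ^ n / k ^ (n - 1))" by (rule mult_left_mono) simp
    also have "\<dots> = ennreal (R * (k * \<omega> * R ^ n + c * t / t ^ n / k ^ (n - 1)))"
      using k c t R by (simp add: \<omega>_def ennreal_mult)
    also have "R * (k * \<omega> * R ^ n + c * t / t ^ n / k ^ (n - 1)) = R ^ n * (\<kappa> * \<omega> + c / \<kappa> ^ (n - 1)) * t powr (- a)"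
    proof -
      have 1: "R * (k * \<omega> * R ^ n) = R ^ n * (\<kappa> * \<omega>) * t powr (- a)" using R by (simp add: k_def)
      have Rn: "R ^ n = R * R ^ (n - 1)" using n by (cases n) auto
      have tn: "t / t ^ n = t powr (1 - real n)" using t by (simp add: powr_diff powr_realpow)
      have ta: "(t powr (- a)) ^ (n - 1) = t powr (- a * (real n - 1))"
        using t n by (simp add: powr_powr of_nat_diff flip: powr_realpow)
      have "(1 - real n) - (- a * (real n - 1)) = - a" using n by (simp add: a_def field_simps)
      then have tt: "t powr (1 - real n) / t powr (- a * (real n - 1)) = t powr (- a)"
        using t by (metis powr_diff)
      have "R * (c * t / t ^ n / k ^ (n - 1)) = R * c * (t / t ^ n) / (\<kappa> ^ (n - 1) * (t powr (- a)) ^ (n - 1) / R ^ (n - 1))"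
        by (simp add: k_def power_divide power_mult_distrib)
      also have "\<dots> = R ^ n * (c / \<kappa> ^ (n - 1)) * (t powr (1 - real n) / t powr (- a * (real n - 1)))"
        unfolding tn ta Rn by simp
      finally show ?thesis unfolding tt using 1 by (simp add: algebra_simps)
    qed
    also have "ennreal (R ^ n * (\<kappa> * \<omega> + c / \<kappa> ^ (n - 1)) * t powr (- a)) =
        ennreal (R ^ n * (\<kappa> * \<omega> + c / \<kappa> ^ (n - 1))) * ennreal (t powr (- a))"
      using R \<kappa> c by (simp add: \<omega>_def ennreal_mult)
    finally show ?thesis by (subst nn_integral_cmult) auto
  qed
  have "(\<integral>\<^sup>+ y. indicator (cball e R) y * seg_int \<rho> e y \<partial>lborel) \<le>
     (\<integral>\<^sup>+ y. (\<integral>\<^sup>+ t. indicator {0..1} t * (ennreal R * (indicator (cball e R) y * \<rho> (e + t *\<^sub>R (y - e)))) \<partial>lborel) \<partial>lborel)"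
  proof (rule nn_integral_mono)
    fix y
    show "indicator (cball e R) y * seg_int \<rho> e y \<le>
      (\<integral>\<^sup>+ t. indicator {0..1} t * (ennreal R * (indicator (cball e R) y * \<rho> (e + t *\<^sub>R (y - e)))) \<partial>lborel)"
    proof (cases "y \<in> cball e R")
      case True
      then have "seg_int \<rho> e y \<le> ennreal R * (\<integral>\<^sup>+ t. indicator {0..1} t * \<rho> (e + t *\<^sub>R (y - e)) \<partial>lborel)"
        unfolding seg_int_def by (intro mult_right_mono ennreal_leI) (auto simp: dist_norm norm_minus_commute)
      also have "\<dots> = (\<integral>\<^sup>+ t. ennreal R * (indicator {0..1} t * \<rho> (e + t *\<^sub>R (y - e))) \<partial>lborel)"
        by (rule nn_integral_cmult[symmetric]) measurable
      finally show ?thesis using True by (simp add: mult.left_commute)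
    qed simp
  qed
  also have "\<dots> = (\<integral>\<^sup>+ t. (\<integral>\<^sup>+ y. indicator {0..1} t * (ennreal R * (indicator (cball e R) y * \<rho> (e + t *\<^sub>R (y - e)))) \<partial>lborel) \<partial>lborel)"
    by (rule lborel_pair.Fubini') measurable
  also have "\<dots> = (\<integral>\<^sup>+ t. indicator {0..1} t * (\<integral>\<^sup>+ y. ennreal R * (indicator (cball e R) y * \<rho> (e + t *\<^sub>R (y - e))) \<partial>lborel) \<partial>lborel)"
    by (intro nn_integral_cong nn_integral_cmult) measurable
  also have "\<dots> \<le> (\<integral>\<^sup>+ t. ennreal (R ^ n * (\<kappa> * \<omega> + c / \<kappa> ^ (n - 1))) * (ennreal (t powr (- a)) * indicator {0..1} t) \<partial>lborel)"
    \<comment> \<open>The substitution degenerates at \<open>t = 0\<close>, a null set.\<close>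
    using AE_lborel_singleton[of "0::real"]
  proof (intro nn_integral_mono_AE, elim eventually_mono)
    fix t :: real assume "t \<noteq> 0"
    then show "indicator {0..1} t * (\<integral>\<^sup>+ y. ennreal R * (indicator (cball e R) y * \<rho> (e + t *\<^sub>R (y - e))) \<partial>lborel)
      \<le> ennreal (R ^ n * (\<kappa> * \<omega> + c / \<kappa> ^ (n - 1))) * (ennreal (t powr (- a)) * indicator {0..1} t)"
      using inner[of t] by (cases "t \<in> {0..1}") auto
  qed
  also have "\<dots> = ennreal (R ^ n * (\<kappa> * \<omega> + c / \<kappa> ^ (n - 1))) * ennreal (real n)"
    using a by (subst nn_integral_cmult) (auto simp: nn_integral_powr_unit_interval)
  also have "\<dots> = ennreal (R ^ n * real n * (\<kappa> * \<omega> + c / \<kappa> ^ (n - 1)))"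
    using R \<kappa> c by (simp add: \<omega>_def mult_ac flip: ennreal_mult)
  finally show ?thesis by (simp add: \<omega>_def)
qed

text \<open>The weighted sum \<open>w\<close> points along the bisector of the two directions. It
  vanishes only if they are opposite, and then any vector orthogonal to \<open>e\<close> works,
  which exists in dimension at least two.\<close>

lemma exists_common_half_space:
  fixes e f :: "'a::euclidean_space"
  assumes "2 \<le> DIM('a)" "e \<noteq> 0" "f \<noteq> 0"
  obtains v where "norm v = 1" "0 \<le> e \<bullet> v" "0 \<le> f \<bullet> v"
proof -
  define w where "w = norm f *\<^sub>R e + norm e *\<^sub>R f"
  have cs: "- (norm e * norm f) \<le> e \<bullet> f" using Cauchy_Schwarz_ineq2[of e f] by auto
  have ew: "0 \<le> e \<bullet> w" "0 \<le> f \<bullet> w"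
  proof -
    have "e \<bullet> w = norm e * (norm e * norm f + e \<bullet> f)"
      by (simp add: w_def inner_add_right power2_eq_square algebra_simps flip: power2_norm_eq_inner)
    then show "0 \<le> e \<bullet> w" using cs by simp
    have "f \<bullet> w = norm f * (norm e * norm f + e \<bullet> f)"
      by (simp add: w_def inner_add_right power2_eq_square algebra_simps inner_commute[of f e] flip: power2_norm_eq_inner)
    then show "0 \<le> f \<bullet> w" using cs by simp
  qed
  show thesis
  proof (cases "w = 0")
    case False
    then show thesis using that[of "w /\<^sub>R norm w"] ew by simp
  next
    case True
    obtain y where y: "y \<noteq> 0" "orthogonal e y" using orthogonal_to_vector_exists[OF assms(1)] by blast
    have "norm e *\<^sub>R f = - norm f *\<^sub>R e" using True by (simp add: w_def add_eq_0_iff)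
    then have "(norm e *\<^sub>R f) \<bullet> y = 0" using y(2) by (simp add: orthogonal_def)
    then have "f \<bullet> y = 0" using assms by simp
    then show thesis using that[of "y /\<^sub>R norm y"] y by (simp add: orthogonal_def)
  qed
qed

text \<open>The inner product condition says that the angle between \<open>e\<close> and
  \<open>y\<close> is at most 120 degrees. With \<open>a\<close> and \<open>b\<close> the norms of
  the two summands of a point of the segment, its squared norm is at least
  \<open>a\<^sup>2 + b\<^sup>2 - a * b\<close>, hence at least the square of
  \<open>(a + b) / 2\<close>.\<close>

lemma norm_segment_ge:
  fixes e y :: "'a::real_inner"
  assumes "s \<le> norm e" "s \<le> norm y" "0 \<le> s" "- (norm e * norm y) / 2 \<le> e \<bullet> y" "0 \<le> t" "t \<le> 1"
  shows "s / 2 \<le> norm (e + t *\<^sub>R (y - e))"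
proof -
  define a where "a = (1 - t) * norm e"
  define b where "b = t * norm y"
  have "(1 - t) * s + t * s \<le> a + b"
    unfolding a_def b_def using assms by (intro add_mono mult_left_mono) auto
  then have "s \<le> a + b" by (simp add: algebra_simps)
  then have "(s / 2)\<^sup>2 \<le> ((a + b) / 2)\<^sup>2" using assms by (intro power_mono) auto
  also have "\<dots> \<le> a\<^sup>2 + b\<^sup>2 - a * b"
  proof -
    have "a\<^sup>2 + b\<^sup>2 - a * b - ((a + b) / 2)\<^sup>2 = 3 * ((a - b) / 2)\<^sup>2"
      by (simp add: power2_eq_square field_simps)
    moreover have "0 \<le> 3 * ((a - b) / 2)\<^sup>2" by simp
    ultimately show ?thesis by linarith
  qed
  also have "\<dots> \<le> a\<^sup>2 + b\<^sup>2 + 2 * (t * (1 - t)) * (e \<bullet> y)"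
  proof -
    have "2 * (t * (1 - t)) * (- (norm e * norm y) / 2) \<le> 2 * (t * (1 - t)) * (e \<bullet> y)"
      using assms by (intro mult_left_mono) auto
    then show ?thesis by (simp add: a_def b_def algebra_simps)
  qed
  also have "\<dots> = (norm ((1 - t) *\<^sub>R e + t *\<^sub>R y))\<^sup>2"
  proof -
    have "(norm (p + q))\<^sup>2 = (norm p)\<^sup>2 + (norm q)\<^sup>2 + 2 * (p \<bullet> q)" for p q :: 'a
      by (simp add: power2_norm_eq_inner inner_add inner_commute)
    then show ?thesis using assms by (simp add: a_def b_def mult_ac)
  qed
  finally have "s / 2 \<le> norm ((1 - t) *\<^sub>R e + t *\<^sub>R y)"
    by (rule power2_le_imp_le) simp
  then show ?thesis by (simp add: algebra_simps)
qed

text \<open>Half-open, so that the shells at the scales \<open>s * 4 ^ k\<close> are pairwise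
  disjoint. It is wider than the range of radii from \<open>s\<close> to \<open>2 * s\<close>,
  leaving room for the segments.\<close>

abbreviation (input) shell :: "'a::metric_space \<Rightarrow> real \<Rightarrow> 'a set" where
  "shell x0 s \<equiv> {x. s / 2 \<le> dist x0 x \<and> dist x0 x < 2 * s}"

lemma seg_int_restrict:
  assumes "\<And>t. t \<in> {0..1} \<Longrightarrow> p + t *\<^sub>R (q - p) \<in> A"
  shows "seg_int (\<lambda>x. indicator A x * \<rho> x) p q = seg_int \<rho> p q"
proof -
  have "(\<integral>\<^sup>+ t. indicator {0..1} t * (indicator A (p + t *\<^sub>R (q - p)) * \<rho> (p + t *\<^sub>R (q - p))) \<partial>lborel) =
     (\<integral>\<^sup>+ t. indicator {0..1} t * \<rho> (p + t *\<^sub>R (q - p)) \<partial>lborel)"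
    using assms by (intro nn_integral_cong) (auto simp: indicator_def)
  then show ?thesis by (simp add: seg_int_def)
qed

text \<open>If the \<open>n\<close>-energy of \<open>\<rho>\<close> near \<open>e\<close> and near \<open>f\<close> were small at all scales, then averaging over the
  middle vertex would produce a two-segment path from \<open>e\<close> to \<open>f\<close> that is too short.\<close>
lemma admissible_energy_at_point:
  fixes \<rho> :: "real^'n::finite \<Rightarrow> ennreal" and c s :: real
  defines "n \<equiv> CARD('n)"
  defines "c \<equiv> (1 / (8 * 16 ^ n * n)) ^ (n - 1) * unit_ball_vol n / (8 * 16 ^ n * n)"
  assumes "2 \<le> n" and adm: "admissible \<rho> ((\<lambda>\<beta>. Some \<circ> \<beta>) ` path_fam E F UNIV)" and "e \<in> E" "f \<in> F"
    and e: "dist x0 e \<in> {s..<2 * s}" and f: "dist x0 f \<in> {s..<2 * s}" and s: "0 < s"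
  shows "\<exists>z\<in>{e, f}. \<exists>r>0. r \<le> 4 * s \<and>
     ennreal (c * r / (4 * s)) < (\<integral>\<^sup>+ x. indicator (cball z r) x * (indicator (shell x0 s) x * \<rho> x) ^ n \<partial>lborel)"
proof (rule ccontr)
  define \<rho>' where "\<rho>' = (\<lambda>x. indicator (shell x0 s) x * \<rho> x)"
  define \<omega> where "\<omega> = unit_ball_vol n"
  \<comment> \<open>The choice \<open>c = \<kappa> ^ (n - 1) * (\<omega> * \<kappa>)\<close> makes
    the two terms of the averaging bound equal, and this value of \<kappa> turns their total at
    radius \<open>4 * s\<close> into exactly \<open>M\<close>.\<close>
  define \<kappa> :: real where "\<kappa> = 1 / (8 * 16 ^ n * n)"
  assume neg: "\<not> ?thesis"
  have \<omega>: "0 < \<omega>" by (simp add: \<omega>_def)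
  have n: "n = DIM(real^'n)" "n \<ge> 1" using assms(3) by (auto simp: n_def)
  have \<kappa>: "0 < \<kappa>" using n by (simp add: \<kappa>_def)
  have c: "c = \<kappa> ^ (n - 1) * (\<omega> * \<kappa>)" by (simp add: c_def \<omega>_def \<kappa>_def)
  have c0: "0 \<le> c" using \<omega> \<kappa> by (simp add: c)
  have [measurable]: "\<rho> \<in> borel_measurable borel" using adm by (simp add: admissible_def)
  have [measurable]: "\<rho>' \<in> borel_measurable borel" unfolding \<rho>'_def by measurable
  \<comment> \<open>A quarter of the volume of the ball of middle vertices. The two endpoints
    together then account for at most half of that volume, while admissibility asks for all of
    it.\<close>
  define M where "M = ennreal (\<omega> * (s / 4) ^ n / 4)"
  have bound: "(\<integral>\<^sup>+ y. indicator (cball z (4 * s)) y * seg_int \<rho>' z y \<partial>lborel) \<le> M" if "z \<in> {e, f}" for z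
  proof -
    have "(\<integral>\<^sup>+ y. indicator (cball z (4 * s)) y * seg_int \<rho>' z y \<partial>lborel) \<le>
      ennreal ((4 * s) ^ n * real n * (\<kappa> * unit_ball_vol n + c / \<kappa> ^ (n - 1)))"
    proof (rule nn_integral_seg_int_le)
      fix r :: real assume "0 < r" "r \<le> 4 * s"
      then show "(\<integral>\<^sup>+ x. indicator (cball z r) x * \<rho>' x ^ n \<partial>lborel) \<le> ennreal (c * r / (4 * s))"
        using neg that unfolding \<rho>'_def by (meson not_le)
    qed (use s n \<kappa> c0 in \<open>simp_all add: n_def\<close>)
    also have "(4 * s) ^ n * real n * (\<kappa> * unit_ball_vol n + c / \<kappa> ^ (n - 1)) = (4 * s) ^ n * real n * (2 * \<kappa> * \<omega>)"
      using \<kappa> by (simp add: c \<omega>_def)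
    also have "\<dots> = \<omega> * (s / 4) ^ n / 4"
    proof -
      have "(16::real) ^ n = 4 ^ n * 4 ^ n" by (simp flip: power_mult_distrib)
      then show ?thesis using n(2) by (simp add: \<kappa>_def power_mult_distrib power_divide field_simps)
    qed
    finally show ?thesis by (simp add: M_def)
  qed
  have "e - x0 \<noteq> 0" "f - x0 \<noteq> 0" using e f s by auto
  then obtain v where v: "norm v = 1" "0 \<le> (e - x0) \<bullet> v" "0 \<le> (f - x0) \<bullet> v"
    using exists_common_half_space[of "e - x0" "f - x0"] assms(3) n by auto
  \<comment> \<open>Middle vertices range over \<open>cball y0 (s / 4)\<close>. From
    \<open>x0\<close>, the point \<open>y0\<close> lies in a direction at an angle of at most 90
    degrees from both endpoints, and the small radius keeps the angles below the 120 degrees needed.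
    Thus all segments avoid the ball of radius \<open>s / 2\<close>, and convexity keeps them inside
    that of radius \<open>2 * s\<close>.\<close>
  define y0 where "y0 = x0 + (3 / 2 * s) *\<^sub>R v"
  have Y: "5 / 4 * s \<le> dist x0 y \<and> dist x0 y \<le> 7 / 4 * s" if "y \<in> cball y0 (s / 4)" for y
  proof -
    have "dist x0 y0 = 3 / 2 * s" using v s by (simp add: y0_def dist_norm)
    then show ?thesis
      using that dist_triangle[of x0 y y0] dist_triangle[of x0 y0 y] by (auto simp: dist_commute)
  qed
  have seg: "p + t *\<^sub>R (y - p) \<in> shell x0 s"
    if y: "y \<in> cball y0 (s / 4)" and t: "t \<in> {0..1}" and p: "dist x0 p \<in> {s..<2 * s}" "0 \<le> (p - x0) \<bullet> v" for p y t
  proof -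
    define p' where "p' = p - x0"
    define y' where "y' = y - x0"
    have np: "norm p' \<in> {s..<2 * s}" "norm y' \<in> {5 / 4 * s .. 7 / 4 * s}" "0 \<le> p' \<bullet> v"
      using p Y[OF y] by (auto simp: p'_def y'_def dist_norm norm_minus_commute)
    have eq: "p + t *\<^sub>R (y - p) - x0 = p' + t *\<^sub>R (y' - p')" by (simp add: p'_def y'_def)
    have "norm (y - y0) \<le> s / 4" using y by (simp add: dist_norm norm_minus_commute)
    then have "\<bar>p' \<bullet> (y - y0)\<bar> \<le> norm p' * (s / 4)"
      using Cauchy_Schwarz_ineq2[of p' "y - y0"] by (meson mult_left_mono norm_ge_zero order_trans)
    moreover have "p' \<bullet> y' = 3 / 2 * s * (p' \<bullet> v) + p' \<bullet> (y - y0)"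
      by (simp add: y'_def y0_def inner_diff_right inner_add_right)
    moreover have "0 \<le> 3 / 2 * s * (p' \<bullet> v)" using np s by simp
    moreover have "norm p' * (s / 4) \<le> norm p' * norm y' / 2"
      using np mult_left_mono[of "s / 4" "norm y' / 2" "norm p'"] by simp
    ultimately have "- (norm p' * norm y') / 2 \<le> p' \<bullet> y'" by linarith
    then have 1: "s / 2 \<le> norm (p' + t *\<^sub>R (y' - p'))"
      using np s t by (intro norm_segment_ge) auto
    have "p + t *\<^sub>R (y - p) \<in> ball x0 (2 * s)"
    proof -
      have "p \<in> ball x0 (2 * s)" "y \<in> ball x0 (2 * s)" using p Y[OF y] s by auto
      then have "(1 - t) *\<^sub>R p + t *\<^sub>R y \<in> ball x0 (2 * s)"
        using t by (intro convexD_alt) auto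
      then show ?thesis by (simp add: algebra_simps)
    qed
    moreover have "dist x0 (p + t *\<^sub>R (y - p)) = norm (p' + t *\<^sub>R (y' - p'))"
      using eq by (metis dist_commute dist_norm)
    ultimately show ?thesis using 1 by simp
  qed
  have sub: "cball y0 (s / 4) \<subseteq> cball p (4 * s)" if "dist x0 p \<in> {s..<2 * s}" for p
  proof
    fix y assume "y \<in> cball y0 (s / 4)"
    then show "y \<in> cball p (4 * s)" using Y[of y] that dist_triangle[of p y x0] s by (auto simp: dist_commute)
  qed
  have [measurable]: "(\<lambda>y. indicator (cball z r) y * seg_int \<rho>' z y) \<in> borel_measurable borel" for z r
    unfolding seg_int_def by measurable
  have "ennreal (\<omega> * (s / 4) ^ n) = (\<integral>\<^sup>+ y. indicator (cball y0 (s / 4)) y \<partial>lborel)"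
    using s by (simp add: emeasure_cball \<omega>_def n)
  also have "\<dots> \<le> (\<integral>\<^sup>+ y. indicator (cball e (4 * s)) y * seg_int \<rho>' e y + indicator (cball f (4 * s)) y * seg_int \<rho>' f y \<partial>lborel)"
  proof (rule nn_integral_mono)
    fix y
    show "indicator (cball y0 (s / 4)) y \<le> indicator (cball e (4 * s)) y * seg_int \<rho>' e y + indicator (cball f (4 * s)) y * seg_int \<rho>' f y"
    proof (cases "y \<in> cball y0 (s / 4)")
      case True
      have "seg_int \<rho>' e y = seg_int \<rho> e y" "seg_int \<rho>' f y = seg_int \<rho> f y"
        unfolding \<rho>'_def by (intro seg_int_restrict seg True e f v; assumption)+
      then show ?thesis
        using admissible_two_segments[OF adm, of e f y] assms True sub[of e] sub[of f] by (auto simp: indicator_def)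
    qed simp
  qed
  also have "\<dots> = (\<integral>\<^sup>+ y. indicator (cball e (4 * s)) y * seg_int \<rho>' e y \<partial>lborel) + (\<integral>\<^sup>+ y. indicator (cball f (4 * s)) y * seg_int \<rho>' f y \<partial>lborel)"
    by (rule nn_integral_add) measurable
  also have "\<dots> \<le> M + M" by (intro add_mono bound) auto
  also have "\<dots> = ennreal (\<omega> * (s / 4) ^ n / 2)" using s \<omega> by (simp add: M_def flip: ennreal_plus)
  finally have "\<omega> * (s / 4) ^ n \<le> \<omega> * (s / 4) ^ n / 2" using s \<omega> by (subst (asm) ennreal_le_iff) auto
  moreover have "0 < \<omega> * (s / 4) ^ n" using s \<omega> by simp
  ultimately show False by linarith
qed

text \<open>Choose disjoint balls whose fivefold enlargements cover \<open>Z\<close>. Distances from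
  \<open>x0\<close> map an enlarged ball into an interval of length \<open>10 * r z\<close>, and
  these intervals cover all radii from \<open>s\<close> to \<open>2 * s\<close>. So the sum of
  \<open>10 * r z\<close> is at least \<open>s\<close>, and the disjoint energies add up to at least
  \<open>c / (4 * s) * (s / 10) = c / 40\<close>.\<close>

lemma nn_integral_shell_ge_of_point_energy:
  fixes g :: "'a::euclidean_space \<Rightarrow> ennreal"
  assumes [measurable]: "g \<in> borel_measurable borel" and s: "0 < s" and c: "0 \<le> c"
    and cov: "\<And>r. r \<in> {s..<2 * s} \<Longrightarrow> \<exists>z\<in>Z. dist x0 z = r"
    and energy: "\<And>z. z \<in> Z \<Longrightarrow> \<exists>r>0. r \<le> 4 * s \<and> ennreal (c * r / (4 * s)) \<le> (\<integral>\<^sup>+ x. indicator (cball z r) x * g x \<partial>lborel)"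
  shows "ennreal (c / 40) \<le> (\<integral>\<^sup>+ x. g x \<partial>lborel)"
proof -
  obtain r where r: "\<And>z. z \<in> Z \<Longrightarrow> 0 < r z \<and> r z \<le> 4 * s \<and> ennreal (c * r z / (4 * s)) \<le> (\<integral>\<^sup>+ x. indicator (cball z (r z)) x * g x \<partial>lborel)"
    using energy by metis
  have sub: "Z \<subseteq> (\<Union>z\<in>Z. cball z (r z))" using r by force
  obtain C where C: "countable C" "C \<subseteq> Z"
     "pairwise (\<lambda>i j. disjnt (cball i (r i)) (cball j (r j))) C"
     "Z \<subseteq> (\<Union>z\<in>C. cball z (5 * r z))"
    by (rule Vitali_covering_lemma_cballs[OF sub, of "4 * s"]) (use r in blast)+
  define I where "I z = {dist x0 z - 5 * r z..dist x0 z + 5 * r z}" for z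
  have "ennreal s = emeasure lborel {s..<2 * s}" using s by simp
  also have "\<dots> = (\<integral>\<^sup>+ u. indicator {s..<2 * s} u \<partial>lborel)" by simp
  also have "\<dots> \<le> (\<integral>\<^sup>+ u. (\<integral>\<^sup>+ z. indicator (I z) u \<partial>count_space C) \<partial>lborel)"
  proof (rule nn_integral_mono)
    fix u
    show "indicator {s..<2 * s} u \<le> (\<integral>\<^sup>+ z. indicator (I z) u \<partial>count_space C)"
    proof (cases "u \<in> {s..<2 * s}")
      case True
      then obtain w where w: "w \<in> Z" "dist x0 w = u" using cov by blast
      then obtain z where z: "z \<in> C" "dist z w \<le> 5 * r z" using C(4) by auto
      then have "u \<in> I z" using w dist_triangle[of x0 w z] dist_triangle[of x0 z w]
        by (auto simp: I_def dist_commute)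
      have "(\<integral>\<^sup>+ z'. indicator {z} z' \<partial>count_space C) \<le> (\<integral>\<^sup>+ z. indicator (I z) u \<partial>count_space C)"
        using \<open>u \<in> I z\<close> by (intro nn_integral_mono) (auto simp: indicator_def)
      then show ?thesis using z True by simp
    qed simp
  qed
  also have "\<dots> = (\<integral>\<^sup>+ z. (\<integral>\<^sup>+ u. indicator (I z) u \<partial>lborel) \<partial>count_space C)"
    by (rule nn_integral_count_space_nn_integral[OF C(1)]) (auto simp: I_def)
  also have "\<dots> = (\<integral>\<^sup>+ z. ennreal (10 * r z) \<partial>count_space C)"
    using C(2) r by (intro nn_integral_cong) (force simp: I_def subset_iff less_imp_le)
  finally have s_le: "ennreal s \<le> (\<integral>\<^sup>+ z. ennreal (10 * r z) \<partial>count_space C)" .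
  have "ennreal (c / 40) = ennreal (c / (40 * s)) * ennreal s" using s c by (simp flip: ennreal_mult)
  also have "\<dots> \<le> ennreal (c / (40 * s)) * (\<integral>\<^sup>+ z. ennreal (10 * r z) \<partial>count_space C)"
    by (intro mult_left_mono s_le) simp
  also have "\<dots> = (\<integral>\<^sup>+ z. ennreal (c / (40 * s)) * ennreal (10 * r z) \<partial>count_space C)"
    by (rule nn_integral_cmult[symmetric]) simp
  also have "\<dots> \<le> (\<integral>\<^sup>+ z. emeasure (density lborel g) (cball z (r z)) \<partial>count_space C)"
  proof (rule nn_integral_mono)
    fix z assume "z \<in> space (count_space C)"
    then have z: "z \<in> Z" using C by auto
    have "ennreal (c / (40 * s)) * ennreal (10 * r z) = ennreal (c * r z / (4 * s))"
      using c s r[OF z] by (simp flip: ennreal_mult)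
    also have "\<dots> \<le> (\<integral>\<^sup>+ x. indicator (cball z (r z)) x * g x \<partial>lborel)" using r[OF z] by blast
    also have "\<dots> = emeasure (density lborel g) (cball z (r z))"
      by (subst emeasure_density) (auto simp: mult.commute)
    finally show "ennreal (c / (40 * s)) * ennreal (10 * r z) \<le> emeasure (density lborel g) (cball z (r z))" .
  qed
  also have "\<dots> = emeasure (density lborel g) (\<Union>z\<in>C. cball z (r z))"
    using C by (intro emeasure_UN_countable[symmetric]) (auto simp: disjoint_family_on_def pairwise_def disjnt_def)
  also have "\<dots> \<le> emeasure (density lborel g) UNIV"
    by (intro emeasure_mono) auto
  also have "\<dots> = (\<integral>\<^sup>+ x. g x \<partial>lborel)" by (subst emeasure_density) auto
  finally show ?thesis .
qed

lemma modulus_ge_of_common_spheres: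
  assumes "2 \<le> CARD('n::finite)"
  obtains c :: real where "0 < c"
    "\<And>E F x0 s N. 0 < s \<Longrightarrow> (\<And>r. r \<in> {s..<s * 4 ^ N} \<Longrightarrow> (\<exists>e\<in>E. dist x0 e = r) \<and> (\<exists>f\<in>F. dist x0 f = r)) \<Longrightarrow>
      ennreal (real N * c) \<le> modulus ((\<lambda>\<beta>::real \<Rightarrow> real^'n. Some \<circ> \<beta>) ` path_fam E F UNIV)"
proof -
  define n where "n = CARD('n)"
  define c where "c = (1 / (8 * 16 ^ n * real n)) ^ (n - 1) * unit_ball_vol n / (8 * 16 ^ n * real n)"
  have "0 < n" by (simp add: n_def)
  then have c: "0 < c" by (simp add: c_def)
  show thesis
  proof (rule that[of "c / 40"])
    show "0 < c / 40" using c by simp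
  next
    fix E F :: "(real^'n) set" and x0 s N
    assume s: "0 < s" and sph: "\<And>r. r \<in> {s..<s * 4 ^ N} \<Longrightarrow> (\<exists>e\<in>E. dist x0 e = r) \<and> (\<exists>f\<in>F. dist x0 f = r)"
    show "ennreal (real N * (c / 40)) \<le> modulus ((\<lambda>\<beta>. Some \<circ> \<beta>) ` path_fam E F UNIV)"
      unfolding modulus_def nn_integral_completion n_def[symmetric]
    proof (rule INF_greatest, clarify)
      fix \<rho> :: "real^'n \<Rightarrow> ennreal" assume adm: "admissible \<rho> ((\<lambda>\<beta>. Some \<circ> \<beta>) ` path_fam E F UNIV)"
      then have [measurable]: "\<rho> \<in> borel_measurable borel" by (simp add: admissible_def)
      define \<mu> where "\<mu> = density lborel (\<lambda>x. \<rho> x ^ n)"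
      have shell: "ennreal (c / 40) \<le> emeasure \<mu> (shell x0 \<sigma>)" if \<sigma>: "0 < \<sigma>" "{\<sigma>..<2 * \<sigma>} \<subseteq> {s..<s * 4 ^ N}" for \<sigma>
      proof -
        define g where "g x = (indicator (shell x0 \<sigma>) x * \<rho> x) ^ n" for x
        have [measurable]: "g \<in> borel_measurable borel" unfolding g_def by measurable
        define Q where "Q z \<longleftrightarrow> (\<exists>r>0. r \<le> 4 * \<sigma> \<and> ennreal (c * r / (4 * \<sigma>)) < (\<integral>\<^sup>+ x. indicator (cball z r) x * g x \<partial>lborel))" for z
        define E' where "E' = {e\<in>E. dist x0 e \<in> {\<sigma>..<2 * \<sigma>}}"
        define F' where "F' = {f\<in>F. dist x0 f \<in> {\<sigma>..<2 * \<sigma>}}"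
        have "Q e \<or> Q f" if "e \<in> E'" "f \<in> F'" for e f
        proof -
          have "\<exists>z\<in>{e, f}. Q z"
            unfolding Q_def c_def g_def n_def
            by (rule admissible_energy_at_point[OF assms adm]) (use that \<sigma>(1) in \<open>simp_all add: E'_def F'_def\<close>)
          then show ?thesis by simp
        qed
        \<comment> \<open>If a single \<open>e\<close> fails \<open>Q\<close>, then every
          \<open>f\<close> satisfies it. One of the two sets therefore qualifies as a whole, and
          either one meets every sphere of this range.\<close>
        then have "(\<forall>e\<in>E'. Q e) \<or> (\<forall>f\<in>F'. Q f)" by blast
        then obtain Z where Z: "Z = E' \<or> Z = F'" "\<forall>z\<in>Z. Q z" by blast
        have "ennreal (c / 40) \<le> (\<integral>\<^sup>+ x. g x \<partial>lborel)"
        proof (rule nn_integral_shell_ge_of_point_energy)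
          fix r assume r: "r \<in> {\<sigma>..<2 * \<sigma>}"
          then obtain e f where "e \<in> E" "dist x0 e = r" "f \<in> F" "dist x0 f = r"
            using sph[of r] \<sigma>(2) by blast
          then have "e \<in> E'" "f \<in> F'" using r by (simp_all add: E'_def F'_def)
          then show "\<exists>z\<in>Z. dist x0 z = r" using Z(1) \<open>dist x0 e = r\<close> \<open>dist x0 f = r\<close> by metis
        next
          fix z assume "z \<in> Z"
          then show "\<exists>r>0. r \<le> 4 * \<sigma> \<and> ennreal (c * r / (4 * \<sigma>)) \<le> (\<integral>\<^sup>+ x. indicator (cball z r) x * g x \<partial>lborel)"
            using Z(2) unfolding Q_def by (meson less_imp_le)
        qed (use \<sigma> c in auto)
        also have "\<dots> = (\<integral>\<^sup>+ x. \<rho> x ^ n * indicator (shell x0 \<sigma>) x \<partial>lborel)"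
        proof (rule nn_integral_cong)
          fix x show "g x = \<rho> x ^ n * indicator (shell x0 \<sigma>) x"
            using \<open>0 < n\<close> by (cases "x \<in> shell x0 \<sigma>") (simp_all add: g_def indicator_def)
        qed
        also have "\<dots> = emeasure \<mu> (shell x0 \<sigma>)"
          unfolding \<mu>_def by (rule emeasure_density[symmetric]) auto
        finally show ?thesis .
      qed
      have pos: "0 < s * 4 ^ k" for k :: nat using s by simp
      have four: "4 * (s * 4 ^ j) \<le> s * 4 ^ k" if "j < k" for j k :: nat
      proof -
        have "s * 4 ^ Suc j \<le> s * 4 ^ k" by (intro mult_left_mono power_increasing) (use s that in auto)
        then show ?thesis by (simp only: power_Suc mult.left_commute)
      qed
      define B where "B k = shell x0 (s * 4 ^ k)" for k :: nat
      have disj: "B j \<inter> B k = {}" if "j < k" for j k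
      proof -
        have "x \<notin> B k" if "x \<in> B j" for x
          using that four[OF \<open>j < k\<close>] pos[of j] unfolding B_def mem_Collect_eq by linarith
        then show ?thesis by blast
      qed
      have "ennreal (real N * (c / 40)) = (\<Sum>k<N. ennreal (c / 40))"
        using ennreal_mult[of "real N" "c / 40"] c by (simp add: ennreal_of_nat_eq_real_of_nat)
      also have "\<dots> \<le> (\<Sum>k<N. emeasure \<mu> (shell x0 (s * 4 ^ k)))"
      proof (intro sum_mono shell pos subsetI)
        fix k r assume k: "k \<in> {..<N}" and r: "r \<in> {s * 4 ^ k..<2 * (s * 4 ^ k)}"
        have "s * 1 \<le> s * 4 ^ k" by (intro mult_left_mono one_le_power) (use s in auto)
        with four[of k N] k r pos[of k] have "s \<le> r \<and> r < s * 4 ^ N"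
          unfolding atLeastLessThan_iff lessThan_iff by linarith
        then show "r \<in> {s..<s * 4 ^ N}" by simp
      qed
      also have "\<dots> = (\<Sum>k<N. emeasure \<mu> (B k))" by (simp add: B_def)
      also have "\<dots> = emeasure \<mu> (\<Union>k<N. B k)"
      proof (rule sum_emeasure)
        show "disjoint_family_on B {..<N}"
          unfolding disjoint_family_on_def using disj by (metis nat_neq_iff Int_commute)
      qed (auto simp: \<mu>_def B_def)
      also have "\<dots> \<le> emeasure \<mu> UNIV" by (intro emeasure_mono) (auto simp: \<mu>_def)
      also have "\<dots> = (\<integral>\<^sup>+ x. \<rho> x ^ n \<partial>lborel)" unfolding \<mu>_def by (subst emeasure_density) auto
      finally show "ennreal (real N * (c / 40)) \<le> (\<integral>\<^sup>+ x. \<rho> x ^ n \<partial>lborel)" .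
    qed
  qed
qed

subsection \<open>The chordal metric\<close>

text \<open>Stereographic projection onto the sphere of radius \<open>1/2\<close> about
  \<open>(0, 1/2)\<close>, with infinity at the north pole. The chordal metric becomes the Euclidean
  distance of the images, so continuity into the extended space can be expressed as continuity of
  \<open>stereo \<circ> g\<close>.\<close>

definition stereo :: "'n::finite ext \<Rightarrow> (real^'n) \<times> real" where
  "stereo p = (case p of None \<Rightarrow> (0, 1)
     | Some x \<Rightarrow> ((1 / (1 + (norm x)\<^sup>2)) *\<^sub>R x, (norm x)\<^sup>2 / (1 + (norm x)\<^sup>2)))"

lemma stereo_simps [simp]:
  "stereo None = (0, 1)"
  "stereo (Some x) = ((1 / (1 + (norm x)\<^sup>2)) *\<^sub>R x, (norm x)\<^sup>2 / (1 + (norm x)\<^sup>2))"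
  by (simp_all add: stereo_def)

lemma one_plus_norm_sq_pos [simp]: "0 < 1 + (norm x)\<^sup>2" "1 + (norm x)\<^sup>2 \<noteq> 0"
  using zero_le_power2[of "norm x"] by (linarith, linarith)

lemma dist_stereo_Some_None: "dist (stereo (Some x)) (stereo None) = 1 / sqrt (1 + (norm x)\<^sup>2)"
proof -
  define u where "u = 1 + (norm x)\<^sup>2"
  have u: "u > 0" "(norm x)\<^sup>2 = u - 1" by (simp_all add: u_def)
  have "(norm ((1 / u) *\<^sub>R x))\<^sup>2 = (u - 1) / u\<^sup>2"
    by (simp add: power_divide u(2))
  moreover have "(dist ((u - 1) / u) 1)\<^sup>2 = 1 / u\<^sup>2"
    using u(1) by (simp add: dist_real_def field_simps power_divide)
  ultimately have "dist (stereo (Some x)) (stereo None) = sqrt ((u - 1) / u\<^sup>2 + 1 / u\<^sup>2)"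
    by (simp add: dist_prod_def u(2) flip: u_def)
  also have "(u - 1) / u\<^sup>2 + 1 / u\<^sup>2 = 1 / u" using u(1) by (simp add: field_simps power2_eq_square)
  finally show ?thesis by (simp add: u_def real_sqrt_divide)
qed

lemma dist_stereo_Some_Some:
  "dist (stereo (Some x)) (stereo (Some y)) = norm (x - y) / (sqrt (1 + (norm x)\<^sup>2) * sqrt (1 + (norm y)\<^sup>2))"
proof -
  define u where "u = 1 + (norm x)\<^sup>2"
  define v where "v = 1 + (norm y)\<^sup>2"
  define i where "i = x \<bullet> y"
  have u: "u > 0" "(norm x)\<^sup>2 = u - 1" by (simp_all add: u_def)
  have v: "v > 0" "(norm y)\<^sup>2 = v - 1" by (simp_all add: v_def)
  have sq: "(norm (a - b))\<^sup>2 = (norm a)\<^sup>2 + (norm b)\<^sup>2 - 2 * (a \<bullet> b)" for a b :: "real^'a"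
    by (simp add: power2_norm_eq_inner inner_diff inner_commute)
  have 1: "(dist ((1 / u) *\<^sub>R x) ((1 / v) *\<^sub>R y))\<^sup>2 = (u - 1) / u\<^sup>2 + (v - 1) / v\<^sup>2 - 2 * i / (u * v)"
    unfolding dist_norm sq using u v by (simp add: power_divide i_def)
  have 2: "(dist ((u - 1) / u) ((v - 1) / v))\<^sup>2 = (1 / v - 1 / u)\<^sup>2"
    using u(1) v(1) by (simp add: dist_real_def diff_divide_distrib)
  have 3: "(norm (x - y))\<^sup>2 = u + v - 2 - 2 * i" unfolding sq using u v by (simp add: i_def)
  have "dist (stereo (Some x)) (stereo (Some y)) =
    sqrt ((u - 1) / u\<^sup>2 + (v - 1) / v\<^sup>2 - 2 * i / (u * v) + (1 / v - 1 / u)\<^sup>2)"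
  proof -
    have "stereo (Some x) = ((1 / u) *\<^sub>R x, (u - 1) / u)" by (simp add: u_def)
    moreover have "stereo (Some y) = ((1 / v) *\<^sub>R y, (v - 1) / v)" by (simp add: v_def)
    ultimately show ?thesis unfolding dist_prod_def by (simp only: fst_conv snd_conv 1 2)
  qed
  also have "(u - 1) / u\<^sup>2 + (v - 1) / v\<^sup>2 - 2 * i / (u * v) + (1 / v - 1 / u)\<^sup>2 = (norm (x - y))\<^sup>2 / (u * v)"
    unfolding 3 using u(1) v(1) by (simp add: field_simps power2_eq_square)
  also have "sqrt ((norm (x - y))\<^sup>2 / (u * v)) = norm (x - y) / (sqrt u * sqrt v)"
    by (simp add: real_sqrt_divide real_sqrt_mult)
  finally show ?thesis by (simp add: u_def v_def)
qed

lemma chordal_eq_dist: "chordal p q = dist (stereo p) (stereo q)"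
proof (cases p; cases q)
  assume "p = None" "q = None"
  then show ?thesis by (simp add: chordal_def)
next
  fix y assume "p = None" "q = Some y"
  then show ?thesis using dist_stereo_Some_None[of y] by (simp add: chordal_def dist_commute del: stereo_simps)
next
  fix x assume "p = Some x" "q = None"
  then show ?thesis using dist_stereo_Some_None[of x] by (simp add: chordal_def del: stereo_simps)
next
  fix x y assume "p = Some x" "q = Some y"
  then show ?thesis using dist_stereo_Some_Some[of x y] by (simp add: chordal_def del: stereo_simps)
qed

lemma chordal_commute: "chordal p q = chordal q p"
  by (simp add: chordal_eq_dist dist_commute)

lemma chordal_nonneg [simp]: "0 \<le> chordal p q"
  by (simp add: chordal_eq_dist)

lemma chordal_refl [simp]: "chordal p p = 0"
  by (simp add: chordal_eq_dist)

lemma chordal_triangle: "chordal p r \<le> chordal p q + chordal q r"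
  by (simp add: chordal_eq_dist dist_triangle)

lemma chordal_eq_0_iff [simp]: "chordal p q = 0 \<longleftrightarrow> p = q"
proof -
  have "1 / sqrt (1 + (norm x)\<^sup>2) \<noteq> 0" for x :: "real^'a"
    using one_plus_norm_sq_pos[of x] by simp
  moreover have "norm (x - y) / (sqrt (1 + (norm x)\<^sup>2) * sqrt (1 + (norm y)\<^sup>2)) = 0 \<longleftrightarrow> x = y" for x y :: "real^'a"
    using one_plus_norm_sq_pos[of x] one_plus_norm_sq_pos[of y] by simp
  ultimately show ?thesis by (cases p; cases q) (simp_all add: chordal_def)
qed

lemma chordal_le_norm: "chordal (Some x) (Some y) \<le> norm (x - y)"
proof -
  have "1 * 1 \<le> sqrt (1 + (norm x)\<^sup>2) * sqrt (1 + (norm y)\<^sup>2)" by (intro mult_mono) auto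
  then show ?thesis by (simp add: chordal_def divide_le_eq mult_le_cancel_left1 mult_left_le)
qed

lemma snd_stereo_eq_1_iff [simp]: "snd (stereo p) = 1 \<longleftrightarrow> p = None"
  by (cases p) (simp_all add: divide_eq_1_iff)

text \<open>The inverse projection from the north pole. It converts chordal continuity into ordinary
  continuity wherever the value is finite.\<close>

lemma the_eq_stereo:
  assumes "p \<noteq> None" shows "the p = (1 / (1 - snd (stereo p))) *\<^sub>R fst (stereo p)"
proof -
  obtain x where x: "p = Some x" using assms by auto
  have "1 - (norm x)\<^sup>2 / (1 + (norm x)\<^sup>2) = 1 / (1 + (norm x)\<^sup>2)" by (simp add: field_simps)
  then show ?thesis by (simp add: x)
qed

lemma continuous_on_the:
  assumes "continuous_on S (\<lambda>x. stereo (g x))" "\<And>x. x \<in> S \<Longrightarrow> g x \<noteq> None"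
  shows "continuous_on S (\<lambda>x. the (g x))"
proof -
  have "continuous_on S (\<lambda>x. (1 / (1 - snd (stereo (g x)))) *\<^sub>R fst (stereo (g x)))"
  proof (intro continuous_intros assms(1) ballI)
    fix x assume "x \<in> S"
    with assms(2) have "snd (stereo (g x)) \<noteq> 1" by simp
    then show "1 - snd (stereo (g x)) \<noteq> 0" by simp
  qed
  then show ?thesis by (rule continuous_on_eq) (use assms(2) the_eq_stereo in metis)
qed

lemma continuous_on_stereo_Some: "continuous_on S (\<lambda>x. stereo (Some x))"
  unfolding stereo_simps by (intro continuous_intros) auto

lemma continuous_on_stereo_iff:
  "continuous_on S (\<lambda>x. stereo (g x)) \<longleftrightarrow> (\<forall>x\<in>S. \<forall>e>0. \<exists>d>0. \<forall>y\<in>S. dist y x < d \<longrightarrow> chordal (g y) (g x) < e)"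
  by (simp add: continuous_on_iff chordal_eq_dist)

lemma stereo_eq_iff: "stereo p = stereo q \<longleftrightarrow> p = q"
  using chordal_eq_0_iff[of p q] by (simp add: chordal_eq_dist del: chordal_eq_0_iff)

lemma exists_chordal_None_less:
  assumes "0 < c" shows "\<exists>y::real^'n::finite. chordal (Some y) None < c"
proof -
  obtain y :: "real^'n" where y: "norm y = 1 / c" using vector_choose_size[of "1 / c"] assms by auto
  have "(1 / c)\<^sup>2 < 1 + (norm y)\<^sup>2" by (simp add: y)
  then have "1 / c < sqrt (1 + (norm y)\<^sup>2)" by (rule real_less_rsqrt)
  then have "chordal (Some y) None < c" using assms by (simp add: chordal_def field_simps)
  then show ?thesis ..
qed

text \<open>Completing the square leaves a half-space (or a trivial case of it), an open ball, or
  the complement of a closed ball, where the balls may be empty. The complement of a ball is what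
  needs dimension at least two.\<close>

lemma connected_quadric:
  fixes a :: "'a::euclidean_space"
  assumes "2 \<le> DIM('a)"
  shows "connected {y. \<alpha> * (norm y)\<^sup>2 - 2 * (a \<bullet> y) + \<beta> < 0}"
proof (cases "\<alpha> = 0")
  case True
  have "convex {y. (2 *\<^sub>R a) \<bullet> y > \<beta>}" by (rule convex_halfspace_gt)
  moreover have "{y. \<alpha> * (norm y)\<^sup>2 - 2 * (a \<bullet> y) + \<beta> < 0} = {y. (2 *\<^sub>R a) \<bullet> y > \<beta>}"
    using True by auto
  ultimately show ?thesis by (metis convex_connected)
next
  case False
  define b where "b = (1 / \<alpha>) *\<^sub>R a"
  define K where "K = (norm b)\<^sup>2 - \<beta> / \<alpha>"
  have eq: "\<alpha> * (norm y)\<^sup>2 - 2 * (a \<bullet> y) + \<beta> = \<alpha> * ((dist b y)\<^sup>2 - K)" for y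
  proof -
    have "(dist b y)\<^sup>2 = (norm b)\<^sup>2 + (norm y)\<^sup>2 - 2 * (b \<bullet> y)"
      by (simp add: dist_norm power2_norm_eq_inner inner_diff inner_commute)
    moreover have "\<alpha> * (b \<bullet> y) = a \<bullet> y" "\<alpha> * K = \<alpha> * (norm b)\<^sup>2 - \<beta>"
      using False by (simp_all add: b_def K_def right_diff_distrib)
    ultimately show ?thesis by (simp add: right_diff_distrib distrib_left)
  qed
  have cases: "{y. (dist b y)\<^sup>2 < K} = {} \<or> {y. (dist b y)\<^sup>2 < K} = ball b (sqrt K)"
              "{y. (dist b y)\<^sup>2 \<le> K} = {} \<or> {y. (dist b y)\<^sup>2 \<le> K} = cball b (sqrt K)"
  proof -
    have "(dist b y)\<^sup>2 < K \<longleftrightarrow> dist b y < sqrt K" "(dist b y)\<^sup>2 \<le> K \<longleftrightarrow> dist b y \<le> sqrt K" if "0 \<le> K" for y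
      using real_sqrt_less_iff[of "(dist b y)\<^sup>2" K] real_sqrt_le_iff[of "(dist b y)\<^sup>2" K] by (simp_all del: real_sqrt_less_iff real_sqrt_le_iff)
    moreover have "\<not> (dist b y)\<^sup>2 < K" "\<not> (dist b y)\<^sup>2 \<le> K" if "\<not> 0 \<le> K" for y
      using that zero_le_power2[of "dist b y"] by linarith+
    ultimately show "{y. (dist b y)\<^sup>2 < K} = {} \<or> {y. (dist b y)\<^sup>2 < K} = ball b (sqrt K)"
              "{y. (dist b y)\<^sup>2 \<le> K} = {} \<or> {y. (dist b y)\<^sup>2 \<le> K} = cball b (sqrt K)"
      by (cases "0 \<le> K"; simp add: ball_def cball_def)+
  qed
  show ?thesis
  proof (cases "\<alpha> > 0")
    case True
    then have "{y. \<alpha> * (norm y)\<^sup>2 - 2 * (a \<bullet> y) + \<beta> < 0} = {y. (dist b y)\<^sup>2 < K}"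
      unfolding eq by (simp add: mult_less_0_iff)
    then show ?thesis using cases(1) by (metis connected_ball connected_empty)
  next
    case neg: False
    then have "{y. \<alpha> * (norm y)\<^sup>2 - 2 * (a \<bullet> y) + \<beta> < 0} = - {y. (dist b y)\<^sup>2 \<le> K}"
      unfolding eq using False by (auto simp: mult_less_0_iff)
    moreover have "bounded {y. (dist b y)\<^sup>2 \<le> K}" "convex {y. (dist b y)\<^sup>2 \<le> K}"
      using cases(2) by (metis bounded_cball bounded_empty, metis convex_cball convex_empty)
    ultimately show ?thesis using connected_complement_bounded_convex assms by metis
  qed
qed

lemma less_iff_power2_less:
  fixes a b :: real
  assumes "0 \<le> a" "0 \<le> b" shows "a < b \<longleftrightarrow> a\<^sup>2 < b\<^sup>2"
  using power_strict_mono[of a b 2] power2_less_imp_less[of a b] assms by auto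

lemma connected_chordal_ball:
  assumes "2 \<le> CARD('n)" "0 < c"
  shows "connected {y::real^'n::finite. chordal (Some y) p < c}"
proof (cases p)
  case None
  have "chordal (Some y) p < c \<longleftrightarrow> - c\<^sup>2 * (norm y)\<^sup>2 - 2 * (0 \<bullet> y) + (1 - c\<^sup>2) < 0" for y
  proof -
    define u where "u = 1 + (norm y)\<^sup>2"
    have u: "0 < u" by (simp add: u_def)
    have "chordal (Some y) p < c \<longleftrightarrow> 1 < c * sqrt u"
      using u by (simp add: None chordal_def flip: u_def) (simp add: divide_less_eq)
    also have "\<dots> \<longleftrightarrow> 1\<^sup>2 < (c * sqrt u)\<^sup>2"
      using assms u by (intro less_iff_power2_less) auto
    also have "\<dots> \<longleftrightarrow> 1 < c\<^sup>2 * u" using u by (simp add: power_mult_distrib)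
    finally show ?thesis by (simp add: u_def algebra_simps)
  qed
  then show ?thesis using connected_quadric[of "- c\<^sup>2" "0 :: real^'n" "1 - c\<^sup>2"] assms by simp
next
  case (Some x)
  \<comment> \<open>The sign of \<open>1 - m\<close> tells whether the chordal ball is a Euclidean
    ball, a half-space or the outside of a ball; infinity belongs to it exactly if
    \<open>1 < m\<close>.\<close>
  define m where "m = c\<^sup>2 * (1 + (norm x)\<^sup>2)"
  have "chordal (Some y) p < c \<longleftrightarrow> (1 - m) * (norm y)\<^sup>2 - 2 * (x \<bullet> y) + ((norm x)\<^sup>2 - m) < 0" for y
  proof -
    define u where "u = 1 + (norm y)\<^sup>2"
    define v where "v = 1 + (norm x)\<^sup>2"
    have u: "0 < u" "0 < v" by (simp_all add: u_def v_def)
    have "chordal (Some y) p < c \<longleftrightarrow> norm (y - x) < c * (sqrt u * sqrt v)"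
      using u by (simp add: Some chordal_def flip: u_def v_def) (simp add: divide_less_eq)
    also have "\<dots> \<longleftrightarrow> (norm (y - x))\<^sup>2 < (c * (sqrt u * sqrt v))\<^sup>2"
      using assms u by (intro less_iff_power2_less) auto
    also have "(c * (sqrt u * sqrt v))\<^sup>2 = m * u" using u by (simp add: power_mult_distrib m_def v_def)
    also have "(norm (y - x))\<^sup>2 = (norm y)\<^sup>2 + (norm x)\<^sup>2 - 2 * (x \<bullet> y)"
      by (simp add: power2_norm_eq_inner inner_diff inner_commute)
    finally show ?thesis by (simp add: u_def algebra_simps)
  qed
  then show ?thesis using connected_quadric[of "1 - m" x "(norm x)\<^sup>2 - m"] assms by simp
qed

subsection \<open>Continuous injections into the extended space\<close>

text \<open>Only continuity and injectivity are assumed, since this is what is known of the limit at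
  first; continuity of the inverse is derived inside.\<close>

locale ext_embedding =
  fixes D :: "(real^'n::finite) set" and g :: "real^'n \<Rightarrow> 'n ext"
  assumes card: "2 \<le> CARD('n)" and open_D: "open D" and inj: "inj_on g D"
    and cont: "continuous_on D (\<lambda>x. stereo (g x))"
begin

lemma chordal_continuous:
  assumes "u \<in> D" "0 < \<epsilon>"
  obtains d where "0 < d" "ball u d \<subseteq> D" "\<And>y. y \<in> ball u d \<Longrightarrow> chordal (g y) (g u) < \<epsilon>"
proof -
  obtain d1 where d1: "0 < d1" "ball u d1 \<subseteq> D" using open_D assms(1) open_contains_ball by blast
  obtain d2 where d2: "0 < d2" "\<And>y. y \<in> D \<Longrightarrow> dist y u < d2 \<Longrightarrow> chordal (g y) (g u) < \<epsilon>"
    using cont[unfolded continuous_on_stereo_iff, rule_format, OF assms] by blast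
  show thesis
  proof (rule that[of "min d1 d2"])
    show "ball u (min d1 d2) \<subseteq> D" using d1(2) by auto
    fix y assume "y \<in> ball u (min d1 d2)"
    then have "y \<in> D" "dist y u < d2" using d1(2) by (auto simp: dist_commute)
    then show "chordal (g y) (g u) < \<epsilon>" by (rule d2(2))
  qed (use d1 d2 in simp)
qed

text \<open>By injectivity at most one point is sent to infinity, so a nearby point has a finite
  image.\<close>

lemma exists_finite_near:
  assumes "open U" "U \<subseteq> D" "u \<in> U" "0 < \<epsilon>"
  obtains u' where "u' \<in> U" "g u' \<noteq> None" "chordal (g u') (g u) < \<epsilon>"
proof (cases "g u = None")
  case False
  then show ?thesis using that[of u] assms by simp
next
  case True
  obtain d where d: "0 < d" "\<And>y. y \<in> ball u d \<Longrightarrow> chordal (g y) (g u) < \<epsilon>"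
    using chordal_continuous[OF subsetD[OF assms(2,3)] assms(4)] by metis
  obtain d' where d': "0 < d'" "ball u d' \<subseteq> U" using assms open_contains_ball by blast
  obtain v where v: "v \<noteq> u" "dist v u < min d d'" using perfect_choose_dist[of "min d d'" u] d d' by auto
  have "v \<in> ball u d'" using v(2) by (simp add: dist_commute)
  then have "v \<in> U" using d'(2) by blast
  moreover have "g v \<noteq> None" using inj_onD[OF inj, of v u] v(1) assms(2,3) \<open>v \<in> U\<close> True by auto
  ultimately show ?thesis using that[of v] d v by (simp add: dist_commute)
qed

lemma finite_part:
  assumes "open U" "U \<subseteq> D"
  shows "open {x\<in>U. g x \<noteq> None}" "continuous_on {x\<in>U. g x \<noteq> None} (\<lambda>x. the (g x))"
    "{y. Some y \<in> g ` U} = (\<lambda>x. the (g x)) ` {x\<in>U. g x \<noteq> None}"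
proof -
  have c: "continuous_on U (\<lambda>x. stereo (g x))" using cont assms continuous_on_subset by blast
  have "open (U \<inter> (\<lambda>x. stereo (g x)) -` {z. snd z \<noteq> 1})"
    by (intro continuous_open_preimage c assms open_Collect_neq continuous_intros)
  moreover have "U \<inter> (\<lambda>x. stereo (g x)) -` {z. snd z \<noteq> 1} = {x\<in>U. g x \<noteq> None}" by auto
  ultimately show "open {x\<in>U. g x \<noteq> None}" by simp
  show "continuous_on {x\<in>U. g x \<noteq> None} (\<lambda>x. the (g x))"
    by (intro continuous_on_the continuous_on_subset[OF c]) auto
  show "{y. Some y \<in> g ` U} = (\<lambda>x. the (g x)) ` {x\<in>U. g x \<noteq> None}"
  proof (intro set_eqI iffI)
    fix y assume "y \<in> {y. Some y \<in> g ` U}"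
    then obtain x where "x \<in> U" "g x = Some y" by (auto simp: image_iff)
    then show "y \<in> (\<lambda>x. the (g x)) ` {x\<in>U. g x \<noteq> None}" by (intro image_eqI[of _ _ x]) auto
  next
    fix y assume "y \<in> (\<lambda>x. the (g x)) ` {x\<in>U. g x \<noteq> None}"
    then obtain x where x: "x \<in> U" "g x = Some y" by auto
    then show "y \<in> {y. Some y \<in> g ` U}" using imageI[of x U g] by simp
  qed
qed

text \<open>Invariance of domain is applied to \<open>the \<circ> g\<close> on the open set of
  points with finite image, a map between Euclidean spaces of equal dimension.\<close>

lemma open_image:
  assumes "open U" "U \<subseteq> D" shows "open {y. Some y \<in> g ` U}"
proof -
  have "inj_on (\<lambda>x. the (g x)) {x\<in>U. g x \<noteq> None}"
  proof (rule inj_onI)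
    fix x y assume "x \<in> {x\<in>U. g x \<noteq> None}" "y \<in> {x\<in>U. g x \<noteq> None}" "the (g x) = the (g y)"
    then have "g x = g y" "x \<in> D" "y \<in> D" using assms by auto
    then show "x = y" using inj by (meson inj_onD)
  qed
  then show ?thesis
    using invariance_of_domain[OF finite_part(2,1)[OF assms]] finite_part(3)[OF assms] by simp
qed

lemma closed_image:
  assumes "compact K" "K \<subseteq> D"
  shows "closed ((\<lambda>x. stereo (g x)) ` K)" "closed {y. Some y \<in> g ` K}"
proof -
  show 1: "closed ((\<lambda>x. stereo (g x)) ` K)"
    using assms cont continuous_on_subset by (intro compact_imp_closed compact_continuous_image) blast+
  have "closed ((\<lambda>y. stereo (Some y)) -` ((\<lambda>x. stereo (g x)) ` K))"
    by (rule continuous_closed_vimage[OF 1]) (use continuous_on_stereo_Some[of UNIV] in \<open>simp add: continuous_on_eq_continuous_at\<close>)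
  moreover have "(\<lambda>y. stereo (Some y)) -` ((\<lambda>x. stereo (g x)) ` K) = {y. Some y \<in> g ` K}"
    unfolding vimage_def image_iff stereo_eq_iff ..
  ultimately show "closed {y. Some y \<in> g ` K}" by simp
qed

text \<open>Chordal balls are connected, and \<open>g ` ball x e\<close> is open and closed relative to a chordal ball
  that misses \<open>g ` sphere x e\<close>.\<close>
lemma chordal_ball_subset_image:
  assumes x: "x \<in> D" "cball x e \<subseteq> D" "0 < e"
    and sph: "\<And>y. y \<in> sphere x e \<Longrightarrow> c \<le> chordal (g y) p" and near: "chordal (g x) p < c" and q: "chordal q p < c"
  shows "q \<in> g ` cball x e"
proof -
  have c: "0 < c" using near chordal_nonneg[of "g x" p] by linarith
  define B where "B = {y. chordal (Some y) p < c}"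
  have sub: "ball x e \<subseteq> D" using x(2) ball_subset_cball by blast
  have fin: "y \<in> {y. Some y \<in> g ` cball x e}" if "y \<in> B" for y
  proof (rule ccontr)
    assume n: "y \<notin> {y. Some y \<in> g ` cball x e}"
    define A1 where "A1 = {y. Some y \<in> g ` ball x e}"
    define A2 where "A2 = - {y. Some y \<in> g ` cball x e}"
    have "open A1" unfolding A1_def by (rule open_image[OF open_ball sub])
    moreover have "open A2" unfolding A2_def using closed_image(2)[OF compact_cball x(2)] by (rule open_Compl)
    moreover have "A1 \<inter> A2 \<inter> B = {}" unfolding A1_def A2_def using ball_subset_cball[of x e] by blast
    moreover have "B \<subseteq> A1 \<union> A2"
    proof
      fix z assume z: "z \<in> B"
      show "z \<in> A1 \<union> A2"
      proof (cases "z \<in> A2")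
        case False
        then obtain w where w: "w \<in> cball x e" "Some z = g w" unfolding A2_def by blast
        have "w \<notin> sphere x e" using sph[of w] z w unfolding B_def by (metis mem_Collect_eq not_le)
        then have "w \<in> ball x e" using w by auto
        then show ?thesis using w(2) unfolding A1_def by blast
      qed simp
    qed
    \<comment> \<open>The centre value \<open>g x\<close> itself may be infinite, hence the detour
      through a nearby point \<open>u\<close>.\<close>
    moreover have "A1 \<inter> B \<noteq> {}"
    proof -
      obtain u where u: "u \<in> ball x e" "g u \<noteq> None" "chordal (g u) (g x) < c - chordal (g x) p"
        using exists_finite_near[OF open_ball sub, of x "c - chordal (g x) p"] near x(3) by auto
      have "chordal (g u) p < c" using u(3) chordal_triangle[of "g u" p "g x"] by linarith
      then have "the (g u) \<in> A1 \<inter> B" using u unfolding A1_def B_def by (auto simp: image_iff)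
      then show ?thesis by blast
    qed
    moreover have "A2 \<inter> B \<noteq> {}" using n that unfolding A2_def by blast
    moreover have "connected B" unfolding B_def by (rule connected_chordal_ball[OF card c])
    ultimately show False unfolding connected_def by blast
  qed
  show ?thesis
  proof (cases q)
    case (Some y)
    then show ?thesis using fin[of y] q by (simp add: B_def)
  next
    \<comment> \<open>Infinity is a limit of finite points of the chordal ball. These are already
      known to lie in the image, which is closed.\<close>
    case None
    show ?thesis
    proof (rule ccontr)
      define S where "S = (\<lambda>x. stereo (g x)) ` cball x e"
      assume "q \<notin> g ` cball x e"
      then have "stereo None \<notin> S" unfolding S_def None image_iff stereo_eq_iff by simp
      then obtain \<epsilon> where \<epsilon>: "0 < \<epsilon>" "\<And>z. dist z (stereo None) < \<epsilon> \<Longrightarrow> z \<notin> S"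
        using closed_image(1)[OF compact_cball x(2)] unfolding S_def closed_def open_dist by (metis ComplD ComplI)
      obtain y :: "real^'n" where y: "chordal (Some y) None < min \<epsilon> (c - chordal None p)"
        using exists_chordal_None_less[of "min \<epsilon> (c - chordal None p)"] \<epsilon> q None by auto
      then have "chordal (Some y) p < c" using chordal_triangle[of "Some y" p None] by linarith
      then have "Some y \<in> g ` cball x e" using fin[of y] unfolding B_def by simp
      then have "stereo (Some y) \<in> S" unfolding S_def image_image[symmetric] by (rule imageI)
      then show False using \<epsilon>(2)[of "stereo (Some y)"] y by (simp add: chordal_eq_dist del: stereo_simps)
    qed
  qed
qed

text \<open>Let \<open>d\<close> be the least chordal distance from \<open>g x\<close> to the image
  of a small sphere about \<open>x\<close>. The image of the closed ball covers the chordal ball of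
  radius \<open>d\<close> about \<open>g x\<close>, so by injectivity any point sent there lies in
  that small ball.\<close>

lemma homeo_into: "homeo_into D g"
proof -
  have "\<exists>d>0. \<forall>y\<in>D. chordal (g y) (g x) < d \<longrightarrow> dist y x < e" if x: "x \<in> D" and e: "e > 0" for x e
  proof -
    obtain e0 where e0: "0 < e0" "cball x e0 \<subseteq> D" using open_D x open_contains_cball by blast
    define e' where "e' = min e0 (e / 2)"
    have e': "0 < e'" "e' < e" "cball x e' \<subseteq> D" using e0 e by (auto simp: e'_def subset_iff)
    have sD: "sphere x e' \<subseteq> D" using e'(3) sphere_cball by blast
    have "continuous_on (sphere x e') (\<lambda>y. chordal (g y) (g x))" unfolding chordal_eq_dist
      by (intro continuous_intros continuous_on_subset[OF cont sD])
    moreover have "sphere x e' \<noteq> {}" using e' by simp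
    ultimately obtain w where w: "w \<in> sphere x e'" "\<And>y. y \<in> sphere x e' \<Longrightarrow> chordal (g w) (g x) \<le> chordal (g y) (g x)"
      using continuous_attains_inf[OF compact_sphere] by metis
    define d where "d = chordal (g w) (g x)"
    have "w \<noteq> x" using w(1) e' by auto
    then have "g w \<noteq> g x" using inj w(1) x sD by (meson inj_onD subsetD)
    then have d: "0 < d" unfolding d_def using chordal_eq_0_iff[of "g w" "g x"] chordal_nonneg[of "g w" "g x"] by linarith
    have "dist y x < e" if y: "y \<in> D" "chordal (g y) (g x) < d" for y
    proof -
      have "g y \<in> g ` cball x e'"
        by (rule chordal_ball_subset_image[where p="g x" and c=d]) (use x e' w y d in \<open>simp_all add: d_def\<close>)
      then have "y \<in> cball x e'" using inj y(1) e'(3) by (meson inj_on_image_mem_iff)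
      then show ?thesis using e' by (simp add: dist_commute)
    qed
    with d show ?thesis by blast
  qed
  then show ?thesis unfolding homeo_into_def using inj cont unfolding continuous_on_stereo_iff by blast
qed

lemma continuous_on_inv_path:
  assumes \<gamma>: "continuous_on I (\<lambda>t::real. stereo (\<gamma> t))" and im: "\<And>t. t \<in> I \<Longrightarrow> \<gamma> t \<in> g ` D"
  shows "continuous_on I (\<lambda>t. inv_into D g (\<gamma> t))"
  unfolding continuous_on_iff
proof (intro ballI allI impI)
  fix t :: real and e :: real assume t: "t \<in> I" and e: "0 < e"
  let ?x = "inv_into D g (\<gamma> t)"
  have x: "?x \<in> D" "g ?x = \<gamma> t" using im[OF t] by (auto simp: inv_into_into f_inv_into_f)
  obtain d where d: "0 < d" "\<And>y. y \<in> D \<Longrightarrow> chordal (g y) (g ?x) < d \<Longrightarrow> dist y ?x < e"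
    using homeo_into[unfolded homeo_into_def, THEN conjunct2, THEN conjunct2, rule_format, OF x(1) e] by blast
  obtain d' where d': "0 < d'" "\<And>u. u \<in> I \<Longrightarrow> dist u t < d' \<Longrightarrow> dist (stereo (\<gamma> u)) (stereo (\<gamma> t)) < d"
    using \<gamma>[unfolded continuous_on_iff, rule_format, OF t d(1)] by blast
  have "dist (inv_into D g (\<gamma> u)) ?x < e" if u: "u \<in> I" "dist u t < d'" for u
  proof (rule d(2))
    show "inv_into D g (\<gamma> u) \<in> D" using im[OF u(1)] by (rule inv_into_into)
    show "chordal (g (inv_into D g (\<gamma> u))) (g ?x) < d"
      unfolding x(2) f_inv_into_f[OF im[OF u(1)]] chordal_eq_dist by (rule d'(2)[OF u])
  qed
  with d'(1) show "\<exists>d>0. \<forall>x'\<in>I. dist x' t < d \<longrightarrow> dist (inv_into D g (\<gamma> x')) (inv_into D g (\<gamma> t)) < e" by blast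
qed

end

lemma ext_embedding_homeo_into:
  assumes "2 \<le> CARD('n)" "open D" "homeo_into D (g :: real^'n \<Rightarrow> 'n::finite ext)"
  shows "ext_embedding D g"
  using assms by unfold_locales (simp_all add: homeo_into_def continuous_on_stereo_iff)

text \<open>\<psi> is a lift of \<gamma> through \<open>g\<close>, required only up to time
  \<open>u\<close>. Since \<open>path_fam\<close> confines interior points merely to
  \<open>D\<close>, any time on the inner sphere followed by any later time on the outer sphere will
  do.\<close>

lemma crossing_subpath:
  fixes \<psi> :: "real \<Rightarrow> real^'n::finite"
  assumes cont: "continuous_on {0..u} \<psi>" and D: "\<And>t. t \<in> {0..u} \<Longrightarrow> \<psi> t \<in> D"
    and \<gamma>: "\<And>t. t \<in> {0..u} \<Longrightarrow> g (\<psi> t) = \<gamma> t"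
    and u: "0 \<le> u" "u \<le> 1" and r: "dist x0 (\<psi> 0) \<le> r1" "r1 < r2" "r2 \<le> dist x0 (\<psi> u)"
  shows "\<exists>a b. 0 \<le> a \<and> a < b \<and> b \<le> 1 \<and>
    (\<exists>\<gamma>'\<in>(\<lambda>\<gamma>. g \<circ> \<gamma>) ` path_fam (sphere x0 r1) (sphere x0 r2) D. \<forall>t\<in>{0..1}. \<gamma>' t = \<gamma> (a + (b - a) * t))"
proof -
  have c: "continuous_on {0..u} (\<lambda>t. dist x0 (\<psi> t))" by (intro continuous_intros cont)
  have "\<exists>a\<ge>0. a \<le> u \<and> dist x0 (\<psi> a) = r1"
    by (rule IVT') (use r u c in simp_all)
  then obtain a where a: "0 \<le> a" "a \<le> u" "dist x0 (\<psi> a) = r1" by blast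
  have "continuous_on {a..u} (\<lambda>t. dist x0 (\<psi> t))" using a by (intro continuous_on_subset[OF c]) auto
  then have "\<exists>b\<ge>a. b \<le> u \<and> dist x0 (\<psi> b) = r2"
    by (intro IVT') (use r a in simp_all)
  then obtain b where b: "a \<le> b" "b \<le> u" "dist x0 (\<psi> b) = r2" by blast
  have "a \<noteq> b" using a(3) b(3) r(2) by auto
  then have ab: "0 \<le> a" "a < b" "b \<le> 1" using a b u by auto
  define \<psi>' where "\<psi>' t = \<psi> (a + (b - a) * t)" for t
  have mem: "a + (b - a) * t \<in> {0..u}" if "t \<in> {0..1}" for t
    using affine_mem_Icc[of a b t] that ab b by auto
  have "continuous_on {0..1} \<psi>'" unfolding \<psi>'_def
    by (intro continuous_on_compose2[OF cont] continuous_intros) (use mem in auto)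
  moreover have "\<psi>' 0 \<in> sphere x0 r1" "\<psi>' 1 \<in> sphere x0 r2" using a b by (simp_all add: \<psi>'_def)
  moreover have "\<psi>' t \<in> D" if "t \<in> {0<..<1}" for t
    unfolding \<psi>'_def by (rule D[OF mem]) (use that in auto)
  ultimately have fam: "\<psi>' \<in> path_fam (sphere x0 r1) (sphere x0 r2) D" by (simp add: path_fam_def)
  have "(g \<circ> \<psi>') t = \<gamma> (a + (b - a) * t)" if "t \<in> {0..1}" for t
    using \<gamma>[OF mem[OF that]] by (simp add: \<psi>'_def)
  with ab fam show ?thesis by blast
qed

subsection \<open>Injectivity of the limit\<close>

lemma cball_subset_open_enlarge:
  fixes S :: "'a::euclidean_space set"
  assumes "open S" "cball z r \<subseteq> S" "0 < r"
  obtains \<epsilon> where "0 < \<epsilon>" "cball z (r + \<epsilon>) \<subseteq> S"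
proof -
  obtain \<epsilon> where \<epsilon>: "0 < \<epsilon>" "(\<Union>x\<in>cball z r. cball x \<epsilon>) \<subseteq> S"
    using compact_subset_open_imp_cball_epsilon_subset[OF compact_cball assms(1,2)] by blast
  have "cball z (r + \<epsilon>) \<subseteq> S"
  proof
    fix y assume y: "y \<in> cball z (r + \<epsilon>)"
    show "y \<in> S"
    proof (cases "y \<in> cball z r")
      case False
      then have d: "r < dist z y" "dist z y \<le> r + \<epsilon>" using y by auto
      \<comment> \<open>The radial projection of \<open>y\<close> onto the sphere of radius
        \<open>r\<close>.\<close>
      define x where "x = z + (r / dist z y) *\<^sub>R (y - z)"
      have "y \<noteq> z" using d assms(3) by auto
      then have "dist z x = r" using d assms(3) by (simp add: x_def dist_norm norm_minus_commute)
      moreover have "dist x y \<le> \<epsilon>"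
      proof -
        have "y - x = (1 - r / dist z y) *\<^sub>R (y - z)" by (simp add: x_def algebra_simps)
        then have "norm (y - x) = \<bar>1 - r / dist z y\<bar> * dist z y" by (simp add: dist_norm norm_minus_commute)
        also have "\<dots> = dist z y - r"
        proof -
          have "0 < dist z y" using d assms(3) by linarith
          then have "0 \<le> 1 - r / dist z y" using d by simp
          then have "\<bar>1 - r / dist z y\<bar> * dist z y = (1 - r / dist z y) * dist z y" by simp
          also have "\<dots> = dist z y - r" using \<open>0 < dist z y\<close> by (simp add: left_diff_distrib)
          finally show ?thesis .
        qed
        finally show ?thesis using d by (simp add: dist_norm norm_minus_commute)
      qed
      ultimately have "x \<in> cball z r" "y \<in> cball x \<epsilon>" by simp_all
      then show ?thesis using \<epsilon>(2) by blast
    qed (use assms(2) in blast)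
  qed
  with \<epsilon>(1) show thesis by (rule that)
qed

text \<open>The set is the union of the connected complements of slightly larger open balls, all of
  which contain \<open>w\<close>.\<close>

lemma connected_open_diff_cball:
  fixes S :: "'a::euclidean_space set"
  assumes "open S" "connected S" "cball z r \<subseteq> S" "2 \<le> DIM('a)" "0 < r"
  shows "connected (S - cball z r)"
proof -
  obtain \<epsilon> where \<epsilon>: "0 < \<epsilon>" and sub: "cball z (r + \<epsilon>) \<subseteq> S"
    using cball_subset_open_enlarge[OF assms(1,3,5)] by blast
  obtain w where w: "dist z w = r + \<epsilon>"
    using vector_choose_dist[of "r + \<epsilon>" z] \<epsilon> assms(5) by auto
  have "connected (\<Union>\<delta>\<in>{0<..<\<epsilon>}. S - ball z (r + \<delta>))"
  proof (rule connected_Union)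
    fix T assume "T \<in> (\<lambda>\<delta>. S - ball z (r + \<delta>)) ` {0<..<\<epsilon>}"
    then obtain \<delta> where \<delta>: "0 < \<delta>" "\<delta> < \<epsilon>" "T = S - ball z (r + \<delta>)" by auto
    have "cball z (r + \<delta>) \<subseteq> cball z (r + \<epsilon>)" using \<delta>(2) by (intro subset_cball) simp
    then show "connected T" unfolding \<delta>(3) using sub by (intro connected_diff_ball assms) blast
  next
    have "w \<in> S" using w sub by auto
    then have "w \<in> S - ball z (r + \<delta>)" if "\<delta> \<in> {0<..<\<epsilon>}" for \<delta> using w that by simp
    then show "\<Inter>((\<lambda>\<delta>. S - ball z (r + \<delta>)) ` {0<..<\<epsilon>}) \<noteq> {}" by blast
  qed
  also have "(\<Union>\<delta>\<in>{0<..<\<epsilon>}. S - ball z (r + \<delta>)) = S - cball z r"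
  proof (intro set_eqI iffI)
    fix y assume y: "y \<in> S - cball z r"
    define \<delta> where "\<delta> = min (\<epsilon> / 2) (dist z y - r)"
    have "\<delta> \<in> {0<..<\<epsilon>}" "y \<in> S - ball z (r + \<delta>)" using y \<epsilon> by (auto simp: \<delta>_def)
    then show "y \<in> (\<Union>\<delta>\<in>{0<..<\<epsilon>}. S - ball z (r + \<delta>))" by blast
  qed auto
  finally show ?thesis .
qed

section \<open>Paths joining the images of a ball and of an exterior\<close>

context ext_embedding
begin

text \<open>At most one point is sent to infinity, and deleting a point from a connected open set
  leaves it connected in dimension at least two.\<close>

lemma connected_image:
  assumes "open V" "connected V" "V \<subseteq> D"
  shows "connected {y. Some y \<in> g ` V}"
proof -
  have "connected {x\<in>V. g x \<noteq> None}"
  proof (cases "\<exists>a\<in>V. g a = None")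
    case True
    then obtain a where a: "a \<in> V" "g a = None" by blast
    have "x = a" if "x \<in> V" "g x = None" for x
      by (rule inj_onD[OF inj]) (use that a assms(3) in auto)
    then have "{x\<in>V. g x \<noteq> None} = V - {a}" using a by blast
    then show ?thesis using connected_open_delete[OF assms(1,2)] card by simp
  next
    case False
    then have "{x\<in>V. g x \<noteq> None} = V" by auto
    then show ?thesis using assms by simp
  qed
  then show ?thesis
    unfolding finite_part(3)[OF assms(1,3)] by (intro connected_continuous_image finite_part(2)[OF assms(1,3)])
qed

lemma exists_image_point_near:
  assumes "open V" "V \<subseteq> D" "v \<in> V" "0 < \<epsilon>"
  obtains y where "Some y \<in> g ` V" "chordal (Some y) (g v) < \<epsilon>"
proof -
  obtain u where u: "u \<in> V" "g u \<noteq> None" "chordal (g u) (g v) < \<epsilon>"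
    using exists_finite_near[OF assms] by blast
  then obtain y where "g u = Some y" by blast
  then show thesis using that[of y] u imageI[OF u(1), of g] by simp
qed

lemma modulus_image_ring_ge:
  assumes z: "z \<in> D" and r: "0 < r1" "r1 < r2" "cball z r2 \<subseteq> D"
  shows "modulus ((\<lambda>\<beta>. Some \<circ> \<beta>) ` path_fam {y. Some y \<in> g ` ball z r1} {y. Some y \<in> g ` (D - cball z r2)} UNIV)
      \<le> modulus ((\<lambda>\<gamma>. g \<circ> \<gamma>) ` path_fam (sphere z r1) (sphere z r2) D)"
proof (rule modulus_mono_subpath)
  fix \<gamma> assume "\<gamma> \<in> (\<lambda>\<beta>. Some \<circ> \<beta>) ` path_fam {y. Some y \<in> g ` ball z r1} {y. Some y \<in> g ` (D - cball z r2)} UNIV"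
  then obtain \<beta> where \<gamma>: "\<gamma> = Some \<circ> \<beta>" and \<beta>: "continuous_on {0..1} \<beta>"
     "Some (\<beta> 0) \<in> g ` ball z r1" "Some (\<beta> 1) \<in> g ` (D - cball z r2)"
    unfolding path_fam_def by blast
  have bD: "ball z r2 \<subseteq> D" using r(3) ball_subset_cball by blast
  define O' where "O' = {y. Some y \<in> g ` ball z r2}"
  define C where "C = {y. Some y \<in> g ` cball z r2}"
  have "open O'" unfolding O'_def by (rule open_image[OF open_ball bD])
  have "closed C" unfolding C_def by (rule closed_image(2)[OF compact_cball r(3)])
  define T where "T = {0..1} \<inter> \<beta> -` (- O')"
  have "closed T" unfolding T_def
    by (rule continuous_closed_preimage[OF \<beta>(1)]) (use \<open>open O'\<close> in auto)
  moreover have "bounded T" by (rule bounded_subset[of "{0..1}"]) (auto simp: T_def)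
  ultimately have "compact T" by (simp add: compact_eq_bounded_closed)
  obtain w where w: "w \<in> D - cball z r2" "Some (\<beta> 1) = g w" using \<beta>(3) by blast
  have "\<beta> 1 \<notin> O'"
  proof
    assume "\<beta> 1 \<in> O'"
    then obtain w' where w': "w' \<in> ball z r2" "Some (\<beta> 1) = g w'" unfolding O'_def by blast
    have "w' = w" by (rule inj_onD[OF inj]) (use w w' bD in auto)
    then show False using w(1) w'(1) by simp
  qed
  then have "1 \<in> T" by (simp add: T_def)
  then have "T \<noteq> {}" by blast
  then obtain u where u: "u \<in> T" "\<And>t. t \<in> T \<Longrightarrow> u \<le> t"
    using compact_attains_inf[OF \<open>compact T\<close>] by blast
  have u01: "0 \<le> u" "u \<le> 1" using u(1) by (auto simp: T_def)
  obtain w0 where w0: "w0 \<in> ball z r1" "Some (\<beta> 0) = g w0" using \<beta>(2) by blast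
  have "w0 \<in> ball z r2" using w0(1) r(2) by simp
  then have "\<beta> 0 \<in> O'" using imageI[of w0 "ball z r2" g] w0(2) by (simp add: O'_def)
  then have "u \<noteq> 0" using u(1) unfolding T_def by auto
  have before: "\<beta> t \<in> O'" if "0 \<le> t" "t < u" for t
  proof (rule ccontr)
    assume "\<beta> t \<notin> O'"
    then have "t \<in> T" using that u01 by (simp add: T_def)
    then show False using u(2)[of t] that by simp
  qed
  have "O' \<subseteq> C" unfolding O'_def C_def using ball_subset_cball[of z r2] by blast
  \<comment> \<open>At the exit time \<open>u\<close> itself the path is still in the closed image
    \<open>C\<close>, as a limit of earlier times, so the lift is defined there too.\<close>
  have "closed ({0..u} \<inter> \<beta> -` C)"
    by (intro continuous_closed_preimage continuous_on_subset[OF \<beta>(1)]) (use u01 \<open>closed C\<close> in auto)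
  moreover have "{0..<u} \<subseteq> {0..u} \<inter> \<beta> -` C" using subsetD[OF \<open>O' \<subseteq> C\<close> before] by auto
  moreover have "closure {0..<u} = {0..u}" using u01 \<open>u \<noteq> 0\<close> by simp
  ultimately have inC: "{0..u} \<subseteq> {0..u} \<inter> \<beta> -` C" by (metis closure_minimal)
  define \<psi> where "\<psi> t = inv_into D g (Some (\<beta> t))" for t
  have im: "Some (\<beta> t) \<in> g ` D" if "t \<in> {0..u}" for t
    using inC that r(3) unfolding C_def by blast
  have "\<exists>a b. 0 \<le> a \<and> a < b \<and> b \<le> 1 \<and>
    (\<exists>\<gamma>'\<in>(\<lambda>\<gamma>. g \<circ> \<gamma>) ` path_fam (sphere z r1) (sphere z r2) D. \<forall>t\<in>{0..1}. \<gamma>' t = \<gamma> (a + (b - a) * t))"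
  proof (rule crossing_subpath[where \<psi>=\<psi>])
    have "continuous_on {0..u} (\<lambda>t. stereo (Some (\<beta> t)))"
      by (intro continuous_on_compose2[OF continuous_on_stereo_Some[of UNIV]] continuous_on_subset[OF \<beta>(1)]) (use u01 in auto)
    then show "continuous_on {0..u} \<psi>" unfolding \<psi>_def by (rule continuous_on_inv_path) (rule im)
    show "\<psi> t \<in> D" if "t \<in> {0..u}" for t unfolding \<psi>_def by (rule inv_into_into[OF im[OF that]])
    show "g (\<psi> t) = \<gamma> t" if "t \<in> {0..u}" for t unfolding \<psi>_def \<gamma> by (simp add: f_inv_into_f[OF im[OF that]])
    have "w0 \<in> D" using \<open>w0 \<in> ball z r2\<close> bD by blast
    then have "\<psi> 0 = w0" unfolding \<psi>_def w0(2) by (rule inv_into_f_f[OF inj])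
    then show "dist z (\<psi> 0) \<le> r1" using w0(1) by simp
    show "r2 \<le> dist z (\<psi> u)"
    proof (rule ccontr)
      assume "\<not> r2 \<le> dist z (\<psi> u)"
      then have "g (\<psi> u) \<in> g ` ball z r2" by (intro imageI) simp
      moreover have "g (\<psi> u) = Some (\<beta> u)" unfolding \<psi>_def using im[of u] u01 by (simp add: f_inv_into_f)
      ultimately have "\<beta> u \<in> O'" unfolding O'_def by simp
      then show False using u(1) by (simp add: T_def)
    qed
  qed (use u01 r in auto)
  moreover have "the \<circ> \<gamma> = \<beta>" unfolding \<gamma> by auto
  ultimately show "continuous_on {0..1} (the \<circ> \<gamma>) \<and> (\<exists>a b. 0 \<le> a \<and> a < b \<and> b \<le> 1 \<and>
    (\<exists>\<gamma>'\<in>(\<lambda>\<gamma>. g \<circ> \<gamma>) ` path_fam (sphere z r1) (sphere z r2) D. \<forall>t\<in>{0..1}. \<gamma>' t = \<gamma> (a + (b - a) * t)))"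
    using \<beta>(1) by simp
qed

end

section \<open>Spheres met by connected sets\<close>

lemma connected_meets_spheres:
  fixes S :: "'a::metric_space set"
  assumes "connected S" "y1 \<in> S" "y2 \<in> S" "dist x0 y1 \<le> r" "r \<le> dist x0 y2"
  shows "\<exists>e\<in>S. dist x0 e = r"
proof -
  have "connected (dist x0 ` S)" by (intro connected_continuous_image continuous_intros assms(1))
  then have "r \<in> dist x0 ` S" using connectedD_interval assms by blast
  then show ?thesis by blast
qed

text \<open>A connected set with one point close to \<open>p\<close> and one far from \<open>p\<close> meets many spheres: centred at
  \<open>p\<close> if \<open>p\<close> is finite, and at the origin if \<open>p\<close> is the point at infinity.\<close>
lemma exists_centre_meeting_spheres:
  assumes "2 \<le> CARD('n)" "0 < c"
  obtains x0 :: "real^'n::finite" and s \<epsilon> :: real where "0 < s" "0 < \<epsilon>"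
    "\<And>S y1 y2 r. connected S \<Longrightarrow> y1 \<in> S \<Longrightarrow> y2 \<in> S \<Longrightarrow> chordal (Some y1) p < \<epsilon> \<Longrightarrow> c \<le> chordal (Some y2) p \<Longrightarrow>
      r \<in> {s..<s * 4 ^ N} \<Longrightarrow> \<exists>e\<in>S. dist x0 e = r"
proof (cases p)
  case (Some x)
  interpret ext_embedding UNIV "Some :: real^'n \<Rightarrow> _"
    by unfold_locales (use assms continuous_on_stereo_Some in auto)
  \<comment> \<open>The top radius is \<open>c\<close> because chordal distance is at most Euclidean
    distance, so the far point has distance at least \<open>c\<close> from \<open>x\<close>. The
    bottom radius determines \<epsilon>.\<close>
  define s where "s = c / 4 ^ N"
  have s: "0 < s" "s * 4 ^ N = c" using assms by (simp_all add: s_def)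
  obtain \<epsilon> where \<epsilon>: "0 < \<epsilon>" "\<And>y. chordal (Some y) (Some x) < \<epsilon> \<Longrightarrow> dist y x < s"
    using homeo_into[unfolded homeo_into_def, THEN conjunct2, THEN conjunct2, rule_format, OF UNIV_I s(1), of x] by blast
  show thesis
  proof (rule that[of s \<epsilon> x])
    fix S y1 y2 r
    assume S: "connected S" "y1 \<in> S" "y2 \<in> S" and y: "chordal (Some y1) p < \<epsilon>" "c \<le> chordal (Some y2) p"
      and r: "r \<in> {s..<s * 4 ^ N}"
    have "dist x y1 \<le> r" using \<epsilon>(2)[of y1] y(1) r Some by (simp add: dist_commute)
    moreover have "r \<le> dist x y2"
      using y(2) chordal_le_norm[of y2 x] r s(2) Some by (simp add: dist_norm norm_minus_commute)
    ultimately show "\<exists>e\<in>S. dist x e = r" by (rule connected_meets_spheres[OF S])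
  qed (use s \<epsilon> in auto)
next
  case None
  \<comment> \<open>For \<open>p\<close> at infinity the roles are exchanged: staying away from
    \<open>p\<close> means norm at most \<open>1 / c\<close>, and being \<epsilon>-close to
    \<open>p\<close> means norm above \<open>R\<close>.\<close>
  define s where "s = 1 / c"
  define R where "R = s * 4 ^ N"
  have s: "0 < s" "0 < R" using assms by (simp_all add: s_def R_def)
  define \<epsilon> where "\<epsilon> = 1 / sqrt (1 + R\<^sup>2)"
  have R1: "0 < 1 + R\<^sup>2" by (metis add_pos_nonneg zero_le_power2 zero_less_one)
  show thesis
  proof (rule that[of s \<epsilon> 0])
    show "0 < \<epsilon>" using R1 by (simp add: \<epsilon>_def)
    fix S :: "(real^'n) set" and y1 y2 r
    assume S: "connected S" "y1 \<in> S" "y2 \<in> S" and y: "chordal (Some y1) p < \<epsilon>" "c \<le> chordal (Some y2) p"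
      and r: "r \<in> {s..<s * 4 ^ N}"
    have "1 / sqrt (1 + (norm y1)\<^sup>2) < 1 / sqrt (1 + R\<^sup>2)" using y(1) None by (simp add: chordal_def \<epsilon>_def)
    then have "sqrt (1 + R\<^sup>2) < sqrt (1 + (norm y1)\<^sup>2)"
      using frac_le[of 1 1 "sqrt (1 + (norm y1)\<^sup>2)" "sqrt (1 + R\<^sup>2)"] by force
    then have "R\<^sup>2 < (norm y1)\<^sup>2" by simp
    then have "R < norm y1" by (rule power2_less_imp_less) simp
    then have 1: "r \<le> dist 0 y1" using r by (simp add: R_def)
    have "norm y2 \<le> sqrt (1 + (norm y2)\<^sup>2)" by (rule real_le_rsqrt) simp
    moreover have "sqrt (1 + (norm y2)\<^sup>2) \<le> s"
      using y(2) None assms(2) by (simp add: chordal_def s_def field_simps)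
    ultimately have 2: "dist 0 y2 \<le> r" using r by simp
    show "\<exists>e\<in>S. dist 0 e = r" by (rule connected_meets_spheres[OF S(1,3,2) 2 1])
  qed (use s in auto)
qed

subsection \<open>Locally uniform limits\<close>

lemma loc_unif_conv_compact:
  assumes conv: "loc_unif_conv D fs f" and K: "compact K" "K \<subseteq> D" and "0 < e"
  shows "\<forall>\<^sub>F m in sequentially. \<forall>y\<in>K. chordal (fs m y) (f y) < e"
proof -
  have "\<forall>x\<in>D. \<exists>r. 0 < r \<and> (\<forall>\<^sub>F m in sequentially. \<forall>y\<in>ball x r. chordal (fs m y) (f y) < e)"
    using conv \<open>0 < e\<close> unfolding loc_unif_conv_def by blast
  from bchoice[OF this] obtain r where
    r: "\<forall>x\<in>D. 0 < r x \<and> (\<forall>\<^sub>F m in sequentially. \<forall>y\<in>ball x (r x). chordal (fs m y) (f y) < e)" ..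
  have "x \<in> ball x (r x)" if "x \<in> K" for x using r K(2) that by auto
  then have "K \<subseteq> (\<Union>x\<in>K. ball x (r x))" by blast
  then obtain T where T: "T \<subseteq> K" "finite T" "K \<subseteq> (\<Union>x\<in>T. ball x (r x))"
    by (rule compactE_image[OF K(1), rotated]) auto
  have "\<forall>\<^sub>F m in sequentially. \<forall>x\<in>T. \<forall>y\<in>ball x (r x). chordal (fs m y) (f y) < e"
    by (rule eventually_ball_finite[OF T(2)]) (use T(1) K(2) r in blast)
  then show ?thesis by eventually_elim (use T(3) in blast)
qed

lemma loc_unif_conv_pointwise:
  assumes "loc_unif_conv D fs f" "x \<in> D" "0 < e"
  shows "\<forall>\<^sub>F m in sequentially. chordal (fs m x) (f x) < e"
  using loc_unif_conv_compact[OF assms(1), of "{x}" e] assms(2,3) by simp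

lemma loc_unif_conv_continuous:
  assumes conv: "loc_unif_conv D fs f" and cont: "\<And>m. continuous_on D (\<lambda>x. stereo (fs m x))" and "open D"
  shows "continuous_on D (\<lambda>x. stereo (f x))"
proof -
  have "isCont (\<lambda>x. stereo (f x)) x" if x: "x \<in> D" for x
  proof -
    obtain r where r: "0 < r" "ball x r \<subseteq> D"
      "\<And>e. 0 < e \<Longrightarrow> \<forall>\<^sub>F m in sequentially. \<forall>y\<in>ball x r. chordal (fs m y) (f y) < e"
      using conv x unfolding loc_unif_conv_def by blast
    have "uniform_limit (ball x r) (\<lambda>m y. stereo (fs m y)) (\<lambda>y. stereo (f y)) sequentially"
      unfolding uniform_limit_iff using r(3) by (simp add: chordal_eq_dist)
    moreover have "\<forall>\<^sub>F m in sequentially. continuous_on (ball x r) (\<lambda>y. stereo (fs m y))"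
      using cont continuous_on_subset[OF _ r(2)] by (intro always_eventually) blast
    ultimately have "continuous_on (ball x r) (\<lambda>y. stereo (f y))"
      by (intro uniform_limit_theorem[of _ _ sequentially]) auto
    then show ?thesis using r(1) by (simp add: continuous_on_eq_continuous_at)
  qed
  then show ?thesis by (intro continuous_at_imp_continuous_on) blast
qed

text \<open>Each of the two sets gets one point sent near \<open>p\<close> and one sent away from
  it: \<open>z\<close> and \<open>u\<close> in the inner ball, \<open>x\<close> and \<open>w\<close>
  outside the outer ball. Non-constancy near \<open>z\<close> supplies both \<open>w\<close> and
  \<open>u\<close>.\<close>

lemma limit_separates_point:
  fixes D :: "(real^'n::finite) set"
  assumes card: "2 \<le> CARD('n)" and D: "open D" "connected D"
    and Q: "\<And>K. compact K \<Longrightarrow> K \<subseteq> D \<Longrightarrow> (\<integral>\<^sup>+ x. indicator K x * Q x \<partial>lebesgue) < \<infinity>"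
    and Qm: "Q \<in> borel_measurable lebesgue"
    and fs: "\<And>m. homeo_into D (fs m)" "\<And>m x0. x0 \<in> D \<Longrightarrow> ring_Q_ineq D Q (fs m) x0"
    and conv: "loc_unif_conv D fs f"
    and z: "z \<in> D" "\<And>r. 0 < r \<Longrightarrow> \<exists>u\<in>D. dist z u < r \<and> f u \<noteq> f z"
    and x: "x \<in> D" "x \<noteq> z"
  shows "f x \<noteq> f z"
proof
  assume eq: "f x = f z"
  define p where "p = f z"
  have emb: "ext_embedding D (fs m)" for m by (rule ext_embedding_homeo_into[OF card D(1) fs(1)])
  obtain R0 where R0: "0 < R0" "ball z R0 \<subseteq> D" using D(1) z(1) open_contains_ball by blast
  obtain w where w: "w \<in> D" "f w \<noteq> p" using z(2)[OF R0(1)] by (auto simp: p_def)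
  have "w \<noteq> z" using w(2) by (auto simp: p_def)
  \<comment> \<open>The radii are fixed after \<open>w\<close>, to leave \<open>x\<close> and
    \<open>w\<close> outside, and before \<open>u\<close>, which is then found inside the inner
    ball.\<close>
  define r2 where "r2 = min R0 (min (dist z x) (dist z w)) / 2"
  define r1 where "r1 = r2 / 2"
  have r: "0 < r1" "r1 < r2" "r2 < R0" "r2 < dist z x" "r2 < dist z w"
  proof -
    define \<mu> where "\<mu> = min R0 (min (dist z x) (dist z w))"
    have "0 < dist z x" "0 < dist z w" using x(2) \<open>w \<noteq> z\<close> by auto
    then have "0 < \<mu>" "\<mu> \<le> R0" "\<mu> \<le> dist z x" "\<mu> \<le> dist z w" using R0(1) by (simp_all add: \<mu>_def)
    moreover have "r2 = \<mu> / 2" by (simp add: r2_def \<mu>_def)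
    ultimately show "0 < r1" "r1 < r2" "r2 < R0" "r2 < dist z x" "r2 < dist z w"
      unfolding r1_def by linarith+
  qed
  have "cball z r2 \<subseteq> ball z R0" using r(3) by auto
  then have cD: "cball z r2 \<subseteq> D" using R0(2) by blast
  obtain u where u: "u \<in> D" "dist z u < r1" "f u \<noteq> p" using z(2)[OF r(1)] by (auto simp: p_def)
  define c where "c = min (chordal (f u) p) (chordal (f w) p) / 2"
  have c: "0 < c" "2 * c \<le> chordal (f u) p" "2 * c \<le> chordal (f w) p"
  proof -
    have "chordal (f u) p \<noteq> 0" "chordal (f w) p \<noteq> 0" using u(3) w(2) by simp_all
    then have "0 < chordal (f u) p" "0 < chordal (f w) p"
      using chordal_nonneg[of "f u" p] chordal_nonneg[of "f w" p] by linarith+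
    then show "0 < c" by (simp add: c_def)
  qed (simp_all add: c_def)
  \<comment> \<open>The constant \<eta> of integral 1. It yields a bound \<open>I\<close> that is
    the same for all \<open>m\<close>, and finite by local integrability of
    \<open>Q\<close>.\<close>
  define k where "k = 1 / (r2 - r1)"
  have k: "0 < k" using r by (simp add: k_def)
  define I where "I = (\<integral>\<^sup>+ y. indicator ({y. r1 < dist y z \<and> dist y z < r2} \<inter> D) y * Q y * ennreal k ^ CARD('n) \<partial>lebesgue)"
  have "I \<le> (\<integral>\<^sup>+ y. (indicator (cball z r2) y * Q y) * ennreal k ^ CARD('n) \<partial>lebesgue)"
    unfolding I_def by (intro nn_integral_mono mult_right_mono) (auto simp: indicator_def dist_commute)
  also have "\<dots> = (\<integral>\<^sup>+ y. indicator (cball z r2) y * Q y \<partial>lebesgue) * ennreal k ^ CARD('n)"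
    by (intro nn_integral_multc borel_measurable_times_ennreal borel_measurable_indicator Qm) simp
  also have "\<dots> < \<infinity>" using Q[OF compact_cball cD] ennreal_less_top[of "k ^ CARD('n)"] k
    by (simp add: ennreal_mult_less_top ennreal_power)
  finally have "I \<noteq> \<infinity>" by simp
  then obtain i where i: "I = ennreal i" "0 \<le> i" by (cases I) auto
  have up: "modulus ((\<lambda>\<gamma>. fs m \<circ> \<gamma>) ` path_fam (sphere z r1) (sphere z r2) D) \<le> I" for m
  proof -
    have "r2 < dist z y" if "y \<in> frontier D" for y
    proof -
      have "y \<notin> D" using that D(1) by (simp add: frontier_def interior_open)
      then have "y \<notin> cball z r2" using cD by blast
      then show ?thesis by simp
    qed
    moreover have "(\<integral>\<^sup>+ t. indicator {r1<..<r2} t * ennreal k \<partial>lebesgue) \<ge> 1"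
    proof -
      have "(\<integral>\<^sup>+ t. indicator {r1<..<r2} t * ennreal k \<partial>lebesgue) = ennreal k * ennreal (r2 - r1)"
        using r by (subst mult.commute) (simp add: nn_integral_cmult_indicator)
      also have "\<dots> = 1" using r by (simp add: k_def flip: ennreal_mult)
      finally show ?thesis by simp
    qed
    ultimately show ?thesis
      using fs(2)[OF z(1), of m, unfolded ring_Q_ineq_def, rule_format, of r1 r2 "\<lambda>_. ennreal k"] r
      unfolding I_def by simp
  qed
  obtain c0 where c0: "0 < c0"
    "\<And>E F x0 s N. 0 < s \<Longrightarrow> (\<And>r. r \<in> {s..<s * 4 ^ N} \<Longrightarrow> (\<exists>e\<in>E. dist x0 e = r) \<and> (\<exists>f\<in>F. dist x0 f = r)) \<Longrightarrow>
      ennreal (real N * c0) \<le> modulus ((\<lambda>\<beta>::real \<Rightarrow> real^'n. Some \<circ> \<beta>) ` path_fam E F UNIV)"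
    using modulus_ge_of_common_spheres[OF card] by blast
  obtain N :: nat where N: "i < real N * c0" using reals_Archimedean3[OF c0(1)] by blast
  obtain x0 :: "real^'n" and s \<epsilon> :: real where s: "0 < s" "0 < \<epsilon>"
    "\<And>S y1 y2 r. connected S \<Longrightarrow> y1 \<in> S \<Longrightarrow> y2 \<in> S \<Longrightarrow> chordal (Some y1) p < \<epsilon> \<Longrightarrow> c \<le> chordal (Some y2) p \<Longrightarrow>
      r \<in> {s..<s * 4 ^ N} \<Longrightarrow> \<exists>e\<in>S. dist x0 e = r"
    using exists_centre_meeting_spheres[OF card c(1), where p=p and N=N] by metis
  \<comment> \<open>\<open>N\<close> depends on \<open>I\<close>, \<epsilon> on \<open>N\<close>,
    and \<open>m\<close> on \<epsilon>, so the uniform bound is beaten. Half of each tolerance pays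
    for convergence, the other half for moving to a finite image point; the factor 2 in the choice
    of \<open>c\<close> serves the same end.\<close>
  have "\<forall>\<^sub>F m in sequentially. chordal (fs m z) (f z) < \<epsilon> / 2 \<and> chordal (fs m x) (f x) < \<epsilon> / 2 \<and>
      chordal (fs m u) (f u) < c / 2 \<and> chordal (fs m w) (f w) < c / 2"
    using s(2) c(1) by (intro eventually_conj loc_unif_conv_pointwise[OF conv] z x u w) auto
  then obtain m where "chordal (fs m z) (f z) < \<epsilon> / 2 \<and> chordal (fs m x) (f x) < \<epsilon> / 2 \<and>
      chordal (fs m u) (f u) < c / 2 \<and> chordal (fs m w) (f w) < c / 2"
    using eventually_happens'[OF sequentially_bot] by blast
  then have m: "chordal (fs m z) p < \<epsilon> / 2" "chordal (fs m x) p < \<epsilon> / 2"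
      "chordal (fs m u) (f u) < c / 2" "chordal (fs m w) (f w) < c / 2"
    by (simp_all add: eq p_def)
  interpret g: ext_embedding D "fs m" by (rule emb)
  have meets: "\<exists>e\<in>{y. Some y \<in> fs m ` V}. dist x0 e = r"
    if V: "open V" "connected V" "V \<subseteq> D" "v1 \<in> V" "v2 \<in> V"
      and near: "chordal (fs m v1) p < \<epsilon> / 2" and far: "chordal (fs m v2) (f v2) < c / 2" "2 * c \<le> chordal (f v2) p"
      and r: "r \<in> {s..<s * 4 ^ N}" for V v1 v2 r
  proof -
    obtain y1 where y1: "Some y1 \<in> fs m ` V" "chordal (Some y1) (fs m v1) < \<epsilon> / 2"
      using g.exists_image_point_near[OF V(1,3,4), of "\<epsilon> / 2"] s(2) by auto
    obtain y2 where y2: "Some y2 \<in> fs m ` V" "chordal (Some y2) (fs m v2) < c / 2"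
      using g.exists_image_point_near[OF V(1,3,5), of "c / 2"] c(1) by auto
    have "chordal (Some y1) p < \<epsilon>" using y1(2) near chordal_triangle[of "Some y1" p "fs m v1"] by linarith
    moreover have "c \<le> chordal (Some y2) p"
      using y2(2) far chordal_triangle[of "f v2" p "fs m v2"] chordal_triangle[of "fs m v2" p "Some y2"]
        chordal_commute[of "f v2" "fs m v2"] chordal_commute[of "fs m v2" "Some y2"] by linarith
    moreover have "y1 \<in> {y. Some y \<in> fs m ` V}" "y2 \<in> {y. Some y \<in> fs m ` V}" using y1(1) y2(1) by simp_all
    ultimately show ?thesis using s(3)[OF g.connected_image[OF V(1,2,3)], of y1 y2 r] r by blast
  qed
  have V1: "open (ball z r1)" "connected (ball z r1)" "ball z r1 \<subseteq> D" "z \<in> ball z r1" "u \<in> ball z r1"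
    using r u cD by auto
  have V2: "open (D - cball z r2)" "connected (D - cball z r2)" "D - cball z r2 \<subseteq> D" "x \<in> D - cball z r2" "w \<in> D - cball z r2"
  proof -
    show "connected (D - cball z r2)"
      using connected_open_diff_cball[OF D cD] card r by simp
  qed (use r x w D in auto)
  have "ennreal (real N * c0) \<le> modulus ((\<lambda>\<beta>. Some \<circ> \<beta>) `
      path_fam {y. Some y \<in> fs m ` ball z r1} {y. Some y \<in> fs m ` (D - cball z r2)} UNIV)"
  proof (rule c0(2)[OF s(1), where ?x0.0=x0], rule conjI)
    fix r assume r: "r \<in> {s..<s * 4 ^ N}"
    show "\<exists>e\<in>{y. Some y \<in> fs m ` ball z r1}. dist x0 e = r" by (rule meets[OF V1 m(1,3) c(2) r])
    show "\<exists>f\<in>{y. Some y \<in> fs m ` (D - cball z r2)}. dist x0 f = r" by (rule meets[OF V2 m(2,4) c(3) r])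
  qed
  also have "\<dots> \<le> I" using g.modulus_image_ring_ge[OF z(1) r(1,2) cD] up order_trans by blast
  finally have "real N * c0 \<le> i" using i c0(1) by (subst (asm) i(1)) (simp add: ennreal_le_iff)
  with N show False by simp
qed

text \<open>If \<open>f\<close> were constant near \<open>v\<close>, take a boundary point
  \<open>w\<close> in \<open>D\<close> of the open set \<open>W\<close> where \<open>f\<close> is
  locally equal to \<open>f v\<close>. By continuity \<open>f w = f v\<close>, yet \<open>f\<close>
  is not constant near \<open>w\<close>, so \<open>w\<close> and \<open>v\<close> must be separated.
  Such a \<open>w\<close> exists since \<open>f a \<noteq> f b\<close> keeps \<open>W\<close> from
  being all of \<open>D\<close>.\<close>

lemma limit_inj_on:
  fixes D :: "(real^'n::finite) set"
  assumes card: "2 \<le> CARD('n)" and D: "open D" "connected D"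
    and Q: "\<And>K. compact K \<Longrightarrow> K \<subseteq> D \<Longrightarrow> (\<integral>\<^sup>+ x. indicator K x * Q x \<partial>lebesgue) < \<infinity>"
    and Qm: "Q \<in> borel_measurable lebesgue"
    and fs: "\<And>m. homeo_into D (fs m)" "\<And>m x0. x0 \<in> D \<Longrightarrow> ring_Q_ineq D Q (fs m) x0"
    and conv: "loc_unif_conv D fs f"
    and cont: "continuous_on D (\<lambda>x. stereo (f x))" and ne: "a \<in> D" "b \<in> D" "f a \<noteq> f b"
  shows "inj_on f D"
proof -
  have separates: "f x \<noteq> f z"
    if "z \<in> D" "\<And>r. 0 < r \<Longrightarrow> \<exists>u\<in>D. dist z u < r \<and> f u \<noteq> f z" "x \<in> D" "x \<noteq> z" for x z
    by (rule limit_separates_point[where D=D and Q=Q and fs=fs and f=f]; fact)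
  have nonconst: "\<exists>u\<in>D. dist v u < r \<and> f u \<noteq> f v" if v: "v \<in> D" and r: "0 < r" for v r
  proof (rule ccontr)
    assume n: "\<not> (\<exists>u\<in>D. dist v u < r \<and> f u \<noteq> f v)"
    define P where "P y \<longleftrightarrow> f y = f v" for y
    define W where "W = {x\<in>D. \<exists>r>0. \<forall>y\<in>D. dist x y < r \<longrightarrow> P y}"
    have "\<forall>y\<in>D. dist v y < r \<longrightarrow> P y" using n unfolding P_def by blast
    with v r have "v \<in> W" unfolding W_def mem_Collect_eq by (intro conjI exI[of _ r])
    have Wf: "f y = f v" if "y \<in> W" for y
    proof -
      have y: "y \<in> D" "\<exists>\<delta>>0. \<forall>y'\<in>D. dist y y' < \<delta> \<longrightarrow> P y'" using that unfolding W_def mem_Collect_eq by (rule conjunct1, rule conjunct2)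
      from y(2) obtain \<delta> where \<delta>: "0 < \<delta>" "\<forall>y'\<in>D. dist y y' < \<delta> \<longrightarrow> P y'" by (elim exE conjE)
      have "dist y y < \<delta>" using \<delta>(1) by simp
      then have "P y" by (rule \<delta>(2)[rule_format, OF y(1)])
      then show ?thesis unfolding P_def .
    qed
    have "open W" unfolding open_contains_ball
    proof
      fix y assume "y \<in> W"
      then obtain r where r: "y \<in> D" "0 < r" "\<And>y'. y' \<in> D \<Longrightarrow> dist y y' < r \<Longrightarrow> P y'" unfolding W_def by blast
      obtain r' where r': "0 < r'" "ball y r' \<subseteq> D" using D(1) r(1) open_contains_ball by blast
      have "ball y (min r' (r / 2)) \<subseteq> W"
      proof
        fix x assume x: "x \<in> ball y (min r' (r / 2))"
        then have "x \<in> D" using r'(2) by auto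
        moreover have "P y'" if "y' \<in> D" "dist x y' < r / 2" for y'
          using r(3)[OF that(1)] dist_triangle[of y y' x] x that(2) by simp
        moreover have "0 < r / 2" using r(2) by simp
        ultimately show "x \<in> W" unfolding W_def by blast
      qed
      then show "\<exists>e>0. ball y e \<subseteq> W" using r' r(2) by (intro exI[of _ "min r' (r / 2)"]) simp
    qed
    have "D \<inter> frontier W \<noteq> {}"
    proof (rule connected_Int_frontier[OF D(2)])
      show "D \<inter> W \<noteq> {}" using \<open>v \<in> W\<close> v by blast
      show "D - W \<noteq> {}"
      proof
        assume "D - W = {}"
        then have "a \<in> W" "b \<in> W" using ne by blast+
        then show False using Wf[of a] Wf[of b] ne(3) by simp
      qed
    qed
    then obtain w where w: "w \<in> D" "w \<in> closure W" "w \<notin> W"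
      unfolding frontier_def interior_open[OF \<open>open W\<close>] by blast
    have fw: "f w = f v"
    proof (rule ccontr)
      assume "f w \<noteq> f v"
      then have "chordal (f v) (f w) \<noteq> 0" by simp
      then have "0 < chordal (f v) (f w)" using chordal_nonneg[of "f v" "f w"] by linarith
      then obtain d where d: "0 < d" "\<And>y. y \<in> D \<Longrightarrow> dist y w < d \<Longrightarrow> chordal (f y) (f w) < chordal (f v) (f w)"
        using cont[unfolded continuous_on_stereo_iff, rule_format, OF w(1)] by blast
      obtain y where y: "y \<in> W" "dist y w < d" using w(2) d(1) unfolding closure_approachable by blast
      have "y \<in> D" using y(1) unfolding W_def by blast
      then show False using d(2)[OF _ y(2)] Wf[OF y(1)] by simp
    qed
    have nc: "\<exists>u\<in>D. dist w u < r \<and> f u \<noteq> f w" if "0 < r" for r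
      using w(1,3) that unfolding W_def P_def fw by blast
    have "v \<noteq> w" using \<open>v \<in> W\<close> w(3) by blast
    from separates[OF w(1) nc v this] fw show False by simp
  qed
  show ?thesis
  proof (rule inj_onI, rule ccontr)
    fix x z assume "x \<in> D" "z \<in> D" "f x = f z" "x \<noteq> z"
    then show False using separates[OF \<open>z \<in> D\<close> nonconst[OF \<open>z \<in> D\<close>] \<open>x \<in> D\<close> \<open>x \<noteq> z\<close>] by simp
  qed
qed

subsection \<open>The ring inequality for the limit\<close>

text \<open>Scaling by \<open>k\<close> matches the simple functions below the two integrands,
  whatever \<open>f\<close> is. It will be applied to an integrand containing
  \<open>\<eta> (dist x x0)\<close>, with \<eta> only Lebesgue measurable.\<close>

lemma nn_integral_cmult_le:
  assumes "0 < k"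
  shows "(\<integral>\<^sup>+ x. ennreal k * f x \<partial>M) \<le> ennreal k * (\<integral>\<^sup>+ x. f x \<partial>M)"
  unfolding nn_integral_def[of M "\<lambda>x. ennreal k * f x"]
proof (rule SUP_least)
  fix g assume "g \<in> {g. simple_function M g \<and> g \<le> (\<lambda>x. ennreal k * f x)}"
  then have g: "simple_function M g" "\<And>x. g x \<le> ennreal k * f x" by (auto simp: le_fun_def)
  define h where "h x = ennreal (1 / k) * g x" for x
  have inv: "ennreal k * ennreal (1 / k) = 1" "ennreal (1 / k) * ennreal k = 1"
    using assms by (simp_all flip: ennreal_mult)
  have h: "simple_function M h" unfolding h_def by (intro simple_function_mult simple_function_const g(1))
  have "integral\<^sup>S M g = (\<integral>\<^sup>+ x. ennreal k * h x \<partial>M)"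
    unfolding h_def by (simp add: mult.assoc[symmetric] inv nn_integral_eq_simple_integral[OF g(1)])
  also have "\<dots> = ennreal k * (\<integral>\<^sup>+ x. h x \<partial>M)"
    by (rule nn_integral_cmult[OF borel_measurable_simple_function[OF h]])
  also have "\<dots> \<le> ennreal k * (\<integral>\<^sup>+ x. f x \<partial>M)"
  proof (intro mult_left_mono nn_integral_mono)
    fix x
    have "h x \<le> ennreal (1 / k) * (ennreal k * f x)" unfolding h_def by (intro mult_left_mono g(2)) simp
    then show "h x \<le> f x" by (simp add: mult.assoc[symmetric] inv)
  qed simp
  finally show "integral\<^sup>S M g \<le> ennreal k * (\<integral>\<^sup>+ x. f x \<partial>M)" .
qed

lemma cball_subset_of_frontier:
  assumes "x0 \<in> D" "0 < r" "\<forall>y\<in>frontier D. r < dist x0 y"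
  shows "cball x0 r \<subseteq> (D :: 'a::euclidean_space set)"
proof (rule ccontr)
  assume "\<not> cball x0 r \<subseteq> D"
  then have "cball x0 r - D \<noteq> {}" by blast
  moreover have "x0 \<in> cball x0 r \<inter> D" using assms(1,2) by simp
  then have "cball x0 r \<inter> D \<noteq> {}" by blast
  ultimately have "cball x0 r \<inter> frontier D \<noteq> {}" by (intro connected_Int_frontier connected_cball)
  then obtain y where "y \<in> frontier D" "dist x0 y \<le> r" by auto
  then show False using assms(3) by force
qed

text \<open>Continuity from below of the measure with density \<eta> along open intervals exhausting
  the given one.\<close>

lemma exists_shrunk_interval:
  fixes \<eta> :: "real \<Rightarrow> ennreal"
  assumes \<eta>: "\<eta> \<in> borel_measurable lebesgue" and t: "t < (\<integral>\<^sup>+ r. indicator {r1<..<r2} r * \<eta> r \<partial>lebesgue)" and e: "0 < e"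
  obtains \<epsilon> where "0 < \<epsilon>" "\<epsilon> < e" "t < (\<integral>\<^sup>+ r. indicator {r1 + \<epsilon><..<r2 - \<epsilon>} r * \<eta> r \<partial>lebesgue)"
proof -
  define \<nu> where "\<nu> = density lebesgue \<eta>"
  have \<nu>: "emeasure \<nu> {a<..<b} = (\<integral>\<^sup>+ r. indicator {a<..<b} r * \<eta> r \<partial>lebesgue)" for a b :: real
    unfolding \<nu>_def by (subst emeasure_density[OF \<eta>]) (simp_all add: mult.commute)
  \<comment> \<open>The shift by 2 keeps the margin positive and strictly below \<open>e\<close>
    already at \<open>k = 0\<close>.\<close>
  define A where "A k = {r1 + e / (real k + 2)<..<r2 - e / (real k + 2)}" for k
  have pos: "0 < e / (real k + 2)" for k using e by simp
  have dec: "e / (real l + 2) \<le> e / (real k + 2)" if "k \<le> l" for k l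
    using that e by (intro divide_left_mono) auto
  have "incseq A"
  proof (rule incseq_SucI)
    fix k show "A k \<subseteq> A (Suc k)" using dec[of k "Suc k"] unfolding A_def by fastforce
  qed
  moreover have "range A \<subseteq> sets \<nu>" unfolding A_def \<nu>_def by auto
  ultimately have "(SUP k. emeasure \<nu> (A k)) = emeasure \<nu> (\<Union>k. A k)" by (intro SUP_emeasure_incseq)
  also have "(\<Union>k. A k) = {r1<..<r2}"
  proof (intro set_eqI iffI)
    fix x assume "x \<in> (\<Union>k. A k)"
    then obtain k where "x \<in> A k" by blast
    then show "x \<in> {r1<..<r2}" using pos[of k] unfolding A_def by auto
  next
    fix x assume x: "x \<in> {r1<..<r2}"
    define d where "d = min (x - r1) (r2 - x)"
    have d: "0 < d" "d \<le> x - r1" "d \<le> r2 - x" using x by (auto simp: d_def)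
    obtain k :: nat where "e < real k * d" using reals_Archimedean3[OF d(1)] by blast
    also have "\<dots> \<le> (real k + 2) * d" using d(1) by (intro mult_right_mono) auto
    finally have "e / (real k + 2) < d" by (simp add: divide_less_eq mult.commute)
    then have "x \<in> A k" using d unfolding A_def by auto
    then show "x \<in> (\<Union>k. A k)" by blast
  qed
  finally have "t < (SUP k. emeasure \<nu> (A k))" using t by (simp add: \<nu>)
  then obtain k where k: "t < emeasure \<nu> (A k)" unfolding less_SUP_iff by blast
  show thesis
  proof (rule that[of "e / (real k + 2)"])
    show "e / (real k + 2) < e" using e by (simp add: divide_less_eq)
    show "t < (\<integral>\<^sup>+ r. indicator {r1 + e / (real k + 2)<..<r2 - e / (real k + 2)} r * \<eta> r \<partial>lebesgue)"
      using k unfolding A_def \<nu> .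
  qed (rule pos)
qed

text \<open>On \<open>cball x0 r2\<close> the map \<open>inv_into D (fs m) \<circ> f\<close> is defined and moves points by at most \<open>\<epsilon>\<close>.\<close>
lemma modulus_limit_ring_le:
  fixes D :: "(real^'n::finite) set"
  assumes f: "ext_embedding D f" and fs: "\<And>m. ext_embedding D (fs m)" and conv: "loc_unif_conv D fs f"
    and \<epsilon>: "0 < \<epsilon>" "cball x0 (r2 + \<epsilon>) \<subseteq> D" and r: "0 < r1" "r1 + \<epsilon> < r2 - \<epsilon>"
  shows "\<exists>m. modulus ((\<lambda>\<gamma>. f \<circ> \<gamma>) ` path_fam (sphere x0 r1) (sphere x0 r2) D)
      \<le> modulus ((\<lambda>\<gamma>. fs m \<circ> \<gamma>) ` path_fam (sphere x0 (r1 + \<epsilon>)) (sphere x0 (r2 - \<epsilon>)) D)"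
proof -
  interpret f: ext_embedding D f by (rule f)
  define K where "K = cball x0 (r2 + \<epsilon>)"
  have K: "compact K" "K \<subseteq> D" using \<epsilon>(2) by (simp_all add: K_def)
  have near: "y \<in> K" if "dist x0 x \<le> r2" "dist x y \<le> \<epsilon>" for x y
    using that dist_triangle[of x0 y x] by (simp add: K_def)
  \<comment> \<open>Pairs at distance exactly \<epsilon>. By compactness and injectivity of
    \<open>f\<close>, the chordal distance of their images has a positive minimum \<open>c\<close>,
    uniformly in the centre.\<close>
  define S where "S = (cball x0 r2 \<times> K) \<inter> {p. dist (fst p) (snd p) = \<epsilon>}"
  have "compact S" unfolding S_def
    by (intro compact_Int_closed compact_Times compact_cball K(1) closed_Collect_eq continuous_intros)
  have SD: "fst p \<in> D" "snd p \<in> D" if "p \<in> S" for p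
  proof -
    have "dist x0 (fst p) \<le> r2" "snd p \<in> K" using that by (auto simp: S_def)
    then show "fst p \<in> D" "snd p \<in> D" using near[of "fst p" "fst p"] K(2) \<epsilon>(1) by auto
  qed
  obtain w where "dist x0 w = \<epsilon>" using vector_choose_dist[of \<epsilon> x0] \<epsilon>(1) by auto
  then have "(x0, w) \<in> S" using near[of x0 w] r \<epsilon>(1) by (simp add: S_def)
  then have "S \<noteq> {}" by blast
  have "continuous_on S (\<lambda>p. stereo (f (fst p)))" "continuous_on S (\<lambda>p. stereo (f (snd p)))"
    by (rule continuous_on_compose2[OF f.cont], intro continuous_intros, use SD in blast)+
  then have "continuous_on S (\<lambda>p. chordal (f (fst p)) (f (snd p)))"
    unfolding chordal_eq_dist by (rule continuous_on_dist)
  from continuous_attains_inf[OF \<open>compact S\<close> \<open>S \<noteq> {}\<close> this] obtain q where q: "q \<in> S"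
    "\<And>p. p \<in> S \<Longrightarrow> chordal (f (fst q)) (f (snd q)) \<le> chordal (f (fst p)) (f (snd p))"
    by blast
  define c where "c = chordal (f (fst q)) (f (snd q))"
  have "fst q \<noteq> snd q" using q(1) \<epsilon>(1) by (auto simp: S_def)
  then have "f (fst q) \<noteq> f (snd q)" using inj_onD[OF f.inj _ SD[OF q(1)]] by blast
  then have "c \<noteq> 0" by (simp add: c_def)
  moreover have "0 \<le> c" by (simp add: c_def)
  ultimately have c: "0 < c" by linarith
  \<comment> \<open>Within \<open>c / 2\<close> of \<open>f\<close>, the map \<open>fs m\<close>
    sends every sphere of radius \<epsilon> to chordal distance at least \<open>c / 2\<close> from
    \<open>f x\<close>, and its centre closer than that. So \<open>f x\<close> lies in the image of
    the ball.\<close>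
  have "\<forall>\<^sub>F m in sequentially. \<forall>y\<in>K. chordal (fs m y) (f y) < c / 2"
    by (rule loc_unif_conv_compact[OF conv K]) (use c in simp)
  then obtain m where m: "\<And>y. y \<in> K \<Longrightarrow> chordal (fs m y) (f y) < c / 2"
    using eventually_happens'[OF sequentially_bot] by blast
  interpret g: ext_embedding D "fs m" by (rule fs)
  have img: "f x \<in> fs m ` cball x \<epsilon>" if x: "dist x0 x \<le> r2" for x
  proof (rule g.chordal_ball_subset_image[where p="f x" and c="c / 2"])
    have xK: "x \<in> K" using near[of x x] x \<epsilon>(1) by simp
    then show "x \<in> D" using K(2) by blast
    show "cball x \<epsilon> \<subseteq> D" using near[OF x] K(2) by auto
    show "chordal (fs m x) (f x) < c / 2" by (rule m[OF xK])
    show "chordal (f x) (f x) < c / 2" using c by simp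
    fix y assume y: "y \<in> sphere x \<epsilon>"
    then have "y \<in> K" using near[OF x] by simp
    then have "c \<le> chordal (f x) (f y)" using q(2)[of "(x, y)"] x y by (simp add: S_def c_def)
    then show "c / 2 \<le> chordal (fs m y) (f x)"
      using m[OF \<open>y \<in> K\<close>] chordal_triangle[of "f x" "f y" "fs m y"]
        chordal_commute[of "f x" "fs m y"] by linarith
  qed (rule \<epsilon>(1))
  have ball_sub: "cball x \<epsilon> \<subseteq> D" if "dist x0 x \<le> r2" for x using near[OF that] K(2) by auto
  have "modulus ((\<lambda>\<gamma>. f \<circ> \<gamma>) ` path_fam (sphere x0 r1) (sphere x0 r2) D)
      \<le> modulus ((\<lambda>\<gamma>. fs m \<circ> \<gamma>) ` path_fam (sphere x0 (r1 + \<epsilon>)) (sphere x0 (r2 - \<epsilon>)) D)"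
  proof (rule modulus_mono_subpath, rule conjI)
    fix \<gamma>' assume "\<gamma>' \<in> (\<lambda>\<gamma>. f \<circ> \<gamma>) ` path_fam (sphere x0 r1) (sphere x0 r2) D" and rect: "rectifiable_ext \<gamma>'"
    then obtain \<gamma> where \<gamma>': "\<gamma>' = f \<circ> \<gamma>" and \<gamma>: "continuous_on {0..1} \<gamma>" "dist x0 (\<gamma> 0) = r1" "dist x0 (\<gamma> 1) = r2"
      "\<forall>t\<in>{0<..<1}. \<gamma> t \<in> D" unfolding path_fam_def by auto
    have \<gamma>D: "\<gamma> t \<in> D" if t: "t \<in> {0..1}" for t
    proof (cases "t \<in> {0<..<1}")
      case False
      then have "t = 0 \<or> t = 1" using t by auto
      then have "dist x0 (\<gamma> t) \<le> r2" using \<gamma>(2,3) r \<epsilon>(1) by auto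
      then show ?thesis using near[of "\<gamma> t" "\<gamma> t"] K(2) \<epsilon>(1) by auto
    qed (use \<gamma>(4) in blast)
    have cf: "continuous_on {0..1} (\<lambda>t. stereo (f (\<gamma> t)))"
      by (rule continuous_on_compose2[OF f.cont \<gamma>(1)]) (use \<gamma>D in auto)
    have "continuous_on {0..1} (\<lambda>t. the (f (\<gamma> t)))"
      by (rule continuous_on_the[OF cf]) (use rect in \<open>simp add: rectifiable_ext_def \<gamma>'\<close>)
    then show "continuous_on {0..1} (the \<circ> \<gamma>')" by (simp add: \<gamma>' o_def)
    have cd: "continuous_on {0..1} (\<lambda>t. dist x0 (\<gamma> t))" by (intro continuous_intros \<gamma>(1))
    \<comment> \<open>\<gamma> may wander anywhere in \<open>D\<close>; up to its first arrival at
      the outer sphere it stays in \<open>cball x0 r2\<close>, where the lift is controlled.\<close>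
    define T where "T = {0..1} \<inter> (\<lambda>t. dist x0 (\<gamma> t)) -` {r2}"
    have "closed T" unfolding T_def by (rule continuous_closed_preimage[OF cd]) auto
    moreover have "bounded T" by (rule bounded_subset[of "{0..1}"]) (auto simp: T_def)
    ultimately have "compact T" by (simp add: compact_eq_bounded_closed)
    moreover have "1 \<in> T" using \<gamma>(3) by (simp add: T_def)
    then have "T \<noteq> {}" by blast
    ultimately obtain u where u: "u \<in> T" "\<And>t. t \<in> T \<Longrightarrow> u \<le> t"
      using compact_attains_inf by metis
    have u01: "0 \<le> u" "u \<le> 1" "dist x0 (\<gamma> u) = r2" using u(1) by (auto simp: T_def)
    have inside: "dist x0 (\<gamma> t) \<le> r2" if t: "t \<in> {0..u}" for t
    proof (rule ccontr)
      assume n: "\<not> dist x0 (\<gamma> t) \<le> r2"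
      have "continuous_on {0..t} (\<lambda>t. dist x0 (\<gamma> t))" by (rule continuous_on_subset[OF cd]) (use t u01 in auto)
      then have "\<exists>t'\<ge>0. t' \<le> t \<and> dist x0 (\<gamma> t') = r2"
        by (intro IVT') (use n t \<gamma>(2) r \<epsilon>(1) in auto)
      then obtain t' where t': "0 \<le> t'" "t' \<le> t" "dist x0 (\<gamma> t') = r2" by blast
      then have "t' \<in> T" using t u01 by (simp add: T_def)
      then have "t = u" using u(2) t t'(2) by force
      then show False using n u01 by simp
    qed
    define \<psi> where "\<psi> t = inv_into D (fs m) (f (\<gamma> t))" for t
    have im: "f (\<gamma> t) \<in> fs m ` D" if "t \<in> {0..u}" for t
      using img[OF inside[OF that]] ball_sub[OF inside[OF that]] by blast
    have \<psi>: "dist (\<gamma> t) (\<psi> t) \<le> \<epsilon>" if t: "t \<in> {0..u}" for t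
    proof -
      obtain y where y: "y \<in> cball (\<gamma> t) \<epsilon>" "f (\<gamma> t) = fs m y" using img[OF inside[OF t]] by blast
      then have "y \<in> D" using ball_sub[OF inside[OF t]] by blast
      then have "\<psi> t = y" unfolding \<psi>_def y(2) by (rule inv_into_f_f[OF g.inj])
      then show ?thesis using y(1) by simp
    qed
    show "\<exists>a b. 0 \<le> a \<and> a < b \<and> b \<le> 1 \<and> (\<exists>\<gamma>''\<in>(\<lambda>\<gamma>. fs m \<circ> \<gamma>) ` path_fam (sphere x0 (r1 + \<epsilon>)) (sphere x0 (r2 - \<epsilon>)) D.
        \<forall>t\<in>{0..1}. \<gamma>'' t = \<gamma>' (a + (b - a) * t))"
    proof (rule crossing_subpath[where \<psi>=\<psi>])
      have "continuous_on {0..u} (\<lambda>t. stereo (f (\<gamma> t)))"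
        by (rule continuous_on_subset[OF cf]) (use u01 in auto)
      then show "continuous_on {0..u} \<psi>" unfolding \<psi>_def by (rule g.continuous_on_inv_path) (rule im)
      show "\<psi> t \<in> D" if "t \<in> {0..u}" for t unfolding \<psi>_def by (rule inv_into_into[OF im[OF that]])
      show "fs m (\<psi> t) = \<gamma>' t" if "t \<in> {0..u}" for t
        unfolding \<psi>_def \<gamma>' by (simp add: f_inv_into_f[OF im[OF that]])
      show "dist x0 (\<psi> 0) \<le> r1 + \<epsilon>"
        using \<psi>[of 0] dist_triangle[of x0 "\<psi> 0" "\<gamma> 0"] \<gamma>(2) u01 by simp
      show "r2 - \<epsilon> \<le> dist x0 (\<psi> u)"
        using \<psi>[of u] dist_triangle[of x0 "\<gamma> u" "\<psi> u"] dist_commute[of "\<gamma> u" "\<psi> u"] u01 by simp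
    qed (use u01 r in auto)
  qed
  then show ?thesis ..
qed

text \<open>On the shrunken ring \<eta> may have integral below 1. For \<open>t < 1\<close> the ring
  can be shrunk so little that the integral still exceeds \<open>t\<close>; then \<eta> divided by
  \<open>t\<close> is a valid choice at the cost of the factor \<open>1 / t ^ n\<close>, which
  disappears as \<open>t\<close> tends to 1.\<close>

lemma ring_Q_ineq_limit:
  fixes D :: "(real^'n::finite) set"
  assumes f: "ext_embedding D f" and fs: "\<And>m. ext_embedding D (fs m)" and conv: "loc_unif_conv D fs f"
    and ring: "\<And>m. ring_Q_ineq D Q (fs m) x0" and x0: "x0 \<in> D"
  shows "ring_Q_ineq D Q f x0"
  unfolding ring_Q_ineq_def
proof (intro allI impI)
  fix r1 r2 :: real and \<eta> :: "real \<Rightarrow> ennreal"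
  assume r: "0 < r1" "r1 < r2" and fr: "\<forall>y\<in>frontier D. r2 < dist x0 y" and \<eta>: "\<eta> \<in> borel_measurable lebesgue"
    and int: "1 \<le> (\<integral>\<^sup>+ r. indicator {r1<..<r2} r * \<eta> r \<partial>lebesgue)"
  define n where "n = CARD('n)"
  define M where "M = modulus ((\<lambda>\<gamma>. f \<circ> \<gamma>) ` path_fam (sphere x0 r1) (sphere x0 r2) D)"
  define I where "I = (\<integral>\<^sup>+ x. indicator ({x. r1 < dist x x0 \<and> dist x x0 < r2} \<inter> D) x * Q x * \<eta> (dist x x0) ^ n \<partial>lebesgue)"
  interpret f: ext_embedding D f by (rule f)
  have r2: "0 < r2" using r by simp
  obtain \<epsilon>0 where \<epsilon>0: "0 < \<epsilon>0" "cball x0 (r2 + \<epsilon>0) \<subseteq> D"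
    by (rule cball_subset_open_enlarge[OF f.open_D cball_subset_of_frontier[OF x0 r2 fr] r2])
  have le: "M \<le> ennreal (1 / t ^ n) * I" if t: "0 < t" "t < 1" for t
  proof -
    have "ennreal t < 1" using t by (simp add: ennreal_less_one_iff)
    then have "ennreal t < (\<integral>\<^sup>+ r. indicator {r1<..<r2} r * \<eta> r \<partial>lebesgue)" using int by (rule less_le_trans)
    then obtain \<epsilon> where \<epsilon>: "0 < \<epsilon>" "\<epsilon> < min \<epsilon>0 ((r2 - r1) / 4)"
      "ennreal t < (\<integral>\<^sup>+ r. indicator {r1 + \<epsilon><..<r2 - \<epsilon>} r * \<eta> r \<partial>lebesgue)"
      using exists_shrunk_interval[OF \<eta>, of "ennreal t" r1 r2 "min \<epsilon>0 ((r2 - r1) / 4)"] \<epsilon>0(1) r(2) by auto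
    have r': "r1 + \<epsilon> < r2 - \<epsilon>" "0 < r1 + \<epsilon>" "r2 - \<epsilon> < r2" using \<epsilon> r by auto
    have "cball x0 (r2 + \<epsilon>) \<subseteq> D" using \<epsilon>0(2) \<epsilon>(2) subset_cball[of "r2 + \<epsilon>" "r2 + \<epsilon>0" x0] by simp
    then obtain m where m: "M \<le> modulus ((\<lambda>\<gamma>. fs m \<circ> \<gamma>) ` path_fam (sphere x0 (r1 + \<epsilon>)) (sphere x0 (r2 - \<epsilon>)) D)"
      using modulus_limit_ring_le[OF f fs conv \<epsilon>(1) _ r(1) r'(1)] unfolding M_def by blast
    define \<eta>' where "\<eta>' = (\<lambda>r. ennreal (1 / t) * \<eta> r)"
    have [measurable]: "\<eta> \<in> borel_measurable lebesgue" by (rule \<eta>)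
    have \<eta>'m: "\<eta>' \<in> borel_measurable lebesgue" unfolding \<eta>'_def by measurable
    have "1 = ennreal (1 / t) * ennreal t" using t by (simp flip: ennreal_mult)
    also have "\<dots> \<le> ennreal (1 / t) * (\<integral>\<^sup>+ r. indicator {r1 + \<epsilon><..<r2 - \<epsilon>} r * \<eta> r \<partial>lebesgue)"
      by (intro mult_left_mono less_imp_le[OF \<epsilon>(3)]) simp
    also have "\<dots> = (\<integral>\<^sup>+ r. ennreal (1 / t) * (indicator {r1 + \<epsilon><..<r2 - \<epsilon>} r * \<eta> r) \<partial>lebesgue)"
      by (intro nn_integral_cmult[symmetric] borel_measurable_times_ennreal borel_measurable_indicator \<eta>) simp
    also have "\<dots> = (\<integral>\<^sup>+ r. indicator {r1 + \<epsilon><..<r2 - \<epsilon>} r * \<eta>' r \<partial>lebesgue)"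
      by (simp add: \<eta>'_def mult.left_commute)
    finally have \<eta>'1: "1 \<le> (\<integral>\<^sup>+ r. indicator {r1 + \<epsilon><..<r2 - \<epsilon>} r * \<eta>' r \<partial>lebesgue)" .
    have fr': "\<forall>y\<in>frontier D. r2 - \<epsilon> < dist x0 y" using fr r'(3) by force
    note m
    also have "modulus ((\<lambda>\<gamma>. fs m \<circ> \<gamma>) ` path_fam (sphere x0 (r1 + \<epsilon>)) (sphere x0 (r2 - \<epsilon>)) D)
      \<le> (\<integral>\<^sup>+ x. indicator ({x. r1 + \<epsilon> < dist x x0 \<and> dist x x0 < r2 - \<epsilon>} \<inter> D) x * Q x * \<eta>' (dist x x0) ^ n \<partial>lebesgue)"
      using ring[of m] r'(1,2) fr' \<eta>'m \<eta>'1 unfolding ring_Q_ineq_def n_def by blast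
    also have "\<dots> \<le> (\<integral>\<^sup>+ x. ennreal (1 / t ^ n) * (indicator ({x. r1 < dist x x0 \<and> dist x x0 < r2} \<inter> D) x * Q x * \<eta> (dist x x0) ^ n) \<partial>lebesgue)"
    proof (rule nn_integral_mono)
      fix x
      have "indicator ({x. r1 + \<epsilon> < dist x x0 \<and> dist x x0 < r2 - \<epsilon>} \<inter> D) x
          \<le> (indicator ({x. r1 < dist x x0 \<and> dist x x0 < r2} \<inter> D) x :: ennreal)"
        using \<epsilon>(1) by (auto simp: indicator_def)
      then have "indicator ({x. r1 + \<epsilon> < dist x x0 \<and> dist x x0 < r2 - \<epsilon>} \<inter> D) x * Q x * (ennreal (1 / t ^ n) * \<eta> (dist x x0) ^ n)
        \<le> indicator ({x. r1 < dist x x0 \<and> dist x x0 < r2} \<inter> D) x * Q x * (ennreal (1 / t ^ n) * \<eta> (dist x x0) ^ n)"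
        by (intro mult_right_mono) auto
      moreover have "\<eta>' (dist x x0) ^ n = ennreal (1 / t ^ n) * \<eta> (dist x x0) ^ n"
        using t by (simp add: \<eta>'_def power_mult_distrib ennreal_power power_one_over)
      ultimately show "indicator ({x. r1 + \<epsilon> < dist x x0 \<and> dist x x0 < r2 - \<epsilon>} \<inter> D) x * Q x * \<eta>' (dist x x0) ^ n
        \<le> ennreal (1 / t ^ n) * (indicator ({x. r1 < dist x x0 \<and> dist x x0 < r2} \<inter> D) x * Q x * \<eta> (dist x x0) ^ n)"
        by (simp only: mult.left_commute[of "ennreal (1 / t ^ n)"])
    qed
    also have "\<dots> \<le> ennreal (1 / t ^ n) * I" unfolding I_def by (rule nn_integral_cmult_le) (use t in simp)
    finally show ?thesis .
  qed
  have "M \<le> I"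
  proof (cases I)
    case (real i)
    \<comment> \<open>The value \<open>t = 1/2\<close> serves only to make \<open>M\<close> finite,
      so that the limit can be taken in the reals.\<close>
    have "M \<le> ennreal (1 / (1 / 2) ^ n) * I" by (rule le) auto
    also have "\<dots> < top" using real by (simp flip: ennreal_mult)
    finally obtain \<mu> where \<mu>: "M = ennreal \<mu>" "0 \<le> \<mu>" by (cases M) auto
    have "\<mu> \<le> i / t ^ n" if "0 < t" "t < 1" for t
    proof -
      have "ennreal \<mu> \<le> ennreal (i / t ^ n)"
        using le[OF that] real that by (simp add: \<mu> flip: ennreal_mult)
      then show ?thesis using real that by (simp add: ennreal_le_iff)
    qed
    then have ev: "\<forall>\<^sub>F t in at_left (1::real). \<mu> \<le> i / t ^ n"
      using eventually_at_left_real[of 0 "1::real"] by (auto elim: eventually_mono)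
    have lim: "((\<lambda>t::real. i / t ^ n) \<longlongrightarrow> i / 1 ^ n) (at_left 1)" by (intro tendsto_intros) auto
    have "\<mu> \<le> i / 1 ^ n" by (rule tendsto_lowerbound[OF lim ev]) simp
    then show ?thesis using real \<mu> by (simp add: ennreal_le_iff)
  qed simp
  then show "modulus ((\<lambda>\<gamma>. f \<circ> \<gamma>) ` path_fam (sphere x0 r1) (sphere x0 r2) D)
      \<le> (\<integral>\<^sup>+ x. indicator ({x. r1 < dist x x0 \<and> dist x x0 < r2} \<inter> D) x * Q x * \<eta> (dist x x0) ^ CARD('n) \<partial>lebesgue)"
    unfolding M_def I_def n_def .
qed

theorem theorem7:
  fixes D :: "(real^'n::finite) set" and Q :: "real^'n \<Rightarrow> ennreal"
    and a b :: "real^'n" and \<delta> :: real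
    and fs :: "nat \<Rightarrow> real^'n \<Rightarrow> 'n ext" and f :: "real^'n \<Rightarrow> 'n ext"
  assumes "CARD('n) \<ge> 2"
    and "open D" and "connected D"
    and "Q \<in> borel_measurable lebesgue"
    and "\<forall>K. compact K \<and> K \<subseteq> D \<longrightarrow> (\<integral>\<^sup>+ x. indicator K x * Q x \<partial>lebesgue) < \<infinity>"
    and "a \<in> D" and "b \<in> D" and "\<delta> > 0"
    and "\<forall>m. fs m \<in> K_class D a b Q \<delta>"
    and "loc_unif_conv D fs f"
  shows "f \<in> K_class D a b Q \<delta>"
proof -
  have K: "homeo_into D (fs m)" "\<And>x0. x0 \<in> D \<Longrightarrow> ring_Q_ineq D Q (fs m) x0" "\<delta> \<le> chordal (fs m a) (fs m b)" for m
    using assms(9) by (simp_all add: K_class_def)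
  have emb: "ext_embedding D (fs m)" for m
    by (rule ext_embedding_homeo_into[OF assms(1,2) K(1)])
  have cont: "continuous_on D (\<lambda>x. stereo (f x))"
    by (rule loc_unif_conv_continuous[OF assms(10) _ assms(2)]) (rule ext_embedding.cont[OF emb])
  have \<delta>: "\<delta> \<le> chordal (f a) (f b)"
  proof (rule field_le_epsilon)
    fix e :: real assume "0 < e"
    then have "\<forall>\<^sub>F m in sequentially. chordal (fs m a) (f a) < e / 2 \<and> chordal (fs m b) (f b) < e / 2"
      by (intro eventually_conj loc_unif_conv_pointwise[OF assms(10)] assms(6,7)) simp_all
    then obtain m where "chordal (fs m a) (f a) < e / 2" "chordal (fs m b) (f b) < e / 2"
      using eventually_happens'[OF sequentially_bot] by blast
    then show "\<delta> \<le> chordal (f a) (f b) + e"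
      using K(3)[of m] chordal_triangle[of "fs m a" "fs m b" "f a"] chordal_triangle[of "f a" "fs m b" "f b"]
        chordal_commute[of "fs m b" "f b"] by linarith
  qed
  \<comment> \<open>Positivity of \<delta> rules out a constant limit.\<close>
  then have ne: "f a \<noteq> f b" using assms(8) by auto
  have "inj_on f D"
    by (rule limit_inj_on[OF assms(1-3) _ assms(4) K(1,2) assms(10) cont assms(6,7) ne]) (use assms(5) in simp_all)
  then interpret f: ext_embedding D f
    using assms(1,2) cont by unfold_locales
  have "ring_Q_ineq D Q f x0" if "x0 \<in> D" for x0
    by (rule ring_Q_ineq_limit[OF f.ext_embedding_axioms emb assms(10) K(2)[OF that] that])
  with f.homeo_into \<delta> show ?thesis by (simp add: K_class_def)
qed

end
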